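(* There is an algorithm which, given an instance $(G,s,t,d,c,U,\Delta)$ of the gas station problem on an $n$-vertex complete graph $G$ (with distances satisfying the triangle inequalities and with an initially empty tank), solves the gas station problem with at most $\Delta$ refill stops, i.e. finds a cheapest way of travelling from $s$ to $t$ with at most $\Delta$ refill stops (or determines that no feasible way of travelling exists), in at most $O(\Delta n^2 + n^2\log n)$ steps.
   Context: An instance of the gas station problem consists of a finite complete (undirected, simple) graph $G=(V,E)$ with $n=|V|$ vertices, two specified vertices $s,t\in V$, a distance function $d:E\to\mathbb{R}^+$, a fuel cost function $c:V\to\mathbb{R}^+$, a tank capacity $U>0$, and a positive integer $\Delta$ (maximal number of refill stops). For an edge $e=uv$ write $d(u,v)=d(v,u)=d(e)$; this is the amount of gas used travelling from $u$ to $v$. The number $c(v)$ is the cost per unit of gas at $v$. Standing assumption: the triangle inequalities $d(u,v)+d(v,w)\geqslant d(u,w)$ hold for all distinct $u,v,w\in V$. A way of travelling from $s$ to $t$ consists of a route, i.e. a finite sequence of vertices $v_1,\dots,v_k$ ($k\ge 1$, $v_1=s$, $v_k=t$, consecutive vertices distinct, repetitions otherwise allowed), together with amounts $f_1,\dots,f_{k-1}\ge 0$, where $f_i$ is the amount of gas bought at $v_i$. The tank is initially empty: $g_1=0$. If $g_i$ is the amount of gas on arrival at $v_i$, then $g_{i+1}=g_i+f_i-d(v_i,v_{i+1})$. The way of travelling is feasible if $g_i+f_i\le U$ and $g_{i+1}\ge 0$ for all $1\le i\le k-1$, and at most $\Delta$ indices $i$ have $f_i>0$ (each such index is a refill stop;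 filling at the starting vertex counts as a refill stop). Its cost is $\sum_{i=1}^{k-1} f_i\,c(v_i)$. The gas station problem asks for a feasible way of travelling of minimum cost. A "step" is an elementary operation in the usual unit-cost model: an arithmetic operation on, or comparison of, real numbers, or a memory access. The values of $d$, $c$ are available in $O(1)$ time. *)

theory Defs
  imports Complex_Main
begin

section \<open>The gas station problem\<close>

text \<open>
  The complete graph has vertex set \<open>{..<verts I}\<close>. The value \<open>d I u v\<close> is the length of the
  edge \<open>uv\<close>; the diagonal values \<open>d I v v\<close> have no meaning and are unconstrained.
\<close>

record gas_instance =
  verts :: nat
  src :: nat
  dst :: nat
  d :: "nat \<Rightarrow> nat \<Rightarrow> real"
  price :: "nat \<Rightarrow> real"
  capacity :: real
  max_stops :: nat

definition valid_instance :: "gas_instance \<Rightarrow> bool" where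
  "valid_instance I \<longleftrightarrow>
     src I < verts I \<and> dst I < verts I \<and>
     (\<forall>u < verts I. \<forall>v < verts I. u \<noteq> v \<longrightarrow> d I u v > 0 \<and> d I u v = d I v u) \<and>
     (\<forall>u < verts I. \<forall>v < verts I. \<forall>w < verts I. u \<noteq> v \<and> v \<noteq> w \<and> u \<noteq> w \<longrightarrow>
        d I u v + d I v w \<ge> d I u w) \<and>
     (\<forall>v < verts I. price I v > 0) \<and>
     capacity I > 0 \<and> max_stops I > 0"

text \<open>
  A way of travelling is a pair of a route \<open>vs\<close> and a list \<open>fs\<close> of bought amounts. Positions
  are counted from 0, so \<open>fs ! i\<close> is bought at \<open>vs ! i\<close>, and nothing is bought at the last
  position. \<open>gas I vs fs i\<close> is the content of the tank on arrival at position \<open>i\<close>.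
\<close>

definition travel_way :: "gas_instance \<Rightarrow> nat list \<Rightarrow> real list \<Rightarrow> bool" where
  "travel_way I vs fs \<longleftrightarrow>
     vs \<noteq> [] \<and> set vs \<subseteq> {..<verts I} \<and> hd vs = src I \<and> last vs = dst I \<and> distinct_adj vs \<and>
     length fs = length vs - 1 \<and> (\<forall>f \<in> set fs. f \<ge> 0)"

primrec gas :: "gas_instance \<Rightarrow> nat list \<Rightarrow> real list \<Rightarrow> nat \<Rightarrow> real" where
  "gas I vs fs 0 = 0"
| "gas I vs fs (Suc i) = gas I vs fs i + fs ! i - d I (vs ! i) (vs ! Suc i)"

definition feasible :: "gas_instance \<Rightarrow> nat list \<Rightarrow> real list \<Rightarrow> bool" where
  "feasible I vs fs \<longleftrightarrow>
     travel_way I vs fs \<and>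
     (\<forall>i < length fs. gas I vs fs i + fs ! i \<le> capacity I \<and> gas I vs fs (Suc i) \<ge> 0) \<and>
     card {i. i < length fs \<and> fs ! i > 0} \<le> max_stops I"

definition travel_cost :: "gas_instance \<Rightarrow> nat list \<Rightarrow> real list \<Rightarrow> real" where
  "travel_cost I vs fs = (\<Sum>i < length fs. fs ! i * price I (vs ! i))"

definition cheapest :: "gas_instance \<Rightarrow> nat list \<Rightarrow> real list \<Rightarrow> bool" where
  "cheapest I vs fs \<longleftrightarrow>
     feasible I vs fs \<and>
     (\<forall>vs' fs'. feasible I vs' fs' \<longrightarrow> travel_cost I vs fs \<le> travel_cost I vs' fs')"


section \<open>A unit-cost random access machine over the reals\<close>

text \<open>
  Programs are finite, and so use finitely many named arrays, each of them with cells indexed by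
  the natural numbers and holding either natural numbers (indices, counters) or reals. A scalar
  variable is cell 0 of an array.

  Index arithmetic is restricted to addition and truncated subtraction; there is no
  multiplication of naturals and no conversion (such as rounding) between naturals and reals, so
  that unit cost is not an unrealistic charge. The only real constants are integers, so that a
  program cannot contain an infinite amount of information. Division by 0 yields 0, as in HOL.
\<close>

type_synonym name = string

datatype nexp =
    NConst nat
  | NGet name nexp
  | NAdd nexp nexp
  | NSub nexp nexp

datatype rexp =
    RConst int
  | RGet name nexp
  | RAdd rexp rexp
  | RSub rexp rexp
  | RMul rexp rexp
  | RDiv rexp rexp

datatype bexp =
    NLess nexp nexp
  | RLess rexp rexp
  | BNot bexp
  | BAnd bexp bexp

datatype prog =
    Skip
  | NSet name nexp nexp
  | RSet name nexp rexp
  | Seq prog prog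
  | Cond bexp prog prog
  | While bexp prog

record store =
  nmem :: "name \<Rightarrow> nat \<Rightarrow> nat"
  rmem :: "name \<Rightarrow> nat \<Rightarrow> real"

primrec nval :: "nexp \<Rightarrow> store \<Rightarrow> nat" where
  "nval (NConst k) \<sigma> = k"
| "nval (NGet a i) \<sigma> = nmem \<sigma> a (nval i \<sigma>)"
| "nval (NAdd x y) \<sigma> = nval x \<sigma> + nval y \<sigma>"
| "nval (NSub x y) \<sigma> = nval x \<sigma> - nval y \<sigma>"

primrec rval :: "rexp \<Rightarrow> store \<Rightarrow> real" where
  "rval (RConst k) \<sigma> = of_int k"
| "rval (RGet a i) \<sigma> = rmem \<sigma> a (nval i \<sigma>)"
| "rval (RAdd x y) \<sigma> = rval x \<sigma> + rval y \<sigma>"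
| "rval (RSub x y) \<sigma> = rval x \<sigma> - rval y \<sigma>"
| "rval (RMul x y) \<sigma> = rval x \<sigma> * rval y \<sigma>"
| "rval (RDiv x y) \<sigma> = rval x \<sigma> / rval y \<sigma>"

primrec bval :: "bexp \<Rightarrow> store \<Rightarrow> bool" where
  "bval (NLess x y) \<sigma> \<longleftrightarrow> nval x \<sigma> < nval y \<sigma>"
| "bval (RLess x y) \<sigma> \<longleftrightarrow> rval x \<sigma> < rval y \<sigma>"
| "bval (BNot b) \<sigma> \<longleftrightarrow> \<not> bval b \<sigma>"
| "bval (BAnd b b') \<sigma> \<longleftrightarrow> bval b \<sigma> \<and> bval b' \<sigma>"

text \<open>
  Every occurrence of a constant, a memory access, an arithmetic operation, a comparison or a
  Boolean connective is one step.
\<close>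

primrec ncost :: "nexp \<Rightarrow> nat" where
  "ncost (NConst k) = 1"
| "ncost (NGet a i) = ncost i + 1"
| "ncost (NAdd x y) = ncost x + ncost y + 1"
| "ncost (NSub x y) = ncost x + ncost y + 1"

primrec rcost :: "rexp \<Rightarrow> nat" where
  "rcost (RConst k) = 1"
| "rcost (RGet a i) = ncost i + 1"
| "rcost (RAdd x y) = rcost x + rcost y + 1"
| "rcost (RSub x y) = rcost x + rcost y + 1"
| "rcost (RMul x y) = rcost x + rcost y + 1"
| "rcost (RDiv x y) = rcost x + rcost y + 1"

primrec bcost :: "bexp \<Rightarrow> nat" where
  "bcost (NLess x y) = ncost x + ncost y + 1"
| "bcost (RLess x y) = rcost x + rcost y + 1"
| "bcost (BNot b) = bcost b + 1"
| "bcost (BAnd b b') = bcost b + bcost b' + 1"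

text \<open>
  \<open>runs P \<sigma> k \<tau>\<close>: the program \<open>P\<close>, started in the store \<open>\<sigma>\<close>, terminates after exactly \<open>k\<close> steps
  in the store \<open>\<tau>\<close>. Control flow is charged as well (one step per branching or loop test).
\<close>

inductive runs :: "prog \<Rightarrow> store \<Rightarrow> nat \<Rightarrow> store \<Rightarrow> bool" where
  Skip: "runs Skip \<sigma> 1 \<sigma>"
| NSet: "runs (NSet a i x) \<sigma> (ncost i + ncost x + 1)
     (\<sigma>\<lparr>nmem := (nmem \<sigma>)(a := (nmem \<sigma> a)(nval i \<sigma> := nval x \<sigma>))\<rparr>)"
| RSet: "runs (RSet a i x) \<sigma> (ncost i + rcost x + 1)
     (\<sigma>\<lparr>rmem := (rmem \<sigma>)(a := (rmem \<sigma> a)(nval i \<sigma> := rval x \<sigma>))\<rparr>)"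
| Seq: "runs P \<sigma> k \<tau> \<Longrightarrow> runs Q \<tau> l \<upsilon> \<Longrightarrow> runs (Seq P Q) \<sigma> (k + l) \<upsilon>"
| CondTrue: "bval b \<sigma> \<Longrightarrow> runs P \<sigma> k \<tau> \<Longrightarrow> runs (Cond b P Q) \<sigma> (bcost b + 1 + k) \<tau>"
| CondFalse: "\<not> bval b \<sigma> \<Longrightarrow> runs Q \<sigma> k \<tau> \<Longrightarrow> runs (Cond b P Q) \<sigma> (bcost b + 1 + k) \<tau>"
| WhileFalse: "\<not> bval b \<sigma> \<Longrightarrow> runs (While b P) \<sigma> (bcost b + 1) \<sigma>"
| WhileTrue: "bval b \<sigma> \<Longrightarrow> runs P \<sigma> k \<tau> \<Longrightarrow> runs (While b P) \<tau> l \<upsilon> \<Longrightarrow>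
     runs (While b P) \<sigma> (bcost b + 1 + k + l) \<upsilon>"

inductive_cases SkipE: "runs Skip \<sigma> k \<tau>"
inductive_cases NSetE: "runs (NSet a i x) \<sigma> k \<tau>"
inductive_cases RSetE: "runs (RSet a i x) \<sigma> k \<tau>"
inductive_cases SeqE: "runs (Seq P Q) \<sigma> k \<tau>"
inductive_cases CondE: "runs (Cond b P Q) \<sigma> k \<tau>"
inductive_cases WhileE: "runs (While b P) \<sigma> k \<tau>"

lemma runs_deterministic:
  "runs P \<sigma> k \<tau> \<Longrightarrow> runs P \<sigma> k' \<tau>' \<Longrightarrow> k' = k \<and> \<tau>' = \<tau>"
proof (induction arbitrary: k' \<tau>' rule: runs.induct)
  case Skip
  then show ?case by (rule SkipE) simp
next
  case NSet
  then show ?case by (rule NSetE) simp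
next
  case RSet
  then show ?case by (rule RSetE) simp
next
  case (Seq P \<sigma> k \<tau> Q l \<upsilon>)
  from Seq.prems obtain k1 \<tau>1 l1
    where *: "k' = k1 + l1" "runs P \<sigma> k1 \<tau>1" "runs Q \<tau>1 l1 \<tau>'"
    by (rule SeqE)
  have 1: "k1 = k" "\<tau>1 = \<tau>"
    using Seq.IH(1)[OF *(2)] by simp_all
  show ?case
    using Seq.IH(2)[OF *(3)[unfolded 1]] *(1) 1 by simp
next
  case (CondTrue b \<sigma> P k \<tau> Q)
  from CondTrue.prems obtain k1
    where *: "k' = bcost b + 1 + k1" "runs P \<sigma> k1 \<tau>'"
    by (rule CondE) (use CondTrue.hyps(1) in simp_all)
  show ?case
    using CondTrue.IH[OF *(2)] *(1) by simp
next
  case (CondFalse b \<sigma> Q k \<tau> P)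
  from CondFalse.prems obtain k1
    where *: "k' = bcost b + 1 + k1" "runs Q \<sigma> k1 \<tau>'"
    by (rule CondE) (use CondFalse.hyps(1) in simp_all)
  show ?case
    using CondFalse.IH[OF *(2)] *(1) by simp
next
  case (WhileFalse b \<sigma> P)
  from WhileFalse.prems show ?case
    by (rule WhileE) (use WhileFalse.hyps in simp_all)
next
  case (WhileTrue b \<sigma> P k \<tau> l \<upsilon>)
  from WhileTrue.prems obtain k1 \<tau>1 l1
    where *: "k' = bcost b + 1 + k1 + l1" "runs P \<sigma> k1 \<tau>1" "runs (While b P) \<tau>1 l1 \<tau>'"
    by (rule WhileE) (use WhileTrue.hyps(1) in simp_all)
  have 1: "k1 = k" "\<tau>1 = \<tau>"
    using WhileTrue.IH(1)[OF *(2)] by simp_all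
  show ?case
    using WhileTrue.IH(2)[OF *(3)[unfolded 1]] *(1) 1 by simp
qed


section \<open>Input and output\<close>

text \<open>The distances are stored row by row; all cells that carry no input are 0.\<close>

definition input_store :: "gas_instance \<Rightarrow> store" where
  "input_store I = \<lparr>
     nmem = (\<lambda>a i. 0)(
       ''n'' := (\<lambda>i. 0)(0 := verts I),
       ''s'' := (\<lambda>i. 0)(0 := src I),
       ''t'' := (\<lambda>i. 0)(0 := dst I),
       ''Delta'' := (\<lambda>i. 0)(0 := max_stops I)),
     rmem = (\<lambda>a i. 0)(
       ''U'' := (\<lambda>i. 0)(0 := capacity I),
       ''c'' := (\<lambda>v. if v < verts I then price I v else 0),
       ''d'' := (\<lambda>i. if i < verts I * verts I then d I (i div verts I) (i mod verts I) else 0))\<rparr>"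

text \<open>
  The output consists of a flag telling whether a feasible way of travelling exists and, if so,
  the number of positions on the route, the route and the amounts bought.
\<close>

definition out_feasible :: "store \<Rightarrow> bool" where
  "out_feasible \<tau> \<longleftrightarrow> nmem \<tau> ''feasible'' 0 \<noteq> 0"

definition out_route :: "store \<Rightarrow> nat list" where
  "out_route \<tau> = map (nmem \<tau> ''route'') [0..<nmem \<tau> ''length'' 0]"

definition out_fuel :: "store \<Rightarrow> real list" where
  "out_fuel \<tau> = map (rmem \<tau> ''fuel'') [0..<nmem \<tau> ''length'' 0 - 1]"

definition correct_output :: "gas_instance \<Rightarrow> store \<Rightarrow> bool" where
  "correct_output I \<tau> \<longleftrightarrow>
     (if out_feasible \<tau> then cheapest I (out_route \<tau>) (out_fuel \<tau>)
      else \<not> (\<exists>vs fs. feasible I vs fs))"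

end

theory Submission
  imports Defs
begin

text \<open>
  By an exchange argument it suffices to consider ways of travelling on which every refill either
  fills the tank or buys just enough to reach the next stop with an empty tank: if gas is not
  dearer at the next stop, buy less, otherwise buy more. Hence the gas on arrival at \<open>v\<close> is 0 or
  \<open>U - d u v\<close> for some \<open>u\<close>, which leaves \<open>n\<^sup>2\<close> states, conveniently numbered like the edges (loops
  stand for an empty tank), and \<open>\<Delta>\<close> rounds of dynamic programming over them. In one round, filling
  up costs a term that depends only on \<open>v\<close> (up to an amount linear in the gas), while buying exactly
  requires a minimum over the edges at \<open>v\<close> that are at least as long as the gas at hand. Once all
  edges are sorted by length, which takes \<open>O(n\<^sup>2 log n)\<close> steps, a sweep through the states by
  decreasing gas maintains these minima for all \<open>v\<close> at once in \<open>O(n\<^sup>2)\<close> steps. The route is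
  recovered by looking, in every round, for an edge that attains the minimum.
\<close>

section \<open>Programs with step bounds\<close>

text \<open>The triangle inequality lets a canonical way stop at every vertex it visits, since a
  vertex without a refill can be skipped. Skipping a vertex may leave surplus gas, which a
  recurrence with exact amounts cannot record. Hence the lower bound is proved for a relaxed notion
  in which gas may be discarded; at the start the tank is empty, so there the relaxation coincides
  with the recurrence. That the value of the recurrence is attained is not shown separately: the
  route recovery constructs a way of exactly this cost. The machine has no infinite value, so
  infeasibility is expressed by a finite bound \<open>M\<close> above the cost of every feasible
  way. It has neither multiplication nor division of indices, nor a conversion from naturals to
  reals. Therefore the row, the column and the transposed number of each edge are tabulated by
  running counters, and \<open>M\<close> is accumulated by repeated addition. The values of all
  rounds stay in memory, because the recovery compares consecutive rounds.\<close>

definition halts :: "prog \<Rightarrow> store \<Rightarrow> nat \<Rightarrow> (store \<Rightarrow> bool) \<Rightarrow> bool" where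
  "halts P \<sigma> t Q \<longleftrightarrow> (\<exists>k \<tau>. runs P \<sigma> k \<tau> \<and> k \<le> t \<and> Q \<tau>)"

lemma halts_mono:
  "halts P \<sigma> t Q \<Longrightarrow> t \<le> t' \<Longrightarrow> (\<And>\<tau>. Q \<tau> \<Longrightarrow> Q' \<tau>) \<Longrightarrow> halts P \<sigma> t' Q'"
  unfolding halts_def using order_trans by blast

lemma halts_Seq:
  assumes "halts P \<sigma> t Q" "\<And>\<tau>. Q \<tau> \<Longrightarrow> halts P' \<tau> t' R"
  shows "halts (Seq P P') \<sigma> (t + t') R"
  using assms unfolding halts_def by (meson add_mono runs.Seq)

lemma halts_Cond:
  assumes "bval b \<sigma> \<Longrightarrow> halts P \<sigma> t Q" "\<not> bval b \<sigma> \<Longrightarrow> halts P' \<sigma> t Q"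
  shows "halts (Cond b P P') \<sigma> (bcost b + 1 + t) Q"
proof (cases "bval b \<sigma>")
  case True
  then obtain k \<tau> where "runs P \<sigma> k \<tau>" "k \<le> t" "Q \<tau>"
    using assms(1) unfolding halts_def by blast
  then show ?thesis
    unfolding halts_def using runs.CondTrue[OF True] by (meson add_left_mono)
next
  case False
  then obtain k \<tau> where "runs P' \<sigma> k \<tau>" "k \<le> t" "Q \<tau>"
    using assms(2) unfolding halts_def by blast
  then show ?thesis
    unfolding halts_def using runs.CondFalse[OF False] by (meson add_left_mono)
qed

text \<open>\<open>block\<close> nests to the right, whereas an initialisation and its loop are best
  verified as one unit. Regrouping is free because \<open>Seq\<close> itself charges no
  step.\<close>

lemma halts_Seq_assoc:
  "halts (Seq (Seq P P') P'') \<sigma> t Q \<Longrightarrow> halts (Seq P (Seq P' P'')) \<sigma> t Q"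
  unfolding halts_def
  by (elim exE conjE SeqE) (metis add.assoc runs.Seq)

text \<open>\<open>J i\<close> is the loop invariant when at most \<open>i\<close> iterations remain.\<close>

lemma halts_While:
  assumes "J i \<sigma>"
    and "\<And>\<sigma>. J 0 \<sigma> \<Longrightarrow> \<not> bval b \<sigma>"
    and "\<And>i \<sigma>. J (Suc i) \<sigma> \<Longrightarrow> bval b \<sigma> \<Longrightarrow> halts P \<sigma> t (J i)"
    and "\<And>i \<sigma>. J i \<sigma> \<Longrightarrow> \<not> bval b \<sigma> \<Longrightarrow> Q \<sigma>"
  shows "halts (While b P) \<sigma> (Suc i * (bcost b + 1 + t)) Q"
  using assms(1)
proof (induction i arbitrary: \<sigma>)
  case 0
  then show ?case
    using assms(2,4) runs.WhileFalse[of b \<sigma> P] unfolding halts_def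
    by (intro exI[of _ "bcost b + 1"] exI[of _ \<sigma>]) auto
next
  case (Suc i)
  show ?case
  proof (cases "bval b \<sigma>")
    case True
    obtain k \<tau> where 1: "runs P \<sigma> k \<tau>" "k \<le> t" "J i \<tau>"
      using assms(3)[OF Suc.prems True] unfolding halts_def by blast
    obtain l \<upsilon> where 2: "runs (While b P) \<tau> l \<upsilon>" "l \<le> Suc i * (bcost b + 1 + t)" "Q \<upsilon>"
      using Suc.IH[OF 1(3)] unfolding halts_def by blast
    show ?thesis
      unfolding halts_def
      using runs.WhileTrue[OF True 1(1) 2(1)] 1(2) 2(2,3)
      by (intro exI[of _ "bcost b + 1 + k + l"] exI[of _ \<upsilon>]) auto
  next
    case False
    then show ?thesis
      using assms(4)[OF Suc.prems] runs.WhileFalse[of b \<sigma> P] unfolding halts_def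
      by (intro exI[of _ "bcost b + 1"] exI[of _ \<sigma>]) auto
  qed
qed

section \<open>Loop-free programs: execution, cost bound, written arrays\<close>

primrec loop_free :: "prog \<Rightarrow> bool" where
  "loop_free Skip \<longleftrightarrow> True"
| "loop_free (NSet a i x) \<longleftrightarrow> True"
| "loop_free (RSet a i x) \<longleftrightarrow> True"
| "loop_free (Seq P Q) \<longleftrightarrow> loop_free P \<and> loop_free Q"
| "loop_free (Cond b P Q) \<longleftrightarrow> loop_free P \<and> loop_free Q"
| "loop_free (While b P) \<longleftrightarrow> False"

text \<open>Meant for loop-free programs; a loop gets the identity as a default.\<close>

primrec exec :: "prog \<Rightarrow> store \<Rightarrow> store" where
  "exec Skip \<sigma> = \<sigma>"
| "exec (NSet a i x) \<sigma> = \<sigma>\<lparr>nmem := (nmem \<sigma>)(a := (nmem \<sigma> a)(nval i \<sigma> := nval x \<sigma>))\<rparr>"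
| "exec (RSet a i x) \<sigma> = \<sigma>\<lparr>rmem := (rmem \<sigma>)(a := (rmem \<sigma> a)(nval i \<sigma> := rval x \<sigma>))\<rparr>"
| "exec (Seq P Q) \<sigma> = exec Q (exec P \<sigma>)"
| "exec (Cond b P Q) \<sigma> = (if bval b \<sigma> then exec P \<sigma> else exec Q \<sigma>)"
| "exec (While b P) \<sigma> = \<sigma>"

text \<open>An upper bound rather than a step count: charging both branches of a conditional makes
  it independent of the store. The value 0 for loops is a dummy, since \<open>halts_exec\<close>
  assumes \<open>loop_free\<close>.\<close>

primrec cost :: "prog \<Rightarrow> nat" where
  "cost Skip = 1"
| "cost (NSet a i x) = ncost i + ncost x + 1"
| "cost (RSet a i x) = ncost i + rcost x + 1"
| "cost (Seq P Q) = cost P + cost Q"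
| "cost (Cond b P Q) = bcost b + 1 + (cost P + cost Q)"
| "cost (While b P) = 0"

lemma halts_exec: "loop_free P \<Longrightarrow> Q (exec P \<sigma>) \<Longrightarrow> halts P \<sigma> (cost P) Q"
proof (induction P arbitrary: \<sigma> Q)
  case Skip
  then show ?case using runs.Skip unfolding halts_def by fastforce
next
  case (NSet a i x)
  then show ?case unfolding halts_def using runs.NSet by fastforce
next
  case (RSet a i x)
  then show ?case unfolding halts_def using runs.RSet by fastforce
next
  case (Seq P1 P2)
  then show ?case
    using halts_Seq[of P1 \<sigma> "cost P1" "\<lambda>\<tau>. \<tau> = exec P1 \<sigma>" P2 "cost P2" Q] by auto
next
  case (Cond b P1 P2)
  have "halts P1 \<sigma> (cost P1 + cost P2) Q" if "bval b \<sigma>"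
    using Cond.IH(1)[of Q \<sigma>] Cond.prems that by (auto elim: halts_mono)
  moreover have "halts P2 \<sigma> (cost P1 + cost P2) Q" if "\<not> bval b \<sigma>"
    using Cond.IH(2)[of Q \<sigma>] Cond.prems that by (auto elim: halts_mono)
  ultimately show ?case
    using halts_Cond[of b \<sigma> P1 "cost P1 + cost P2" Q P2] by simp
qed simp

primrec nwrites :: "prog \<Rightarrow> name set" where
  "nwrites Skip = {}"
| "nwrites (NSet a i x) = {a}"
| "nwrites (RSet a i x) = {}"
| "nwrites (Seq P Q) = nwrites P \<union> nwrites Q"
| "nwrites (Cond b P Q) = nwrites P \<union> nwrites Q"
| "nwrites (While b P) = nwrites P"

primrec rwrites :: "prog \<Rightarrow> name set" where
  "rwrites Skip = {}"
| "rwrites (NSet a i x) = {}"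
| "rwrites (RSet a i x) = {a}"
| "rwrites (Seq P Q) = rwrites P \<union> rwrites Q"
| "rwrites (Cond b P Q) = rwrites P \<union> rwrites Q"
| "rwrites (While b P) = rwrites P"

lemma runs_frame:
  "runs P \<sigma> k \<tau> \<Longrightarrow>
     (\<forall>a. a \<notin> nwrites P \<longrightarrow> nmem \<tau> a = nmem \<sigma> a) \<and> (\<forall>a. a \<notin> rwrites P \<longrightarrow> rmem \<tau> a = rmem \<sigma> a)"
  by (induction rule: runs.induct) auto

lemma halts_frame:
  assumes "halts P \<sigma> t Q"
  shows "halts P \<sigma> t (\<lambda>\<tau>. Q \<tau> \<and> (\<forall>a. a \<notin> nwrites P \<longrightarrow> nmem \<tau> a = nmem \<sigma> a) \<and>
           (\<forall>a. a \<notin> rwrites P \<longrightarrow> rmem \<tau> a = rmem \<sigma> a))"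
  using assms runs_frame unfolding halts_def by blast

lemma exec_frame:
  "a \<notin> nwrites P \<Longrightarrow> nmem (exec P \<sigma>) a = nmem \<sigma> a"
  "a \<notin> rwrites P \<Longrightarrow> rmem (exec P \<sigma>) a = rmem \<sigma> a"
  by (induction P arbitrary: \<sigma>) auto

abbreviation nvar :: "name \<Rightarrow> nexp" where "nvar a \<equiv> NGet a (NConst 0)"
abbreviation rvar :: "name \<Rightarrow> rexp" where "rvar a \<equiv> RGet a (NConst 0)"
abbreviation nset :: "name \<Rightarrow> nexp \<Rightarrow> prog" where "nset a x \<equiv> NSet a (NConst 0) x"
abbreviation rset :: "name \<Rightarrow> rexp \<Rightarrow> prog" where "rset a x \<equiv> RSet a (NConst 0) x"
text \<open>Truncated subtraction gives \<open>x - (x - y) = min x y\<close>.\<close>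

abbreviation nmin :: "nexp \<Rightarrow> nexp \<Rightarrow> nexp" where "nmin x y \<equiv> NSub x (NSub x y)"

fun block :: "prog list \<Rightarrow> prog" where
  "block [] = Skip"
| "block [P] = P"
| "block (P # Ps) = Seq P (block Ps)"

abbreviation nne :: "nexp \<Rightarrow> nexp \<Rightarrow> bexp" where
  "nne x y \<equiv> BNot (BAnd (BNot (NLess x y)) (BNot (NLess y x)))"
abbreviation ninc :: "name \<Rightarrow> prog" where "ninc a \<equiv> nset a (NAdd (nvar a) (NConst 1))"

text \<open>These rules keep case distinctions inside a cell instead of splitting the store.\<close>

lemma exec_Cond_NSet [simp]:
  "exec (Cond b (NSet a i x) (NSet a i y)) \<sigma> =
     \<sigma>\<lparr>nmem := (nmem \<sigma>)(a := (nmem \<sigma> a)(nval i \<sigma> := (if bval b \<sigma> then nval x \<sigma> else nval y \<sigma>)))\<rparr>"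
  by simp

lemma exec_Cond_RSet [simp]:
  "exec (Cond b (RSet a i x) (RSet a i y)) \<sigma> =
     \<sigma>\<lparr>rmem := (rmem \<sigma>)(a := (rmem \<sigma> a)(nval i \<sigma> := (if bval b \<sigma> then rval x \<sigma> else rval y \<sigma>)))\<rparr>"
  by simp

lemma exec_Cond_RSet_Skip [simp]:
  "exec (Cond b (RSet a i x) Skip) \<sigma> =
     \<sigma>\<lparr>rmem := (rmem \<sigma>)(a := (rmem \<sigma> a)(nval i \<sigma> := (if bval b \<sigma> then rval x \<sigma> else rmem \<sigma> a (nval i \<sigma>))))\<rparr>"
  by simp

section \<open>Bottom-up merge sort\<close>

fun merge :: "(nat \<Rightarrow> real) \<Rightarrow> nat list \<Rightarrow> nat list \<Rightarrow> nat list" where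
  "merge key [] ys = ys"
| "merge key xs [] = xs"
| "merge key (x # xs) (y # ys) =
     (if key y < key x then y # merge key (x # xs) ys else x # merge key xs (y # ys))"

lemma merge_Nil2 [simp]: "merge key xs [] = xs"
  by (cases xs) auto

lemma length_merge [simp]: "length (merge key xs ys) = length xs + length ys"
  by (induction key xs ys rule: merge.induct) auto

lemma set_merge [simp]: "set (merge key xs ys) = set xs \<union> set ys"
  by (induction key xs ys rule: merge.induct) auto

lemma sorted_merge:
  "sorted (map key xs) \<Longrightarrow> sorted (map key ys) \<Longrightarrow> sorted (map key (merge key xs ys))"
  by (induction key xs ys rule: merge.induct) (fastforce simp: not_less)+

function merge_pass :: "(nat \<Rightarrow> real) \<Rightarrow> nat \<Rightarrow> nat list \<Rightarrow> nat list" where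
  "merge_pass key k xs =
     (if k = 0 \<or> xs = [] then xs
      else merge key (take k xs) (take k (drop k xs)) @ merge_pass key k (drop (k + k) xs))"
  by auto
termination by (relation "measure (\<lambda>(key, k, xs). length xs)") auto

function blocks_sorted :: "(nat \<Rightarrow> real) \<Rightarrow> nat \<Rightarrow> nat list \<Rightarrow> bool" where
  "blocks_sorted key k xs =
     (if k = 0 \<or> xs = [] then True
      else sorted (map key (take k xs)) \<and> blocks_sorted key k (drop k xs))"
  by auto
termination by (relation "measure (\<lambda>(key, k, xs). length xs)") auto

declare merge_pass.simps [simp del] blocks_sorted.simps [simp del]

lemma merge_pass_Nil [simp]: "merge_pass key k [] = []"
  by (simp add: merge_pass.simps)

lemma set_merge_pass [simp]: "set (merge_pass key k xs) = set xs"
proof (induction key k xs rule: merge_pass.induct)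
  case (1 key k xs)
  have "set (take k xs) \<union> set (take k (drop k xs)) \<union> set (drop (k + k) xs) = set xs"
    by (metis append_take_drop_id drop_drop set_append sup_assoc)
  with 1 show ?case
    by (subst merge_pass.simps) auto
qed

lemma blocks_sorted_1: "blocks_sorted key 1 xs"
proof (induction xs)
  case (Cons x xs)
  then show ?case by (subst blocks_sorted.simps) simp
qed (simp add: blocks_sorted.simps)

lemma blocks_sorted_long: "blocks_sorted key k xs \<Longrightarrow> 0 < k \<Longrightarrow> length xs \<le> k \<Longrightarrow> sorted (map key xs)"
  by (cases "xs = []") (auto simp: blocks_sorted.simps[of key k xs])

text \<open>If at least \<open>k + k\<close> entries are left, the merged pair is exactly the first
  block of the result. Otherwise it exhausts the input and forms the last, shorter block.\<close>

lemma blocks_sorted_merge_pass: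
  "blocks_sorted key k xs \<Longrightarrow> blocks_sorted key (k + k) (merge_pass key k xs)"
proof (induction key k xs rule: merge_pass.induct)
  case (1 key k xs)
  show ?case
  proof (cases "k = 0 \<or> xs = []")
    case True
    then show ?thesis by (auto simp: blocks_sorted.simps merge_pass.simps)
  next
    case False
    let ?m = "merge key (take k xs) (take k (drop k xs))"
    have b: "blocks_sorted key k (drop k xs)" "sorted (map key (take k xs))"
      using 1(2) False by (auto simp: blocks_sorted.simps[of key k xs])
    then have "sorted (map key (take k (drop k xs)))" "blocks_sorted key k (drop (k + k) xs)"
      using False by (auto simp: blocks_sorted.simps[of key k "drop k xs"] blocks_sorted.simps[of key k "[]"]
          add.commute split: if_splits)
    then have m: "sorted (map key ?m)" and r: "blocks_sorted key (k + k) (merge_pass key k (drop (k + k) xs))"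
      using b(2) sorted_merge 1(1) False by auto
    have e: "merge_pass key k xs = ?m @ merge_pass key k (drop (k + k) xs)"
      using False by (subst merge_pass.simps) simp
    show ?thesis
    proof (cases "k + k \<le> length xs")
      case True
      then have l: "length ?m = k + k" by simp
      show ?thesis unfolding e
        by (subst blocks_sorted.simps) (use m r l in simp)
    next
      case short: False
      then have l: "length ?m \<le> k + k" "drop (k + k) xs = []" by auto
      show ?thesis unfolding e
        by (subst blocks_sorted.simps) (use m l False in \<open>simp add: blocks_sorted.simps[of key _ "[]"]\<close>)
    qed
  qed
qed

section \<open>Merge sort as a program\<close>

definition merge_step :: prog where
  "merge_step =
     Cond (BAnd (BNot (NLess (nvar ''i'') (nvar ''I''))) (BNot (NLess (nvar ''j'') (nvar ''J''))))
       (block [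
         nset ''i'' (nvar ''J''),
         nset ''I'' (nmin (NAdd (nvar ''i'') (nvar ''k'')) (nvar ''B'')),
         nset ''j'' (nvar ''I''),
         nset ''J'' (nmin (NAdd (nvar ''j'') (nvar ''k'')) (nvar ''B''))])
       (block [
         Cond (BAnd (NLess (nvar ''i'') (nvar ''I''))
             (BNot (BAnd (NLess (nvar ''j'') (nvar ''J''))
               (RLess (RGet ''d'' (NGet ''p'' (nvar ''j''))) (RGet ''d'' (NGet ''p'' (nvar ''i'')))))))
           (block [
             NSet ''p'' (nvar ''o'') (NGet ''p'' (nvar ''i'')),
             nset ''i'' (NAdd (nvar ''i'') (NConst 1))])
           (block [
             NSet ''p'' (nvar ''o'') (NGet ''p'' (nvar ''j'')),
             nset ''j'' (NAdd (nvar ''j'') (NConst 1))]),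
         nset ''o'' (NAdd (nvar ''o'') (NConst 1))])"

definition merge_test :: bexp where
  "merge_test = NLess (nvar ''o'') (NAdd (nvar ''B'') (nvar ''N''))"

text \<open>
  Every pass reads the cells \<open>b ..< B\<close> of the array \<open>p\<close> and writes the cells \<open>B ..< B + N\<close>.
\<close>

definition merge_init :: prog where
  "merge_init = block [nset ''i'' (nvar ''b''), nset ''I'' (nvar ''b''), nset ''j'' (nvar ''b''),
     nset ''J'' (nvar ''b''), nset ''o'' (nvar ''B'')]"

text \<open>The output region of a pass becomes the input region of the next one, which writes to
  fresh cells; nothing is copied back.\<close>

definition sort_next :: prog where
  "sort_next = block [nset ''b'' (nvar ''B''), nset ''B'' (NAdd (nvar ''B'') (nvar ''N'')),
     nset ''k'' (NAdd (nvar ''k'') (nvar ''k''))]"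

definition sort_init :: prog where
  "sort_init = block [nset ''k'' (NConst 1), nset ''b'' (NConst 0), nset ''B'' (nvar ''N'')]"

definition sort_test :: bexp where
  "sort_test = NLess (nvar ''k'') (nvar ''N'')"

definition pass_prog :: prog where
  "pass_prog = block [merge_init, While merge_test merge_step, sort_next]"

definition sort_prog :: prog where
  "sort_prog = block [sort_init,
     While sort_test pass_prog]"

text \<open>A pass is a single loop; each iteration opens a pair of blocks or writes one entry.
  Hence the measure: two iterations for every cell still to be written, plus one if the current pair
  is exhausted. The counting equation guarantees unread input as long as cells remain to be
  written.\<close>

definition merge_inv :: "(nat \<Rightarrow> nat) \<Rightarrow> (nat \<Rightarrow> real) \<Rightarrow> nat \<Rightarrow> nat \<Rightarrow> nat \<Rightarrow> nat \<Rightarrow> store \<Rightarrow> bool" where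
  "merge_inv f key N k b r \<sigma> \<longleftrightarrow>
     (let i = nmem \<sigma> ''i'' 0; I = nmem \<sigma> ''I'' 0; j = nmem \<sigma> ''j'' 0; J = nmem \<sigma> ''J'' 0;
          o' = nmem \<sigma> ''o'' 0; p = nmem \<sigma> ''p''; B = b + N in
      rmem \<sigma> ''d'' = key \<and> nmem \<sigma> ''N'' 0 = N \<and> nmem \<sigma> ''k'' 0 = k \<and> nmem \<sigma> ''B'' 0 = B \<and> 0 < k \<and>
      b \<le> i \<and> i \<le> I \<and> I \<le> j \<and> j \<le> J \<and> J \<le> B \<and> B \<le> o' \<and>
      o' + (I - i) + (J - j) + (B - J) = B + N \<and>
      (\<forall>y < B. p y = f y) \<and>
      map p [B..<o'] @ merge key (map f [i..<I]) (map f [j..<J]) @ merge_pass key k (map f [J..<B])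
        = merge_pass key k (map f [b..<B]) \<and>
      2 * (B + N - o') + (if i = I \<and> j = J then 1 else 0) \<le> r)"

text \<open>\<open>a + k - (a + k - e)\<close> is \<open>min (a + k) e\<close>; the block ends
  appear in the form in which the program computes them.\<close>

lemma merge_pass_upt:
  assumes "0 < k" "a < e"
  shows "merge_pass key k (map f [a..<e]) =
     merge key (map f [a..<a + k - (a + k - e)])
       (map f [a + k - (a + k - e)..<(a + k - (a + k - e)) + k - ((a + k - (a + k - e)) + k - e)]) @
     merge_pass key k (map f [(a + k - (a + k - e)) + k - ((a + k - (a + k - e)) + k - e)..<e])"
proof -
  have "merge_pass key k (map f [a..<e]) =
    merge key (map f (take k [a..<e])) (map f (take k [a + k..<e])) @
      merge_pass key k (map f [a + (k + k)..<e])"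
    using assms by (subst merge_pass.simps) (simp add: take_map drop_map)
  moreover have "take k [a..<e] = [a..<a + k - (a + k - e)]"
    by (cases "a + k \<le> e") auto
  moreover have "take k [a + k..<e] =
      [a + k - (a + k - e)..<(a + k - (a + k - e)) + k - ((a + k - (a + k - e)) + k - e)]"
    by (cases "a + k \<le> e"; cases "a + k + k \<le> e") auto
  moreover have "[a + (k + k)..<e] = [(a + k - (a + k - e)) + k - ((a + k - (a + k - e)) + k - e)..<e]"
    by (cases "a + k \<le> e"; cases "a + k + k \<le> e") (auto simp: add.assoc)
  ultimately show ?thesis by simp
qed

lemma merge_step:
  assumes inv: "merge_inv f key N k b (Suc r) \<sigma>" and test: "bval merge_test \<sigma>"
  shows "merge_inv f key N k b r (exec merge_step \<sigma>)" (is "merge_inv _ _ _ _ _ _ ?\<tau>")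
proof -
  define \<tau> where "\<tau> = ?\<tau>"
  define i I j J o' p B where defs: "i = nmem \<sigma> ''i'' 0" "I = nmem \<sigma> ''I'' 0" "j = nmem \<sigma> ''j'' 0"
    "J = nmem \<sigma> ''J'' 0" "o' = nmem \<sigma> ''o'' 0" "p = nmem \<sigma> ''p''" "B = b + N"
  note folds = defs[symmetric]
  have s: "rmem \<sigma> ''d'' = key" "nmem \<sigma> ''N'' 0 = N" "nmem \<sigma> ''k'' 0 = k" "nmem \<sigma> ''B'' 0 = B" "0 < k"
      "b \<le> i" "i \<le> I" "I \<le> j" "j \<le> J" "J \<le> B" "B \<le> o'" "o' < B + N"
      "o' + (I - i) + (J - j) + (B - J) = B + N"
      "\<And>y. y < B \<Longrightarrow> p y = f y"
      "map p [B..<o'] @ merge key (map f [i..<I]) (map f [j..<J]) @ merge_pass key k (map f [J..<B])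
        = merge_pass key k (map f [b..<B])"
      "2 * (B + N - o') + (if i = I \<and> j = J then 1 else 0) \<le> Suc r"
    using inv test unfolding merge_inv_def Let_def folds by (auto simp: folds merge_test_def)
  have measure: "2 * (B + N - Suc o') + (if P then 1 else 0) \<le> r" for P
    using s(12,16) by (auto split: if_splits)
  consider (new) "i = I" "j = J" | (left) "i < I" "\<not> (j < J \<and> key (f j) < key (f i))"
    | (right) "\<not> (i < I \<and> \<not> (j < J \<and> key (f j) < key (f i)))" "j < J"
    using s by linarith
  then show ?thesis
  proof cases
    case new
    \<comment> \<open>Both blocks are exhausted while cells remain to be written, so by the counting
      equation unread input lies beyond \<open>J\<close>.\<close>
    then have "J < B" using s by simp
    define I' J' where IJ: "I' = J + k - (J + k - B)" "J' = I' + k - (I' + k - B)"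
    have le: "J < I'" "I' \<le> J'" "J' \<le> B" using \<open>J < B\<close> \<open>0 < k\<close> unfolding IJ by auto
    have eqs: "nmem \<tau> ''i'' 0 = J" "nmem \<tau> ''I'' 0 = I'" "nmem \<tau> ''j'' 0 = I'" "nmem \<tau> ''J'' 0 = J'"
      "nmem \<tau> ''o'' 0 = o'" "nmem \<tau> ''p'' = p" "nmem \<tau> ''N'' 0 = N" "nmem \<tau> ''k'' 0 = k"
      "nmem \<tau> ''B'' 0 = B" "rmem \<tau> ''d'' = key"
      using new s(1-4) by (simp_all add: \<tau>_def merge_step_def folds IJ)
    have mp: "merge_pass key k (map f [J..<B]) = merge key (map f [J..<I']) (map f [I'..<J']) @
        merge_pass key k (map f [J'..<B])"
      using merge_pass_upt[OF \<open>0 < k\<close> \<open>J < B\<close>, of key f] unfolding IJ .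
    show ?thesis
      using s le new defs(7)[symmetric] unfolding \<tau>_def [symmetric] merge_inv_def Let_def eqs by (simp add: mp)
  next
    case left
    then have p: "p i = f i" "j < J \<Longrightarrow> p j = f j" using s by auto
    have eqs: "nmem \<tau> ''i'' 0 = Suc i" "nmem \<tau> ''I'' 0 = I" "nmem \<tau> ''j'' 0 = j" "nmem \<tau> ''J'' 0 = J"
      "nmem \<tau> ''o'' 0 = Suc o'" "nmem \<tau> ''p'' = p(o' := f i)" "nmem \<tau> ''N'' 0 = N"
      "nmem \<tau> ''k'' 0 = k" "nmem \<tau> ''B'' 0 = B" "rmem \<tau> ''d'' = key"
      using left p s(1-4) by (auto simp: \<tau>_def merge_step_def folds)
    have l: "map f [i..<I] = f i # map f [Suc i..<I]" using left by (simp add: upt_conv_Cons)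
    have m: "merge key (map f [i..<I]) (map f [j..<J]) = f i # merge key (map f [Suc i..<I]) (map f [j..<J])"
      using left by (cases "j < J") (auto simp: l upt_conv_Cons[of j J] )
    have "Suc o' + (I - Suc i) + (J - j) + (B - J) = B + N"
      using s(13) left(1) by linarith
    then show ?thesis
      using s(1-12) s(14) s(15)[unfolded m] left(1) measure defs(7)[symmetric]
      unfolding \<tau>_def [symmetric] merge_inv_def Let_def eqs by simp
  next
    case right
    then have p: "i < I \<Longrightarrow> p i = f i" "p j = f j" using s by auto
    have eqs: "nmem \<tau> ''i'' 0 = i" "nmem \<tau> ''I'' 0 = I" "nmem \<tau> ''j'' 0 = Suc j" "nmem \<tau> ''J'' 0 = J"
      "nmem \<tau> ''o'' 0 = Suc o'" "nmem \<tau> ''p'' = p(o' := f j)" "nmem \<tau> ''N'' 0 = N"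
      "nmem \<tau> ''k'' 0 = k" "nmem \<tau> ''B'' 0 = B" "rmem \<tau> ''d'' = key"
      using right p s(1-4) by (auto simp: \<tau>_def merge_step_def folds)
    have l: "map f [j..<J] = f j # map f [Suc j..<J]" using right by (simp add: upt_conv_Cons)
    have m: "merge key (map f [i..<I]) (map f [j..<J]) = f j # merge key (map f [i..<I]) (map f [Suc j..<J])"
      using right by (cases "i < I") (auto simp: l upt_conv_Cons[of i I])
    have "Suc o' + (I - i) + (J - Suc j) + (B - J) = B + N"
      using s(13) right(2) by linarith
    then show ?thesis
      using s(1-12) s(14) s(15)[unfolded m] right(2) measure defs(7)[symmetric]
      unfolding \<tau>_def [symmetric] merge_inv_def Let_def eqs by simp
  qed
qed

definition pass_time :: "nat \<Rightarrow> nat" where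
  "pass_time N = cost merge_init +
     (Suc (2 * N + 1) * (bcost merge_test + 1 + cost merge_step) + cost sort_next)"

lemma pass_prog:
  assumes "rmem \<sigma> ''d'' = key" "nmem \<sigma> ''N'' 0 = N" "nmem \<sigma> ''k'' 0 = k" "0 < k"
    and "nmem \<sigma> ''b'' 0 = b" "nmem \<sigma> ''B'' 0 = b + N"
  shows "halts pass_prog \<sigma> (pass_time N) (\<lambda>\<tau>. rmem \<tau> ''d'' = key \<and> nmem \<tau> ''N'' 0 = N \<and>
    nmem \<tau> ''k'' 0 = k + k \<and> nmem \<tau> ''b'' 0 = b + N \<and> nmem \<tau> ''B'' 0 = b + N + N \<and>
    map (nmem \<tau> ''p'') [b + N..<b + N + N] = merge_pass key k (map (nmem \<sigma> ''p'') [b..<b + N]))"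
proof -
  let ?inv = "merge_inv (nmem \<sigma> ''p'') key N k b"
  have loop: "halts (While merge_test merge_step) \<tau> (Suc (2 * N + 1) * (bcost merge_test + 1 + cost merge_step))
      (\<lambda>\<tau>. \<exists>r. ?inv r \<tau> \<and> \<not> bval merge_test \<tau>)" if "?inv (2 * N + 1) \<tau>" for \<tau>
  proof (rule halts_While[where J = ?inv, OF that])
    show "\<not> bval merge_test \<tau>" if "?inv 0 \<tau>" for \<tau>
      using that by (auto simp: merge_inv_def Let_def merge_test_def)
    show "halts merge_step \<tau> (cost merge_step) (?inv r)"
      if "?inv (Suc r) \<tau>" "bval merge_test \<tau>" for r \<tau>
      by (rule halts_exec) (use merge_step[OF that] in \<open>simp_all add: merge_step_def\<close>)
  qed auto
  \<comment> \<open>Initially the current pair is empty, which accounts for the 1 in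
    \<open>2 * N + 1\<close>.\<close>
  have init: "?inv (2 * N + 1) (exec merge_init \<sigma>)"
    using assms by (simp add: merge_inv_def Let_def merge_init_def)
  have fin: "rmem \<upsilon> ''d'' = key \<and> nmem \<upsilon> ''N'' 0 = N \<and>
    nmem \<upsilon> ''k'' 0 = k + k \<and> nmem \<upsilon> ''b'' 0 = b + N \<and> nmem \<upsilon> ''B'' 0 = b + N + N \<and>
    map (nmem \<upsilon> ''p'') [b + N..<b + N + N] = merge_pass key k (map (nmem \<sigma> ''p'') [b..<b + N])"
    if "?inv r \<tau>" "\<not> bval merge_test \<tau>" "\<upsilon> = exec sort_next \<tau>" for r \<tau> \<upsilon>
  proof -
    have "nmem \<tau> ''o'' 0 = b + N + N" "nmem \<tau> ''i'' 0 = nmem \<tau> ''I'' 0" "nmem \<tau> ''j'' 0 = nmem \<tau> ''J'' 0"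
       "nmem \<tau> ''J'' 0 = b + N"
      using that by (auto simp: merge_inv_def Let_def merge_test_def)
    then show ?thesis
      using that by (simp add: merge_inv_def Let_def sort_next_def)
  qed
  show ?thesis
    unfolding pass_prog_def pass_time_def block.simps
    by (rule halts_Seq[OF halts_exec[where Q = "?inv (2 * N + 1)"]]; (rule halts_Seq[OF loop])?;
        (rule halts_exec)?) (use init fin in \<open>auto simp: merge_init_def sort_next_def\<close>)
qed

definition sort_time :: "nat \<Rightarrow> nat \<Rightarrow> nat" where
  "sort_time N R = cost sort_init + Suc R * (bcost sort_test + 1 + pass_time N)"

text \<open>\<open>R\<close> bounds the number of passes: the block length doubles from 1 onwards,
  and a single sorted block of length at least \<open>N\<close> is the whole list.\<close>

lemma sort_prog:
  assumes "rmem \<sigma> ''d'' = key" "nmem \<sigma> ''N'' 0 = N" "\<And>y. y < N \<Longrightarrow> nmem \<sigma> ''p'' y = y"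
    and R: "N \<le> 2 ^ R"
  shows "halts sort_prog \<sigma> (sort_time N R)
    (\<lambda>\<tau>. sorted (map key (map (nmem \<tau> ''p'') [nmem \<tau> ''b'' 0..<nmem \<tau> ''b'' 0 + N])) \<and>
         set (map (nmem \<tau> ''p'') [nmem \<tau> ''b'' 0..<nmem \<tau> ''b'' 0 + N]) = {..<N})"
proof -
  let ?ps = "\<lambda>\<sigma> :: store. map (nmem \<sigma> ''p'') [nmem \<sigma> ''b'' 0..<nmem \<sigma> ''b'' 0 + N]"
  define inv where "inv r \<sigma> \<longleftrightarrow> rmem \<sigma> ''d'' = key \<and> nmem \<sigma> ''N'' 0 = N \<and>
      nmem \<sigma> ''B'' 0 = nmem \<sigma> ''b'' 0 + N \<and> blocks_sorted key (nmem \<sigma> ''k'' 0) (?ps \<sigma>) \<and>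
      set (?ps \<sigma>) = {..<N} \<and> (\<exists>m. nmem \<sigma> ''k'' 0 = 2 ^ m \<and> r + m = R)" for r and \<sigma> :: store
  have loop: "halts (While sort_test pass_prog) \<tau> (Suc R * (bcost sort_test + 1 + pass_time N))
      (\<lambda>\<tau>. sorted (map key (?ps \<tau>)) \<and> set (?ps \<tau>) = {..<N})" if "inv R \<tau>" for \<tau>
  proof (rule halts_While[where J = inv, OF that])
    show "\<not> bval sort_test \<tau>" if "inv 0 \<tau>" for \<tau>
      using that R by (auto simp: inv_def sort_test_def)
  next
    fix r \<tau> assume inv: "inv (Suc r) \<tau>" and "bval sort_test \<tau>"
    then obtain m where m: "nmem \<tau> ''k'' 0 = 2 ^ m" "Suc r + m = R"
      by (auto simp: inv_def)
    have "halts pass_prog \<tau> (pass_time N) (\<lambda>\<upsilon>. rmem \<upsilon> ''d'' = key \<and> nmem \<upsilon> ''N'' 0 = N \<and>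
        nmem \<upsilon> ''k'' 0 = 2 ^ m + 2 ^ m \<and> nmem \<upsilon> ''b'' 0 = nmem \<tau> ''b'' 0 + N \<and>
        nmem \<upsilon> ''B'' 0 = nmem \<tau> ''b'' 0 + N + N \<and>
        map (nmem \<upsilon> ''p'') [nmem \<tau> ''b'' 0 + N..<nmem \<tau> ''b'' 0 + N + N] = merge_pass key (2 ^ m) (?ps \<tau>))"
      by (rule pass_prog) (use inv m in \<open>auto simp: inv_def\<close>)
    then show "halts pass_prog \<tau> (pass_time N) (inv r)"
    proof (rule halts_mono)
      fix \<upsilon> :: store assume v: "rmem \<upsilon> ''d'' = key \<and> nmem \<upsilon> ''N'' 0 = N \<and>
        nmem \<upsilon> ''k'' 0 = 2 ^ m + 2 ^ m \<and> nmem \<upsilon> ''b'' 0 = nmem \<tau> ''b'' 0 + N \<and>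
        nmem \<upsilon> ''B'' 0 = nmem \<tau> ''b'' 0 + N + N \<and>
        map (nmem \<upsilon> ''p'') [nmem \<tau> ''b'' 0 + N..<nmem \<tau> ''b'' 0 + N + N] = merge_pass key (2 ^ m) (?ps \<tau>)"
      then have ps: "?ps \<upsilon> = merge_pass key (2 ^ m) (?ps \<tau>)" by simp
      have "\<exists>m'. nmem \<upsilon> ''k'' 0 = 2 ^ m' \<and> r + m' = R"
        using v m by (intro exI[of _ "Suc m"]) auto
      moreover have "blocks_sorted key (nmem \<upsilon> ''k'' 0) (?ps \<upsilon>)"
        unfolding ps using v inv m blocks_sorted_merge_pass by (metis inv_def)
      moreover have "set (?ps \<upsilon>) = {..<N}"
        unfolding ps set_merge_pass using inv by (simp add: inv_def)
      ultimately show "inv r \<upsilon>"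
        unfolding inv_def using v by simp
    qed simp
  next
    fix r \<tau> assume "inv r \<tau>" "\<not> bval sort_test \<tau>"
    then show "sorted (map key (?ps \<tau>)) \<and> set (?ps \<tau>) = {..<N}"
      unfolding inv_def sort_test_def using blocks_sorted_long[of key "nmem \<tau> ''k'' 0" "?ps \<tau>"]
      by (auto simp del: map_map)
  qed
  have init: "inv R (exec sort_init \<sigma>)"
  proof -
    have "map (nmem \<sigma> ''p'') [0..<N] = [0..<N]"
      using assms(3) by (intro map_idI) simp
    then show ?thesis
      using assms(1,2) blocks_sorted_1 unfolding inv_def by (auto simp: sort_init_def)
  qed
  show ?thesis
    unfolding sort_prog_def sort_time_def block.simps
    by (rule halts_Seq[OF halts_exec[where Q = "inv R"]]; (rule loop)?)
       (use init in \<open>auto simp: sort_init_def\<close>)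
qed

section \<open>Ways of travelling with canonical refills\<close>

locale gas_problem =
  fixes I :: gas_instance
  assumes valid: "valid_instance I"
begin

abbreviation "n \<equiv> verts I"
abbreviation "U \<equiv> capacity I"
abbreviation "c \<equiv> price I"

text \<open>The diagonal of \<open>d\<close> is unconstrained; the value 0 extends the triangle
  inequality to coinciding vertices.\<close>

definition dist :: "nat \<Rightarrow> nat \<Rightarrow> real" where
  "dist u v = (if u = v then 0 else d I u v)"

text \<open>Each of the at most \<open>max_stops I\<close> refills of a feasible way buys at most
  \<open>U\<close> units at a price bounded by the sum of all prices. The summand 1 makes the bound
  strict.\<close>

definition M :: real where
  "M = 1 + real (max_stops I) * (U * (\<Sum>v<n. c v))"

text \<open>
  \<open>A q v g\<close> is the optimal cost of reaching the destination from \<open>v\<close> with \<open>g\<close> units in the tank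
  and at most \<open>q\<close> refill stops, where every stop either fills the tank or buys just enough to
  reach the next stop with an empty tank. Values from \<open>M\<close> on stand for infinity.
\<close>

primrec A :: "nat \<Rightarrow> nat \<Rightarrow> real \<Rightarrow> real" where
  "A 0 v g = (if v = dst I then 0 else M)"
| "A (Suc q) v g = Min (insert (A q v g)
     ((\<lambda>w. (dist v w - g) * c v + A q w 0) ` {w. w < n \<and> w \<noteq> v \<and> dist v w \<le> U \<and> g \<le> dist v w} \<union>
      (\<lambda>w. (U - g) * c v + A q w (U - dist v w)) ` {w. w < n \<and> w \<noteq> v \<and> dist v w \<le> U}))"

lemma U_pos: "U > 0" and stops_pos: "max_stops I > 0"
  and src: "src I < n" and dst: "dst I < n" and n_pos: "n > 0"
  using valid by (auto simp: valid_instance_def)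

lemma c_pos: "v < n \<Longrightarrow> c v > 0"
  using valid by (auto simp: valid_instance_def)

lemma d_pos: "u < n \<Longrightarrow> v < n \<Longrightarrow> u \<noteq> v \<Longrightarrow> d I u v > 0"
  using valid by (auto simp: valid_instance_def)

lemma d_sym: "u < n \<Longrightarrow> v < n \<Longrightarrow> u \<noteq> v \<Longrightarrow> d I u v = d I v u"
  using valid by (auto simp: valid_instance_def)

lemma dist_self [simp]: "dist v v = 0"
  by (simp add: dist_def)

lemma dist_sym: "u < n \<Longrightarrow> v < n \<Longrightarrow> dist u v = dist v u"
  using d_sym by (auto simp: dist_def)

lemma dist_nonneg: "u < n \<Longrightarrow> v < n \<Longrightarrow> dist u v \<ge> 0"
  using d_pos[of u v] by (auto simp: dist_def)

lemma dist_pos: "u < n \<Longrightarrow> v < n \<Longrightarrow> u \<noteq> v \<Longrightarrow> dist u v > 0"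
  using d_pos by (auto simp: dist_def)

lemma dist_triangle:
  assumes "u < n" "v < n" "w < n"
  shows "dist u w \<le> dist u v + dist v w"
proof (cases "u \<noteq> v \<and> v \<noteq> w \<and> u \<noteq> w")
  case True
  then show ?thesis
    using valid assms unfolding valid_instance_def dist_def by simp
next
  case False
  then show ?thesis
    using assms dist_nonneg[of u v] dist_nonneg[of v w] by auto
qed

lemma sum_c_nonneg: "0 \<le> (\<Sum>v<n. c v)"
  by (rule sum_nonneg) (use c_pos in \<open>auto intro: less_imp_le\<close>)

lemma M_ge_1: "M \<ge> 1"
  unfolding M_def using U_pos sum_c_nonneg by simp

section \<open>Elementary bounds for the recurrence\<close>

lemma A_keep: "A (Suc q) v g \<le> A q v g"
  by (simp add: Min_le_iff del: Min_insert)

lemma A_exact: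
  "w < n \<Longrightarrow> w \<noteq> v \<Longrightarrow> dist v w \<le> U \<Longrightarrow> g \<le> dist v w \<Longrightarrow>
     A (Suc q) v g \<le> (dist v w - g) * c v + A q w 0"
  by (auto simp add: Min_le_iff simp del: Min_insert)

lemma A_fill:
  "w < n \<Longrightarrow> w \<noteq> v \<Longrightarrow> dist v w \<le> U \<Longrightarrow>
     A (Suc q) v g \<le> (U - g) * c v + A q w (U - dist v w)"
  by (auto simp add: Min_le_iff simp del: Min_insert)

lemma A_cases [consumes 0, case_names keep exact fill]:
  obtains "A (Suc q) v g = A q v g"
  | w where "w < n" "w \<noteq> v" "dist v w \<le> U" "g \<le> dist v w"
      "A (Suc q) v g = (dist v w - g) * c v + A q w 0"
  | w where "w < n" "w \<noteq> v" "dist v w \<le> U"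
      "A (Suc q) v g = (U - g) * c v + A q w (U - dist v w)"
proof -
  have "A (Suc q) v g \<in> insert (A q v g)
     ((\<lambda>w. (dist v w - g) * c v + A q w 0) ` {w. w < n \<and> w \<noteq> v \<and> dist v w \<le> U \<and> g \<le> dist v w} \<union>
      (\<lambda>w. (U - g) * c v + A q w (U - dist v w)) ` {w. w < n \<and> w \<noteq> v \<and> dist v w \<le> U})"
    unfolding A.simps by (rule Min_in) auto
  then show ?thesis
    using that by blast
qed

lemma A_eqI:
  assumes "x \<le> A q v g"
    and "\<And>w. w < n \<Longrightarrow> w \<noteq> v \<Longrightarrow> dist v w \<le> U \<Longrightarrow> g \<le> dist v w \<Longrightarrow>
           x \<le> (dist v w - g) * c v + A q w 0"
    and "\<And>w. w < n \<Longrightarrow> w \<noteq> v \<Longrightarrow> dist v w \<le> U \<Longrightarrow> x \<le> (U - g) * c v + A q w (U - dist v w)"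
    and "A (Suc q) v g \<le> x"
  shows "A (Suc q) v g = x"
  by (rule antisym[OF assms(4)]) (cases q v g rule: A_cases; use assms in simp)

lemma A_le_M: "A q v g \<le> M"
proof (induction q)
  case 0
  then show ?case using M_ge_1 by simp
next
  case (Suc q)
  then show ?case using A_keep[of q v g] by linarith
qed

text \<open>Missing gas can be added to the purchase at the first stop, which is \<open>w\<close>
  itself, so gas in the tank is worth at most its local price. Without a stop the value does not
  depend on the gas.\<close>

lemma A_slope:
  assumes "w < n" "0 \<le> g" "g \<le> g'"
  shows "A q w g \<le> A q w g' + (g' - g) * c w"
proof (induction q)
  case 0
  then show ?case using assms c_pos[of w] by simp
next
  case (Suc q)
  show ?case
  proof (cases q w g' rule: A_cases)
    case keep
    then show ?thesis using Suc A_keep[of q w g] by linarith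
  next
    case (exact x)
    then have "A (Suc q) w g \<le> (dist w x - g) * c w + A q x 0"
      using assms by (intro A_exact) auto
    then show ?thesis using exact by (simp add: algebra_simps)
  next
    case (fill x)
    then have "A (Suc q) w g \<le> (U - g) * c w + A q x (U - dist w x)"
      using assms by (intro A_fill) auto
    then show ?thesis using fill by (simp add: algebra_simps)
  qed
qed

text \<open>
  The cost \<open>x\<close> suffices from \<open>v\<close> with \<open>g\<close> units: drive to some \<open>w\<close> without buying, possibly
  discarding gas, and proceed there according to \<open>A\<close>. Allowing gas to be discarded makes this
  notion monotone in \<open>g\<close>, which \<open>A\<close> itself is not.
\<close>

definition suffices :: "nat \<Rightarrow> nat \<Rightarrow> real \<Rightarrow> real \<Rightarrow> bool" where
  "suffices q v g x \<longleftrightarrow> (\<exists>w g'. w < n \<and> 0 \<le> g' \<and> g' + dist v w \<le> g \<and> A q w g' \<le> x)"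

section \<open>The exchange argument\<close>

lemma sufficesI:
  "w < n \<Longrightarrow> 0 \<le> g' \<Longrightarrow> g' + dist v w \<le> g \<Longrightarrow> A q w g' \<le> x \<Longrightarrow> suffices q v g x"
  unfolding suffices_def by blast

lemma sufficesI_here: "v < n \<Longrightarrow> 0 \<le> g \<Longrightarrow> A q v g \<le> x \<Longrightarrow> suffices q v g x"
  by (rule sufficesI[of v g]) auto

lemma suffices_Suc: "suffices q v g x \<Longrightarrow> suffices (Suc q) v g x"
  unfolding suffices_def using A_keep order_trans by blast

lemma suffices_mono: "q \<le> q' \<Longrightarrow> suffices q v g x \<Longrightarrow> suffices q' v g x"
  by (induction q' rule: dec_induct) (auto intro: suffices_Suc)

text \<open>Two drives without a refill in between merge into one by the triangle inequality, and
  the surplus is discarded.\<close>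

lemma suffices_drive:
  assumes "suffices q w (g - dist v w) x" "v < n" "w < n"
  shows "suffices q v g x"
proof -
  obtain u g' where u: "u < n" "0 \<le> g'" "g' + dist w u \<le> g - dist v w" "A q u g' \<le> x"
    using assms(1) unfolding suffices_def by blast
  show ?thesis
    using dist_triangle[of v w u] assms(2,3) u by (intro sufficesI[of u g']) auto
qed

text \<open>If the gas at hand reaches \<open>w\<close>, drive on, discard the rest and pay
  \<open>A q w 0\<close>; otherwise buy the difference at \<open>v\<close>.\<close>

lemma suffices_buy_exact:
  assumes "v < n" "w < n" "0 \<le> g" "dist v w \<le> U" "0 \<le> x"
    and "(dist v w - g) * c v + A q w 0 \<le> x" "A q w 0 \<le> x"
  shows "suffices (Suc q) v g x"
proof (cases "dist v w \<le> g")
  case True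
  have "A (Suc q) w 0 \<le> x"
    using assms(7) A_keep[of q w 0] by linarith
  then show ?thesis using True assms by (intro sufficesI[of w 0]) auto
next
  case False
  then have "w \<noteq> v" using assms(3) by auto
  then have "A (Suc q) v g \<le> x"
    using A_exact[of w v g q] assms False by linarith
  then show ?thesis using assms by (intro sufficesI_here) auto
qed

text \<open>The bound \<open>g \<le> U\<close> keeps the price \<open>(U - g) * c v\<close> of a
  fill nonnegative.\<close>

lemma A_nonneg: 
  assumes "v < n" "g \<le> U" shows "0 \<le> A q v g"
  using assms
proof (induction q arbitrary: v g)
  case 0
  then show ?case using M_ge_1 by simp
next
  case (Suc q)
  show ?case
  proof (cases q v g rule: A_cases)
    case keep
    then show ?thesis using Suc by simp
  next
    case (exact x)
    then show ?thesis using Suc.IH[of x 0] Suc.prems c_pos[of v] U_pos by simp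
  next
    case (fill x)
    then show ?thesis using Suc.IH[of x "U - dist v x"] Suc.prems c_pos[of v] dist_nonneg[of v x]
      by simp
  qed
qed

text \<open>
  The exchange argument: if gas at the next stop \<open>w\<close> is not dearer than at \<open>v\<close>, buy less at \<open>v\<close>
  until \<open>w\<close> is reached empty; otherwise buy more at \<open>v\<close>, until the tank is full or \<open>w\<close> can be
  skipped.
\<close>

lemma A_buy:
  assumes "v < n" "w < n" "0 \<le> g'" "g' + dist v w \<le> h" "0 \<le> g" "g \<le> h" "h \<le> U"
  shows "suffices (Suc q) v g ((h - g) * c v + A q w g')"
proof (cases "c w \<le> c v")
  case True
  let ?x = "(h - g) * c v + A q w g'"
  show ?thesis
  proof (cases "dist v w \<le> g")
    case le: True
    \<comment> \<open>Buy nothing at \<open>v\<close>. The gas then lacking at \<open>w\<close>, at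
      most \<open>h - g\<close>, is bought there at a price that is not higher.\<close>
    define g2 where "g2 = min g' (g - dist v w)"
    have "A (Suc q) w g2 \<le> A q w g2" by (rule A_keep)
    also have "\<dots> \<le> A q w g' + (g' - g2) * c w"
      using assms le by (intro A_slope) (auto simp: g2_def)
    also have "(g' - g2) * c w \<le> (h - g) * c v"
      using assms le True c_pos by (intro mult_mono) (auto simp: g2_def less_imp_le)
    finally show ?thesis
      using assms le by (intro sufficesI[of w g2]) (auto simp: g2_def)
  next
    case False
    \<comment> \<open>Buy at \<open>v\<close> only what is needed to reach \<open>w\<close>, and
      postpone the other \<open>g'\<close> units to \<open>w\<close>.\<close>
    have "A q w 0 \<le> A q w g' + (g' - 0) * c w"
      using assms by (intro A_slope) auto
    moreover have "g' * c w \<le> g' * c v"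
      using assms True by (intro mult_left_mono) auto
    moreover have "(g' + dist v w) * c v \<le> h * c v"
      using assms c_pos[of v] by (intro mult_right_mono) auto
    ultimately have "(dist v w - g) * c v + A q w 0 \<le> ?x"
      by (simp add: algebra_simps)
    moreover have "A (Suc q) v g \<le> (dist v w - g) * c v + A q w 0"
      using assms False by (intro A_exact) auto
    ultimately show ?thesis
      using assms by (intro sufficesI_here) auto
  qed
next
  case False
  then have wv: "w \<noteq> v" by auto
  show ?thesis
  \<comment> \<open>The induction hypothesis serves the case in which the value at \<open>w\<close>
    is already attained with one stop fewer.\<close>
  proof (induction q)
    case 0
    have hv: "(h - g) * c v \<ge> 0" using assms c_pos[of v] by simp
    show ?case
    proof (cases "w = dst I")
      case True
      have "(dist v w - g) * c v \<le> (h - g) * c v"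
        using assms c_pos[of v] by (intro mult_right_mono) auto
      then show ?thesis using True assms hv by (intro suffices_buy_exact[of v w]) auto
    next
      case False
      \<comment> \<open>Away from the destination and without a stop left, the given cost is at
        least \<open>M\<close>, and no value of \<open>A\<close> exceeds \<open>M\<close>.\<close>
      then show ?thesis using assms hv A_le_M[of "Suc 0" v g]
        by (intro sufficesI_here) (auto simp del: A.simps(2))
    qed
  next
    case (Suc q)
    have cv: "0 < c v" "c v < c w" using False c_pos assms by auto
    have fill: "A (Suc (Suc q)) v g \<le> (U - g) * c v + A (Suc q) w (U - dist v w)"
      using assms wv by (intro A_fill) auto
    \<comment> \<open>Filling up at \<open>v\<close> costs \<open>U - h\<close> additional units
      there and saves at least as many dearer units at \<open>w\<close>.\<close>
    have gain: "(U - h) * c v \<le> (U - dist v w - g') * c w"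
      using assms cv by (intro mult_mono) auto
    show ?case
    proof (cases q w g' rule: A_cases)
      case keep
      then show ?thesis using suffices_Suc[OF Suc] by simp
    next
      case (exact x)
      show ?thesis
      proof (cases "dist v w + dist w x \<le> U")
        case True
        \<comment> \<open>Move the purchase from \<open>w\<close> to \<open>v\<close> and drive
          straight to \<open>x\<close>; this even saves a stop.\<close>
        have "(dist v x - g) * c v \<le> ((h - g) + (dist w x - g')) * c v"
          using dist_triangle[of v w x] assms exact cv by (intro mult_right_mono) auto
        also have "\<dots> \<le> (h - g) * c v + (dist w x - g') * c w"
          using exact cv mult_left_mono[of "c v" "c w" "dist w x - g'"]
          by (simp add: distrib_right)
        finally have *: "(dist v x - g) * c v \<le> (h - g) * c v + (dist w x - g') * c w" .
        have nn: "0 \<le> (h - g) * c v + (dist w x - g') * c w"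
          using exact cv assms by simp
        have "suffices (Suc q) v g ((h - g) * c v + A (Suc q) w g')"
          using dist_triangle[of v w x] assms exact True * nn A_nonneg[of x 0 q] U_pos
          by (intro suffices_buy_exact[of v x]) auto
        then show ?thesis by (rule suffices_Suc)
      next
        case False
        \<comment> \<open>A full tank at \<open>v\<close> does not last via \<open>w\<close> to
          \<open>x\<close>. So fill up at \<open>v\<close>; the stop at \<open>w\<close> remains,
          with a purchase no larger than before.\<close>
        have "A (Suc q) w (U - dist v w) \<le> (dist w x - (U - dist v w)) * c w + A q x 0"
          using exact False by (intro A_exact) auto
        then have "A (Suc (Suc q)) v g \<le> (h - g) * c v + A (Suc q) w g'"
          using fill gain exact by (simp add: algebra_simps del: A.simps(2))
        then show ?thesis using assms by (intro sufficesI_here) auto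
      qed
    next
      case (fill x)
      have "A (Suc q) w (U - dist v w) \<le> (U - (U - dist v w)) * c w + A q x (U - dist w x)"
        using fill by (intro A_fill) auto
      then have "A (Suc (Suc q)) v g \<le> (h - g) * c v + A (Suc q) w g'"
        using \<open>A (Suc (Suc q)) v g \<le> (U - g) * c v + A (Suc q) w (U - dist v w)\<close> gain fill
        by (simp add: algebra_simps del: A.simps(2))
      then show ?thesis using assms by (intro sufficesI_here) auto
    qed
  qed
qed

lemma suffices_buy:
  assumes "suffices q v h x" "v < n" "0 \<le> g" "g \<le> h" "h \<le> U"
  shows "suffices (Suc q) v g ((h - g) * c v + x)"
proof -
  obtain w g' where w: "w < n" "0 \<le> g'" "g' + dist v w \<le> h" "A q w g' \<le> x"
    using assms(1) unfolding suffices_def by blast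
  have "suffices (Suc q) v g ((h - g) * c v + A q w g')"
    using assms w by (intro A_buy) auto
  then show ?thesis
    using w(4) unfolding suffices_def by (meson add_left_mono order_trans)
qed

section \<open>Lower bound for feasible ways\<close>

lemma feasible_length: "feasible I vs fs \<Longrightarrow> length vs = Suc (length fs)"
  by (auto simp: feasible_def travel_way_def Suc_pred)

lemma feasible_vertex:
  assumes "feasible I vs fs" "i \<le> length fs"
  shows "vs ! i < n"
proof -
  have "vs ! i \<in> set vs"
    using feasible_length[OF assms(1)] assms(2) by simp
  then show ?thesis
    using assms(1) unfolding feasible_def travel_way_def by blast
qed

text \<open>Backward induction along the way: driving a leg is \<open>suffices_drive\<close>, and a
  positive purchase is \<open>suffices_buy\<close>, which consumes one stop. Positions without a
  purchase consume none, so vertices merely passed through are absorbed.\<close>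

lemma suffices_feasible_suffix:
  assumes f: "feasible I vs fs" and "i \<le> length fs"
  shows "suffices (card {j. i \<le> j \<and> j < length fs \<and> fs ! j > 0}) (vs ! i) (gas I vs fs i)
           (\<Sum>j\<in>{i..<length fs}. fs ! j * c (vs ! j))"
  using assms(2)
proof (induction i rule: inc_induct)
  case base
  have len: "length vs = Suc (length fs)" "last vs = dst I" "vs \<noteq> []"
    using f by (auto simp: feasible_def travel_way_def Suc_pred)
  then have "vs ! length fs = dst I" by (metis last_conv_nth diff_Suc_1)
  moreover have "gas I vs fs (length fs) \<ge> 0"
    using f by (cases "length fs") (auto simp: feasible_def simp del: gas.simps(2))
  moreover have "{j. length fs \<le> j \<and> j < length fs \<and> fs ! j > 0} = {}"
    by auto
  ultimately show ?case using dst by (simp only: card.empty) (intro sufficesI_here; simp)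
next
  case (step i)
  let ?v = "vs ! i" and ?w = "vs ! Suc i" and ?g = "gas I vs fs i"
  let ?S = "\<lambda>i. {j. i \<le> j \<and> j < length fs \<and> fs ! j > 0}"
  have len: "length vs = Suc (length fs)"
    using f by (rule feasible_length)
  have v: "?v < n" "?w < n"
    using feasible_vertex[OF f] step(2) by auto
  have "distinct_adj vs" using f by (auto simp: feasible_def travel_way_def)
  then have "?v \<noteq> ?w"
    using step(2) len by (auto simp: distinct_adj_conv_nth)
  then have "dist ?v ?w = d I ?v ?w" by (simp add: dist_def)
  have g: "?g \<ge> 0"
    using f step(2) by (cases i) (auto simp: feasible_def simp del: gas.simps(2))
  have h: "?g + fs ! i \<le> U" and fi: "fs ! i \<ge> 0"
    using f step(2) by (auto simp: feasible_def travel_way_def)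
  have split: "(\<Sum>j\<in>{i..<length fs}. fs ! j * c (vs ! j)) =
      fs ! i * c ?v + (\<Sum>j\<in>{Suc i..<length fs}. fs ! j * c (vs ! j))"
    using step(2) by (simp add: sum.atLeast_Suc_lessThan)
  have gas_Suc: "gas I vs fs (Suc i) = (?g + fs ! i) - dist ?v ?w"
    using \<open>dist ?v ?w = d I ?v ?w\<close> by simp
  have drive: "suffices (card (?S (Suc i))) ?v (?g + fs ! i)
      (\<Sum>j\<in>{Suc i..<length fs}. fs ! j * c (vs ! j))"
    using step(3) v unfolding gas_Suc by (rule suffices_drive)
  have le: "i \<le> j \<longleftrightarrow> j = i \<or> Suc i \<le> j" for j
    by auto
  show ?case
  proof (cases "fs ! i > 0")
    case True
    then have "?S i = insert i (?S (Suc i))"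
      unfolding le using step(2) by blast
    then have card: "card (?S i) = Suc (card (?S (Suc i)))" by simp
    have "(?g + fs ! i - ?g) * c ?v = fs ! i * c ?v" by simp
    then show ?thesis
      using suffices_buy[OF drive v(1) g _ h] fi unfolding card split by simp
  next
    case False
    then have "?S i = ?S (Suc i)"
      unfolding le by blast
    moreover have "fs ! i = 0" using False fi by simp
    ultimately show ?thesis using drive unfolding split by simp
  qed
qed

text \<open>With an empty tank and positive distances, the relaxation in \<open>suffices\<close>
  allows neither a drive nor a discard at the start, so it collapses to \<open>A\<close> at the
  source.\<close>

lemma feasible_cost_ge:
  assumes "feasible I vs fs"
  shows "A (max_stops I) (src I) 0 \<le> travel_cost I vs fs"
proof -
  have "vs ! 0 = src I"
    using assms by (auto simp: feasible_def travel_way_def hd_conv_nth)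
  moreover have "card {j. j < length fs \<and> fs ! j > 0} \<le> max_stops I"
    using assms by (simp add: feasible_def)
  ultimately have "suffices (max_stops I) (src I) 0 (travel_cost I vs fs)"
    using suffices_mono suffices_feasible_suffix[OF assms, of 0]
    by (simp add: travel_cost_def lessThan_atLeast0)
  then obtain w g where *: "w < n" "0 \<le> g" "g + dist (src I) w \<le> 0"
    "A (max_stops I) w g \<le> travel_cost I vs fs"
    unfolding suffices_def by blast
  have "dist (src I) w \<ge> 0" using * src by (intro dist_nonneg)
  then have "g = 0" "dist (src I) w \<le> 0" using * by linarith+
  then have "w = src I" using dist_pos[OF src *(1)] by force
  then show ?thesis using * \<open>g = 0\<close> by simp
qed

lemma feasible_cost_less:
  assumes "feasible I vs fs"
  shows "travel_cost I vs fs < M"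
proof -
  let ?J = "{i. i < length fs \<and> fs ! i > 0}" and ?S = "\<Sum>v<n. c v"
  have S: "?S \<ge> 0" by (rule sum_c_nonneg)
  have "fs ! i \<ge> 0" if "i < length fs" for i
    using assms that by (auto simp: feasible_def travel_way_def)
  then have "travel_cost I vs fs = (\<Sum>i\<in>?J. fs ! i * c (vs ! i))"
    unfolding travel_cost_def
    by (intro sum.mono_neutral_right) (auto simp: not_less intro: antisym)
  also have "\<dots> \<le> real (card ?J) * (U * ?S)"
  proof (rule sum_bounded_above)
    fix i assume i: "i \<in> ?J"
    then have "vs ! i < n"
      using feasible_vertex[OF assms] by auto
    then have "c (vs ! i) \<le> ?S"
      using c_pos by (intro member_le_sum) (auto intro: less_imp_le)
    moreover have "gas I vs fs i \<ge> 0"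
      using assms i by (cases i) (auto simp: feasible_def simp del: gas.simps(2))
    then have "fs ! i \<le> U"
      using assms i unfolding feasible_def by fastforce
    ultimately show "fs ! i * c (vs ! i) \<le> U * ?S"
      using i c_pos[OF \<open>vs ! i < n\<close>] U_pos by (intro mult_mono) auto
  qed
  also have "\<dots> \<le> real (max_stops I) * (U * ?S)"
    using assms S U_pos by (intro mult_right_mono) (auto simp: feasible_def)
  finally show ?thesis by (simp add: M_def)
qed

section \<open>Ways built leg by leg\<close>

definition partial_way :: "nat list \<Rightarrow> real list \<Rightarrow> nat \<Rightarrow> real \<Rightarrow> real \<Rightarrow> bool" where
  "partial_way vs fs v g x \<longleftrightarrow>
     vs \<noteq> [] \<and> set vs \<subseteq> {..<n} \<and> hd vs = src I \<and> last vs = v \<and> distinct_adj vs \<and>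
     length vs = Suc (length fs) \<and> (\<forall>f \<in> set fs. f \<ge> 0) \<and>
     (\<forall>i < length fs. gas I vs fs i + fs ! i \<le> U \<and> gas I vs fs (Suc i) \<ge> 0) \<and>
     gas I vs fs (length fs) = g \<and> travel_cost I vs fs = x"

lemma partial_way_start: "partial_way [src I] [] (src I) 0 0"
  using src by (simp add: partial_way_def travel_cost_def)

lemma gas_append:
  "i \<le> length fs \<Longrightarrow> length vs = Suc (length fs) \<Longrightarrow> gas I (vs @ [w]) (fs @ [f]) i = gas I vs fs i"
  by (induction i) (auto simp: nth_append)

lemma partial_way_extend:
  assumes p: "partial_way vs fs v g x" and w: "w < n" "w \<noteq> v"
    and f: "0 \<le> f" "g + f \<le> U" "dist v w \<le> g + f"
  shows "partial_way (vs @ [w]) (fs @ [f]) w (g + f - dist v w) (x + f * c v)"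
proof -
  have vs: "vs \<noteq> []" "length vs = Suc (length fs)" "last vs = v" "gas I vs fs (length fs) = g"
    "travel_cost I vs fs = x"
    using p by (auto simp: partial_way_def)
  then have v: "vs ! length fs = v"
    by (simp add: last_conv_nth)
  note ga = gas_append[OF _ vs(2), of _ w f]
  have gas_last: "gas I (vs @ [w]) (fs @ [f]) (Suc (length fs)) = g + f - dist v w"
    using ga[of "length fs"] vs v w(2) by (simp add: nth_append dist_def)
  have "gas I (vs @ [w]) (fs @ [f]) i + (fs @ [f]) ! i \<le> U \<and>
        gas I (vs @ [w]) (fs @ [f]) (Suc i) \<ge> 0" if "i < Suc (length fs)" for i
  proof (cases "i = length fs")
    case True
    then show ?thesis using gas_last f ga[of "length fs"] vs(4) by (simp del: gas.simps)
  next
    case False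
    then have "i < length fs" using that by simp
    then show ?thesis using p ga[of i] ga[of "Suc i"]
      by (simp add: partial_way_def nth_append del: gas.simps)
  qed
  moreover have "travel_cost I (vs @ [w]) (fs @ [f]) = x + f * c v"
    using vs v by (simp add: travel_cost_def nth_append)
  ultimately show ?thesis
    using p w f gas_last vs(3) unfolding partial_way_def
    by (auto simp: distinct_adj_append_iff simp del: gas.simps)
qed

text \<open>Counting every leg as a refill stop overestimates the number of stops, but stays within
  the limit. Optimality is the lower bound \<open>feasible_cost_ge\<close>.\<close>

lemma partial_way_cheapest:
  assumes p: "partial_way vs fs (dst I) g (A (max_stops I) (src I) 0)"
    and len: "length fs \<le> max_stops I"
  shows "cheapest I vs fs"
proof -
  have "card {i. i < length fs \<and> fs ! i > 0} \<le> card {..<length fs}"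
    by (intro card_mono) auto
  then have "feasible I vs fs"
    using p len by (auto simp: partial_way_def feasible_def travel_way_def)
  then show ?thesis
    using p feasible_cost_ge by (auto simp: cheapest_def partial_way_def)
qed

lemma not_feasible_if_A_ge_M: "A (max_stops I) (src I) 0 \<ge> M \<Longrightarrow> \<not> feasible I vs fs"
  using feasible_cost_ge feasible_cost_less by fastforce

end

section \<open>Edge tables\<close>

text \<open>Index arithmetic cannot split an edge number, so its ends and its transposed number are
  stored. The counter \<open>T\<close> follows the transposed number: moving one column to the right
  adds \<open>n\<close>.\<close>

definition table_edge :: prog where
  "table_edge = block [
     NSet ''row'' (nvar ''x'') (nvar ''v''),
     NSet ''col'' (nvar ''x'') (nvar ''w''),
     NSet ''tr'' (nvar ''x'') (nvar ''T''),
     NSet ''p'' (nvar ''x'') (nvar ''x''),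
     Cond (BAnd (nne (nvar ''v'') (nvar ''w'')) (BNot (RLess (rvar ''U'') (RGet ''d'' (nvar ''x'')))))
       (NSet ''ok'' (nvar ''x'') (NConst 1)) (NSet ''ok'' (nvar ''x'') (NConst 0)),
     ninc ''x'',
     ninc ''w'',
     nset ''T'' (NAdd (nvar ''T'') (nvar ''n''))]"

text \<open>Executed in full only at the end of a row. \<open>y\<close> advances by
  \<open>n + 1\<close>, the gap between consecutive loops, and \<open>T\<close> restarts at the new
  row number. The length \<open>U\<close> of a loop is entered once its row is finished.\<close>

definition table_wrap :: prog where
  "table_wrap =
     Cond (NLess (nvar ''w'') (nvar ''n'')) Skip (block [
       NSet ''dg'' (nvar ''v'') (nvar ''y''),
       RSet ''d'' (nvar ''y'') (rvar ''U''),
       rset ''S'' (RAdd (rvar ''S'') (RGet ''c'' (nvar ''v''))),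
       nset ''y'' (NAdd (NAdd (nvar ''y'') (nvar ''n'')) (NConst 1)),
       ninc ''v'',
       nset ''w'' (NConst 0),
       nset ''T'' (nvar ''v'')])"

definition table_step :: prog where
  "table_step = block [table_edge, table_wrap]"

definition table_test :: bexp where
  "table_test = NLess (nvar ''v'') (nvar ''n'')"

text \<open>By now the edge counter has run through all pairs, which yields the square of
  \<open>n\<close> without a multiplication.\<close>

definition bound_init :: prog where
  "bound_init = block [nset ''N'' (nvar ''x''), rset ''M'' (RConst 1)]"

text \<open>\<open>Delta\<close> is a natural number and cannot be converted to a real factor, so
  the product in \<open>M\<close> is formed by \<open>Delta\<close> additions.\<close>

definition bound_step :: prog where
  "bound_step = block [rset ''M'' (RAdd (rvar ''M'') (RMul (rvar ''U'') (rvar ''S''))), ninc ''q'']"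

definition bound_test :: bexp where
  "bound_test = NLess (nvar ''q'') (nvar ''Delta'')"

definition table_prog :: prog where
  "table_prog = block [While table_test table_step, bound_init, While bound_test bound_step]"

context gas_problem begin

text \<open>
  The edge from \<open>v\<close> to \<open>w\<close> has number \<open>v * n + w\<close>. Loops get length \<open>U\<close>, so that \<open>U - E y\<close> is
  the gas on arrival at \<open>y div n\<close> after filling up at \<open>y mod n\<close>, and 0 if \<open>y\<close> is a loop.
\<close>

definition N :: nat where "N = n * n"

definition E :: "nat \<Rightarrow> real" where
  "E y = (if y div n = y mod n then U else d I (y div n) (y mod n))"

definition ok :: "nat \<Rightarrow> bool" where
  "ok y \<longleftrightarrow> y div n \<noteq> y mod n \<and> E y \<le> U"

definition tables :: "store \<Rightarrow> bool" where
  "tables \<sigma> \<longleftrightarrow>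
     nmem \<sigma> ''n'' 0 = n \<and> nmem \<sigma> ''s'' 0 = src I \<and> nmem \<sigma> ''t'' 0 = dst I \<and>
     nmem \<sigma> ''Delta'' 0 = max_stops I \<and> nmem \<sigma> ''N'' 0 = N \<and>
     rmem \<sigma> ''U'' 0 = U \<and> rmem \<sigma> ''M'' 0 = M \<and>
     (\<forall>v < n. rmem \<sigma> ''c'' v = c v \<and> nmem \<sigma> ''dg'' v = v * n + v) \<and>
     (\<forall>y < N. nmem \<sigma> ''row'' y = y div n \<and> nmem \<sigma> ''col'' y = y mod n \<and>
        nmem \<sigma> ''tr'' y = (y mod n) * n + y div n \<and> rmem \<sigma> ''d'' y = E y \<and>
        (0 < nmem \<sigma> ''ok'' y \<longleftrightarrow> ok y))"

lemma edge_less: "v < n \<Longrightarrow> w < n \<Longrightarrow> v * n + w < N"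
  unfolding N_def using mult_le_mono1[of "Suc v" n n] by simp

lemma edge_div_mod [simp]: "w < n \<Longrightarrow> (v * n + w) div n = v" "w < n \<Longrightarrow> (v * n + w) mod n = w"
  by (simp_all add: div_mult_self3[OF less_imp_neq, symmetric])

lemma edge_bounds: "y < N \<Longrightarrow> y div n < n" "y < N \<Longrightarrow> y mod n < n"
  using n_pos by (auto simp: N_def less_mult_imp_div_less)

lemma edge_split: "(y div n) * n + y mod n = y"
  by simp

lemma E_dist: "v < n \<Longrightarrow> w < n \<Longrightarrow> v \<noteq> w \<Longrightarrow> E (v * n + w) = dist v w"
  by (simp add: E_def dist_def)

lemma E_loop: "v < n \<Longrightarrow> E (v * n + v) = U"
  by (simp add: E_def)

lemma E_nonneg: "y < N \<Longrightarrow> 0 \<le> E y"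
  using U_pos d_pos[OF edge_bounds] by (auto simp: E_def intro: less_imp_le)

definition table_inv :: "nat \<Rightarrow> store \<Rightarrow> bool" where
  "table_inv r \<sigma> \<longleftrightarrow>
     (let v = nmem \<sigma> ''v'' 0; w = nmem \<sigma> ''w'' 0; x = nmem \<sigma> ''x'' 0 in
      r + x = N \<and> x = v * n + w \<and> (v < n \<and> w < n \<or> v = n \<and> w = 0) \<and>
      nmem \<sigma> ''T'' 0 = w * n + v \<and> nmem \<sigma> ''y'' 0 = v * n + v \<and> nmem \<sigma> ''q'' 0 = 0 \<and>
      nmem \<sigma> ''n'' 0 = n \<and> nmem \<sigma> ''s'' 0 = src I \<and> nmem \<sigma> ''t'' 0 = dst I \<and>
      nmem \<sigma> ''Delta'' 0 = max_stops I \<and> rmem \<sigma> ''U'' 0 = U \<and> rmem \<sigma> ''S'' 0 = (\<Sum>u<v. c u) \<and>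
      (\<forall>u < n. rmem \<sigma> ''c'' u = c u) \<and> (\<forall>u < v. nmem \<sigma> ''dg'' u = u * n + u) \<and>
      (\<forall>y < N. rmem \<sigma> ''d'' y = (if y div n = y mod n \<and> y div n < v then U else d I (y div n) (y mod n))) \<and>
      (\<forall>y < x. nmem \<sigma> ''row'' y = y div n \<and> nmem \<sigma> ''col'' y = y mod n \<and>
         nmem \<sigma> ''tr'' y = (y mod n) * n + y div n \<and> nmem \<sigma> ''p'' y = y \<and>
         (0 < nmem \<sigma> ''ok'' y \<longleftrightarrow> ok y)))"

lemma table_step:
  assumes inv: "table_inv (Suc r) \<sigma>" and test: "bval table_test \<sigma>"
  shows "table_inv r (exec table_step \<sigma>)"
proof -
  define v w x where defs: "v = nmem \<sigma> ''v'' 0" "w = nmem \<sigma> ''w'' 0" "x = nmem \<sigma> ''x'' 0"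
  define ok' where "ok' = (if v \<noteq> w \<and> \<not> U < rmem \<sigma> ''d'' x then 1 else 0 :: nat)"
  define \<rho> where "\<rho> = exec table_edge \<sigma>"
  define \<tau> where "\<tau> = exec table_wrap \<rho>"
  have \<tau>: "exec table_step \<sigma> = \<tau>"
    by (simp add: table_step_def \<tau>_def \<rho>_def)
  note folds = defs[symmetric]
  have s: "Suc r + x = N" "x = v * n + w" "v < n" "w < n"
      "nmem \<sigma> ''T'' 0 = w * n + v" "nmem \<sigma> ''y'' 0 = v * n + v" "nmem \<sigma> ''q'' 0 = 0"
      "nmem \<sigma> ''n'' 0 = n" "nmem \<sigma> ''s'' 0 = src I" "nmem \<sigma> ''t'' 0 = dst I"
      "nmem \<sigma> ''Delta'' 0 = max_stops I" "rmem \<sigma> ''U'' 0 = U" "rmem \<sigma> ''S'' 0 = (\<Sum>u<v. c u)"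
      "\<And>u. u < n \<Longrightarrow> rmem \<sigma> ''c'' u = c u" "\<And>u. u < v \<Longrightarrow> nmem \<sigma> ''dg'' u = u * n + u"
      "\<And>y. y < N \<Longrightarrow> rmem \<sigma> ''d'' y = (if y div n = y mod n \<and> y div n < v then U else d I (y div n) (y mod n))"
      "\<And>y. y < x \<Longrightarrow> nmem \<sigma> ''row'' y = y div n \<and> nmem \<sigma> ''col'' y = y mod n \<and>
         nmem \<sigma> ''tr'' y = (y mod n) * n + y div n \<and> nmem \<sigma> ''p'' y = y \<and>
         (0 < nmem \<sigma> ''ok'' y \<longleftrightarrow> ok y)"
    using inv test unfolding table_inv_def Let_def folds by (auto simp: folds table_test_def)
  have xm: "x div n = v" "x mod n = w" "x < N"
    using s(1-4) by auto
  \<comment> \<open>On the diagonal the stored distance may be arbitrary; both sides are false there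
    because they demand \<open>v \<noteq> w\<close>.\<close>
  have okx: "0 < ok' \<longleftrightarrow> ok x"
    using s(16)[OF xm(3)] by (auto simp: ok'_def ok_def xm E_def)
  have \<rho>: "nmem \<rho> ''row'' = (nmem \<sigma> ''row'')(x := v)" "nmem \<rho> ''col'' = (nmem \<sigma> ''col'')(x := w)"
      "nmem \<rho> ''tr'' = (nmem \<sigma> ''tr'')(x := w * n + v)" "nmem \<rho> ''p'' = (nmem \<sigma> ''p'')(x := x)"
      "nmem \<rho> ''ok'' = (nmem \<sigma> ''ok'')(x := ok')"
      "nmem \<rho> ''x'' 0 = Suc x" "nmem \<rho> ''w'' 0 = Suc w" "nmem \<rho> ''T'' 0 = w * n + v + n"
      "nmem \<rho> ''v'' 0 = v" "nmem \<rho> ''y'' 0 = v * n + v" "nmem \<rho> ''q'' 0 = 0"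
      "nmem \<rho> ''n'' 0 = n" "nmem \<rho> ''s'' 0 = src I" "nmem \<rho> ''t'' 0 = dst I"
      "nmem \<rho> ''Delta'' 0 = max_stops I" "nmem \<rho> ''dg'' = nmem \<sigma> ''dg''" "rmem \<rho> = rmem \<sigma>"
    by (simp_all add: \<rho>_def table_edge_def folds ok'_def neq_iff s(5-12) disj_commute)
  note \<rho> = \<rho>(1-16) fun_cong[OF \<rho>(17), of "''U''"] fun_cong[OF \<rho>(17), of "''S''"]
    fun_cong[OF \<rho>(17), of "''c''"] fun_cong[OF \<rho>(17), of "''d''"]
  have arr: "nmem \<tau> ''row'' = (nmem \<sigma> ''row'')(x := v)" "nmem \<tau> ''col'' = (nmem \<sigma> ''col'')(x := w)"
      "nmem \<tau> ''tr'' = (nmem \<sigma> ''tr'')(x := w * n + v)" "nmem \<tau> ''p'' = (nmem \<sigma> ''p'')(x := x)"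
      "nmem \<tau> ''ok'' = (nmem \<sigma> ''ok'')(x := ok')" "nmem \<tau> ''x'' 0 = Suc x" "nmem \<tau> ''q'' 0 = 0"
      "nmem \<tau> ''n'' 0 = n" "nmem \<tau> ''s'' 0 = src I" "nmem \<tau> ''t'' 0 = dst I"
      "nmem \<tau> ''Delta'' 0 = max_stops I" "rmem \<tau> ''U'' 0 = U" "rmem \<tau> ''c'' = rmem \<sigma> ''c''"
    by (cases "Suc w < n"; simp add: \<tau>_def table_wrap_def \<rho> s(12))+
  have tab: "nmem \<tau> ''row'' y = y div n \<and> nmem \<tau> ''col'' y = y mod n \<and>
         nmem \<tau> ''tr'' y = (y mod n) * n + y div n \<and> nmem \<tau> ''p'' y = y \<and>
         (0 < nmem \<tau> ''ok'' y \<longleftrightarrow> ok y)" if "y < Suc x" for y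
    using that s(17)[of y] okx xm by (cases "y = x") (auto simp: arr)
  show ?thesis
  proof (cases "Suc w < n")
    case True
    have eqs: "nmem \<tau> ''v'' 0 = v" "nmem \<tau> ''w'' 0 = Suc w" "nmem \<tau> ''T'' 0 = Suc w * n + v"
        "nmem \<tau> ''y'' 0 = v * n + v" "nmem \<tau> ''dg'' = nmem \<sigma> ''dg''" "rmem \<tau> ''S'' 0 = (\<Sum>u<v. c u)"
        "rmem \<tau> ''d'' = rmem \<sigma> ''d''"
      using True by (simp_all add: \<tau>_def table_wrap_def \<rho> s(13))
    show ?thesis
      using s(1-3) True s(14-16) tab
      unfolding \<tau> table_inv_def Let_def eqs arr(6-13) by auto
  next
    case False
    then have w: "Suc w = n" using s(4) by simp
    have eqs: "nmem \<tau> ''v'' 0 = Suc v" "nmem \<tau> ''w'' 0 = 0" "nmem \<tau> ''T'' 0 = 0 * n + Suc v"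
        "nmem \<tau> ''y'' 0 = Suc v * n + Suc v" "nmem \<tau> ''dg'' = (nmem \<sigma> ''dg'')(v := v * n + v)"
        "rmem \<tau> ''S'' 0 = (\<Sum>u<Suc v. c u)"
        "rmem \<tau> ''d'' = (rmem \<sigma> ''d'')(v * n + v := U)"
      using False by (simp_all add: \<tau>_def table_wrap_def \<rho> s(3,12-14))
    have dg: "((nmem \<sigma> ''dg'')(v := v * n + v)) u = u * n + u" if "u < Suc v" for u
      using s(15)[of u] that by auto
    have dd: "((rmem \<sigma> ''d'')(v * n + v := U)) y =
        (if y div n = y mod n \<and> y div n < Suc v then U else d I (y div n) (y mod n))" if "y < N" for y
    proof (cases "y = v * n + v")
      case True
      then show ?thesis using s(3) by simp
    next
      case False
      then have "y div n = y mod n \<Longrightarrow> y div n \<noteq> v"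
        using edge_split[of y] by auto
      then show ?thesis using False s(16)[OF that] by (auto simp: less_Suc_eq)
    qed
    have x: "Suc x = Suc v * n + 0" using s(2) w by simp
    have v: "Suc v < n \<and> 0 < n \<or> Suc v = n \<and> 0 = (0::nat)" using s(3) by auto
    show ?thesis
      using s(1) v x s(14) dg dd tab
      unfolding \<tau> table_inv_def Let_def eqs arr(6-13) by simp
  qed
qed

definition table_time :: nat where
  "table_time = Suc N * (bcost table_test + 1 + cost table_step) + (cost bound_init +
     Suc (max_stops I) * (bcost bound_test + 1 + cost bound_step))"

lemma table_prog:
  "halts table_prog (input_store I) table_time
     (\<lambda>\<tau>. tables \<tau> \<and> (\<forall>y < N. nmem \<tau> ''p'' y = y))"
proof -
  have loop: "halts (While table_test table_step) (input_store I)
      (Suc N * (bcost table_test + 1 + cost table_step))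
      (\<lambda>\<tau>. \<exists>r. table_inv r \<tau> \<and> \<not> bval table_test \<tau>)"
  proof (rule halts_While[where J = table_inv])
    have "(rmem (input_store I) ''d'') y = d I (y div n) (y mod n)" if "y < N" for y
      using that by (simp add: input_store_def N_def)
    then show "table_inv N (input_store I)"
      using n_pos unfolding table_inv_def Let_def
      by (simp add: input_store_def)
    show "\<not> bval table_test \<tau>" if "table_inv 0 \<tau>" for \<tau>
      using that edge_less[of "nmem \<tau> ''v'' 0" "nmem \<tau> ''w'' 0"]
      by (auto simp: table_inv_def Let_def table_test_def)
    show "halts table_step \<tau> (cost table_step) (table_inv r)"
      if "table_inv (Suc r) \<tau>" "bval table_test \<tau>" for r \<tau>
      by (rule halts_exec) (use table_step[OF that] in \<open>simp_all add: table_step_def table_edge_def table_wrap_def\<close>)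
  qed auto
  \<comment> \<open>While \<open>M\<close> is still being accumulated, everything else in
    \<open>tables\<close> already holds. This is expressed by overwriting \<open>M\<close> with its
    final value.\<close>
  define J where "J r \<tau> \<longleftrightarrow> r + nmem \<tau> ''q'' 0 = max_stops I \<and>
      rmem \<tau> ''M'' 0 = 1 + real (nmem \<tau> ''q'' 0) * (U * (\<Sum>v<n. c v)) \<and>
      rmem \<tau> ''S'' 0 = (\<Sum>v<n. c v) \<and> tables (\<tau>\<lparr>rmem := (rmem \<tau>)(''M'' := \<lambda>_. M)\<rparr>) \<and>
      (\<forall>y < N. nmem \<tau> ''p'' y = y)" for r and \<tau> :: store
  have init: "J (max_stops I) (exec bound_init \<tau>)" if "table_inv r \<tau>" "\<not> bval table_test \<tau>" for r \<tau>
  proof -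
    have "nmem \<tau> ''v'' 0 = n" "nmem \<tau> ''x'' 0 = N"
      using that by (auto simp: table_inv_def Let_def table_test_def N_def)
    then show ?thesis
      using that(1) edge_bounds(2) unfolding J_def tables_def table_inv_def Let_def
      by (simp add: bound_init_def E_def)
  qed
  have bound: "halts (While bound_test bound_step) \<tau>
      (Suc (max_stops I) * (bcost bound_test + 1 + cost bound_step))
      (\<lambda>\<tau>. tables \<tau> \<and> (\<forall>y < N. nmem \<tau> ''p'' y = y))" if "J (max_stops I) \<tau>" for \<tau>
  proof (rule halts_While[where J = J, OF that])
    show "\<not> bval bound_test \<tau>" if "J 0 \<tau>" for \<tau>
      using that by (simp add: J_def tables_def bound_test_def)
    show "halts bound_step \<tau> (cost bound_step) (J r)" if "J (Suc r) \<tau>" "bval bound_test \<tau>" for r \<tau>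
      by (rule halts_exec)
        (use that in \<open>simp_all add: bound_step_def J_def tables_def algebra_simps\<close>)
    show "tables \<tau> \<and> (\<forall>y < N. nmem \<tau> ''p'' y = y)" if "J r \<tau>" "\<not> bval bound_test \<tau>" for r \<tau>
      using that by (simp add: J_def tables_def bound_test_def M_def)
  qed
  show ?thesis
    unfolding table_prog_def table_time_def block.simps
    by (rule halts_Seq[OF loop]; (rule halts_Seq[OF halts_exec[where Q = "J (max_stops I)"] bound])?)
       (use init in \<open>auto simp: bound_init_def\<close>)
qed

end

section \<open>The dynamic program\<close>

text \<open>
  Cell \<open>q * N + y\<close> of the array \<open>A\<close> is for state \<open>y\<close> with \<open>q\<close> stops left; \<open>a\<close> and \<open>e\<close> are the
  offsets of the round that is read and of the round that is written.
\<close>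

definition base_step :: prog where
  "base_step = block [
     Cond (nne (NGet ''row'' (nvar ''x'')) (nvar ''t''))
       (RSet ''A'' (nvar ''x'') (rvar ''M'')) (RSet ''A'' (nvar ''x'') (RConst 0)),
     ninc ''x'']"

definition edge_test :: bexp where
  "edge_test = NLess (nvar ''x'') (nvar ''N'')"

text \<open>\<open>cur\<close> collects the minima without the gas term, so its infinity has to
  survive the later subtraction of \<open>g * c v\<close>: with \<open>g = U - E y\<close>, the
  initial value \<open>M + U * c v\<close> leaves \<open>M + E y * c v\<close>, which is at least
  \<open>M\<close>.\<close>

definition vertex_step :: prog where
  "vertex_step = block [
     RSet ''cur'' (nvar ''v'') (RAdd (rvar ''M'') (RMul (rvar ''U'') (RGet ''c'' (nvar ''v'')))),
     RSet ''fill'' (nvar ''v'') (rvar ''M''),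
     ninc ''v'']"

text \<open>Filling up at the row and driving to the column of edge \<open>x\<close> leads to the
  state numbered by the transposed edge.\<close>

definition fill_cand_exp :: rexp where
  "fill_cand_exp = RGet ''A'' (NAdd (nvar ''a'') (NGet ''tr'' (nvar ''x'')))"

definition fill_step :: prog where
  "fill_step = block [
     Cond (BAnd (NLess (NConst 0) (NGet ''ok'' (nvar ''x'')))
         (RLess fill_cand_exp (RGet ''fill'' (NGet ''row'' (nvar ''x'')))))
       (RSet ''fill'' (NGet ''row'' (nvar ''x'')) fill_cand_exp) Skip,
     ninc ''x'']"

abbreviation price_exp :: rexp where
  "price_exp \<equiv> RGet ''c'' (NGet ''row'' (nvar ''y''))"
abbreviation dist_exp :: rexp where
  "dist_exp \<equiv> RGet ''d'' (nvar ''y'')"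
abbreviation cur_exp :: rexp where
  "cur_exp \<equiv> RGet ''cur'' (NGet ''row'' (nvar ''y''))"

definition exact_cand_exp :: rexp where
  "exact_cand_exp = RAdd (RMul dist_exp price_exp)
     (RGet ''A'' (NAdd (nvar ''a'') (NGet ''dg'' (NGet ''col'' (nvar ''y'')))))"

text \<open>One sorted list serves both pointers. Read upwards by \<open>i\<close> it lists the
  states by decreasing gas; read downwards by \<open>j\<close> it lists the edges by decreasing
  length. Edges therefore only ever become eligible, and each is pulled at most once in a
  round.\<close>

definition pull_test :: bexp where
  "pull_test = BAnd (NLess (NConst 0) (nvar ''j''))
     (BNot (RLess (RGet ''d'' (NGet ''p'' (NAdd (nvar ''b'') (NSub (nvar ''j'') (NConst 1)))))
        (RSub (rvar ''U'') (RGet ''d'' (NGet ''p'' (NAdd (nvar ''b'') (nvar ''i'')))))))"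

definition pull_step :: prog where
  "pull_step = block [
     nset ''j'' (NSub (nvar ''j'') (NConst 1)),
     nset ''y'' (NGet ''p'' (NAdd (nvar ''b'') (nvar ''j''))),
     Cond (BAnd (NLess (NConst 0) (NGet ''ok'' (nvar ''y''))) (RLess exact_cand_exp cur_exp))
       (RSet ''cur'' (NGet ''row'' (nvar ''y'')) exact_cand_exp) Skip]"

definition exact_exp :: rexp where
  "exact_exp = RSub cur_exp (RMul (RSub (rvar ''U'') dist_exp) price_exp)"

definition fill_exp :: rexp where
  "fill_exp = RAdd (RGet ''fill'' (NGet ''row'' (nvar ''y''))) (RMul dist_exp price_exp)"

definition emit_step :: prog where
  "emit_step = block [
     nset ''y'' (NGet ''p'' (NAdd (nvar ''b'') (nvar ''i''))),
     rset ''z'' (RGet ''A'' (NAdd (nvar ''a'') (nvar ''y''))),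
     Cond (RLess exact_exp (rvar ''z'')) (rset ''z'' exact_exp) Skip,
     Cond (RLess fill_exp (rvar ''z'')) (rset ''z'' fill_exp) Skip,
     RSet ''A'' (NAdd (nvar ''e'') (nvar ''y'')) (rvar ''z''),
     ninc ''i'']"

definition sweep_step :: prog where
  "sweep_step = Cond pull_test pull_step emit_step"

definition sweep_test :: bexp where
  "sweep_test = NLess (nvar ''i'') (nvar ''N'')"

definition sweep_init :: prog where
  "sweep_init = block [nset ''i'' (NConst 0), nset ''j'' (nvar ''N'')]"

definition level_next :: prog where
  "level_next = block [nset ''a'' (nvar ''e''), nset ''e'' (NAdd (nvar ''e'') (nvar ''N'')), ninc ''q'']"

definition level_prog :: prog where
  "level_prog = block [
     nset ''v'' (NConst 0), While table_test vertex_step,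
     nset ''x'' (NConst 0), While edge_test fill_step,
     sweep_init, While sweep_test sweep_step,
     level_next]"

definition levels_init :: prog where
  "levels_init = block [nset ''a'' (NConst 0), nset ''e'' (nvar ''N''), nset ''q'' (NConst 0)]"

definition levels_prog :: prog where
  "levels_prog = block [
     nset ''x'' (NConst 0), While edge_test base_step,
     levels_init, While bound_test level_prog]"

text \<open>Neither the dynamic program nor the route recovery writes these arrays, so that
  \<open>env\<close> survives each of their pieces by comparing array names.\<close>

definition static_n :: "name set" where
  "static_n = {''n'', ''s'', ''t'', ''Delta'', ''N'', ''row'', ''col'', ''tr'', ''dg'', ''ok'', ''b'', ''p''}"

definition static_r :: "name set" where
  "static_r = {''U'', ''M'', ''c'', ''d''}"

context gas_problem begin

definition env :: "nat list \<Rightarrow> store \<Rightarrow> bool" where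
  "env ps \<sigma> \<longleftrightarrow> tables \<sigma> \<and> length ps = N \<and> sorted (map E ps) \<and> set ps = {..<N} \<and>
     (\<forall>i < N. nmem \<sigma> ''p'' (nmem \<sigma> ''b'' 0 + i) = ps ! i)"

lemma env_cong:
  assumes "env ps \<sigma>" "\<And>a. a \<in> static_n \<Longrightarrow> nmem \<tau> a = nmem \<sigma> a"
    "\<And>a. a \<in> static_r \<Longrightarrow> rmem \<tau> a = rmem \<sigma> a"
  shows "env ps \<tau>"
  using assms unfolding env_def tables_def static_n_def static_r_def by simp

lemma env_exec:
  assumes "env ps \<sigma>" "nwrites P \<inter> static_n = {}" "rwrites P \<inter> static_r = {}"
  shows "env ps (exec P \<sigma>)"
  using assms(1) by (rule env_cong; intro exec_frame) (use assms(2,3) in blast)+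

text \<open>States with \<open>E y > U\<close> have a negative amount of gas. The recurrence is
  evaluated for them as well, but no other state refers to them: candidates come from edges that are
  \<open>ok\<close> and lead to their transposes or to loops.\<close>

definition level :: "nat \<Rightarrow> store \<Rightarrow> bool" where
  "level q \<sigma> \<longleftrightarrow> (\<forall>y < N. rmem \<sigma> ''A'' (q * N + y) = A q (y div n) (U - E y))"

lemma levelD: "level q \<sigma> \<Longrightarrow> y < N \<Longrightarrow> rmem \<sigma> ''A'' (q * N + y) = A q (y div n) (U - E y)"
  by (simp add: level_def)

lemma envD:
  assumes "env ps \<sigma>"
  shows "nmem \<sigma> ''n'' 0 = n" "nmem \<sigma> ''s'' 0 = src I" "nmem \<sigma> ''t'' 0 = dst I"
    "nmem \<sigma> ''Delta'' 0 = max_stops I" "nmem \<sigma> ''N'' 0 = N" "rmem \<sigma> ''U'' 0 = U" "rmem \<sigma> ''M'' 0 = M"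
    "v < n \<Longrightarrow> rmem \<sigma> ''c'' v = c v" "v < n \<Longrightarrow> nmem \<sigma> ''dg'' v = v * n + v"
    "y < N \<Longrightarrow> nmem \<sigma> ''row'' y = y div n" "y < N \<Longrightarrow> nmem \<sigma> ''col'' y = y mod n"
    "y < N \<Longrightarrow> nmem \<sigma> ''tr'' y = (y mod n) * n + y div n" "y < N \<Longrightarrow> rmem \<sigma> ''d'' y = E y"
    "y < N \<Longrightarrow> 0 < nmem \<sigma> ''ok'' y \<longleftrightarrow> ok y"
    "i < N \<Longrightarrow> nmem \<sigma> ''p'' (nmem \<sigma> ''b'' 0 + i) = ps ! i"
  using assms by (simp_all add: env_def tables_def)

lemma env_ps:
  assumes "env ps \<sigma>"
  shows "length ps = N" "i < N \<Longrightarrow> ps ! i < N" "i \<le> j \<Longrightarrow> j < N \<Longrightarrow> E (ps ! i) \<le> E (ps ! j)"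
    "y < N \<Longrightarrow> \<exists>i<N. y = ps ! i"
proof -
  show l: "length ps = N" using assms by (simp add: env_def)
  show "i < N \<Longrightarrow> ps ! i < N"
    using assms l nth_mem[of i ps] by (simp add: env_def)
  show "i \<le> j \<Longrightarrow> j < N \<Longrightarrow> E (ps ! i) \<le> E (ps ! j)"
    using assms l sorted_nth_mono[of "map E ps" i j] by (simp add: env_def)
  show "y < N \<Longrightarrow> \<exists>i<N. y = ps ! i"
    using assms l unfolding env_def by (metis in_set_conv_nth lessThan_iff)
qed

section \<open>Running minima and the recurrence\<close>

definition is_min :: "real \<Rightarrow> real set \<Rightarrow> bool" where
  "is_min x S \<longleftrightarrow> x \<in> S \<and> (\<forall>y \<in> S. x \<le> y)"

text \<open>\<open>m\<close> is the initial value of the running minimum, so there is a minimum even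
  when no edge qualifies.\<close>

definition cands :: "(nat \<Rightarrow> real) \<Rightarrow> nat \<Rightarrow> nat set \<Rightarrow> real \<Rightarrow> real set" where
  "cands f v Y m = insert m (f ` {y \<in> Y. ok y \<and> y div n = v})"

definition exact_cand :: "nat \<Rightarrow> nat \<Rightarrow> real" where
  "exact_cand q y = E y * c (y div n) + A q (y mod n) 0"

definition fill_cand :: "nat \<Rightarrow> nat \<Rightarrow> real" where
  "fill_cand q y = A q (y mod n) (U - E ((y mod n) * n + y div n))"

lemma is_min_insert:
  "is_min x (cands f v Y m) \<Longrightarrow> x' = (if ok y \<and> y div n = v \<and> f y < x then f y else x) \<Longrightarrow>
     is_min x' (cands f v (insert y Y) m)"
  unfolding is_min_def cands_def by force

lemma is_min_empty: "is_min m (cands f v {} m)"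
  unfolding is_min_def cands_def by simp

lemma is_min_cands_le: "is_min x (cands f v Y m) \<Longrightarrow> y \<in> Y \<Longrightarrow> ok y \<Longrightarrow> y div n = v \<Longrightarrow> x \<le> f y"
  unfolding is_min_def cands_def by blast

lemma is_min_cands_cases:
  assumes "is_min x (cands f v Y m)"
  obtains "x = m" | y where "y \<in> Y" "ok y" "y div n = v" "x = f y"
  using assms unfolding is_min_def cands_def by blast

lemma ok_dist:
  assumes "y < N" "ok y"
  shows "y mod n < n" "y mod n \<noteq> y div n" "E y = dist (y div n) (y mod n)" "dist (y div n) (y mod n) \<le> U"
    "E ((y mod n) * n + y div n) = dist (y div n) (y mod n)"
  using assms edge_bounds[of y] E_dist[of "y mod n" "y div n"] dist_sym[of "y mod n" "y div n"]
  by (auto simp: ok_def E_def dist_def)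

lemma ok_edge: "v < n \<Longrightarrow> w < n \<Longrightarrow> w \<noteq> v \<Longrightarrow> dist v w \<le> U \<Longrightarrow> ok (v * n + w)"
  by (simp add: ok_def E_dist)

text \<open>In the exact candidates the gas occurs only in the term
  \<open>- (U - E y) * c v\<close>, common to all edges at \<open>v\<close>, so it can be taken out
  of the minimum; what remains of it is the eligibility recorded by \<open>Y\<close>. The initial
  values contribute at least \<open>M\<close>, which \<open>A\<close> never exceeds.\<close>

lemma A_next_level:
  assumes y: "y < N" and v: "v = y div n"
    and fill: "is_min fv (cands (fill_cand q) v {..<N} M)"
    and cur: "is_min cv (cands (exact_cand q) v Y (M + U * c v))"
    and Y: "\<And>y'. y' \<in> Y \<Longrightarrow> y' < N \<and> U - E y \<le> E y'" "\<And>y'. y' < N \<Longrightarrow> U - E y \<le> E y' \<Longrightarrow> y' \<in> Y"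
  shows "A (Suc q) v (U - E y) =
    min (min (A q v (U - E y)) (cv - (U - E y) * c v)) (fv + E y * c v)"
proof (rule A_eqI)
  have vn: "v < n" using y v edge_bounds by simp
  have E: "0 \<le> E y * c v" using E_nonneg[OF y] c_pos[OF vn] by simp
  show "A (Suc q) v (U - E y) \<le> min (min (A q v (U - E y)) (cv - (U - E y) * c v)) (fv + E y * c v)"
  proof (intro min.boundedI)
    show "A (Suc q) v (U - E y) \<le> A q v (U - E y)" by (rule A_keep)
    show "A (Suc q) v (U - E y) \<le> cv - (U - E y) * c v"
      using cur
    proof (cases rule: is_min_cands_cases)
      case 1
      then show ?thesis using A_le_M[of "Suc q" v "U - E y"] E by (simp add: algebra_simps del: A.simps)
    next
      case (2 y')
      then have "y' < N" "U - E y \<le> E y'" using Y by auto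
      then have "A (Suc q) v (U - E y) \<le> (dist v (y' mod n) - (U - E y)) * c v + A q (y' mod n) 0"
        using 2 ok_dist[of y'] by (intro A_exact) auto
      then show ?thesis
        using 2 ok_dist[of y'] \<open>y' < N\<close> by (simp add: exact_cand_def algebra_simps del: A.simps)
    qed
    show "A (Suc q) v (U - E y) \<le> fv + E y * c v"
      using fill
    proof (cases rule: is_min_cands_cases)
      case 1
      then show ?thesis using A_le_M[of "Suc q" v "U - E y"] E by (simp del: A.simps)
    next
      case (2 y')
      then have "A (Suc q) v (U - E y) \<le> (U - (U - E y)) * c v + A q (y' mod n) (U - dist v (y' mod n))"
        using ok_dist[of y'] by (intro A_fill) auto
      then show ?thesis
        using 2 ok_dist[of y'] by (simp add: fill_cand_def del: A.simps)
    qed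
  qed
  fix w assume w: "w < n" "w \<noteq> v" "dist v w \<le> U"
  let ?y = "v * n + w"
  have ok: "?y < N" "ok ?y" "E ?y = dist v w" "?y div n = v" "?y mod n = w"
    using w vn ok_edge edge_less E_dist by auto
  show "min (min (A q v (U - E y)) (cv - (U - E y) * c v)) (fv + E y * c v)
      \<le> (dist v w - (U - E y)) * c v + A q w 0" if "U - E y \<le> dist v w"
    using is_min_cands_le[OF cur Y(2)[OF ok(1)] ok(2)] that ok
    by (simp add: exact_cand_def left_diff_distrib min_le_iff_disj)
  show "min (min (A q v (U - E y)) (cv - (U - E y) * c v)) (fv + E y * c v)
      \<le> (U - (U - E y)) * c v + A q w (U - dist v w)"
    using is_min_cands_le[OF fill _ ok(2), unfolded lessThan_iff] ok ok_dist(5)[OF ok(1,2)]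
    by (simp add: fill_cand_def min_le_iff_disj)
qed simp

definition levels :: "nat list \<Rightarrow> nat \<Rightarrow> store \<Rightarrow> bool" where
  "levels ps q \<sigma> \<longleftrightarrow> env ps \<sigma> \<and> nmem \<sigma> ''a'' 0 = q * N \<and> nmem \<sigma> ''e'' 0 = Suc q * N \<and>
     nmem \<sigma> ''q'' 0 = q \<and> (\<forall>q' \<le> q. level q' \<sigma>)"

lemma levels_exec:
  assumes "levels ps q \<sigma>" "nwrites P \<inter> (static_n \<union> {''a'', ''e'', ''q''}) = {}"
    "rwrites P \<inter> (static_r \<union> {''A''}) = {}"
  shows "levels ps q (exec P \<sigma>)"
proof -
  have "env ps (exec P \<sigma>)" using assms by (intro env_exec) (auto simp: levels_def)
  moreover have "nmem (exec P \<sigma>) a = nmem \<sigma> a" if "a \<in> {''a'', ''e'', ''q''}" for a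
    using assms(2) that by (intro exec_frame) blast
  moreover have "rmem (exec P \<sigma>) ''A'' = rmem \<sigma> ''A''"
    using assms(3) by (intro exec_frame) blast
  ultimately show ?thesis
    using assms(1) by (simp add: levels_def level_def)
qed

lemma levelsD:
  assumes "levels ps q \<sigma>"
  shows "env ps \<sigma>" "nmem \<sigma> ''a'' 0 = q * N" "nmem \<sigma> ''e'' 0 = Suc q * N" "nmem \<sigma> ''q'' 0 = q"
    "y < N \<Longrightarrow> rmem \<sigma> ''A'' (q * N + y) = A q (y div n) (U - E y)"
  using assms by (auto simp: levels_def level_def)

section \<open>Loop invariants of the dynamic program\<close>

definition base_inv :: "nat list \<Rightarrow> nat \<Rightarrow> store \<Rightarrow> bool" where
  "base_inv ps r \<sigma> \<longleftrightarrow> env ps \<sigma> \<and> r + nmem \<sigma> ''x'' 0 = N \<and>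
     (\<forall>y < nmem \<sigma> ''x'' 0. rmem \<sigma> ''A'' y = A 0 (y div n) (U - E y))"

lemma base_step:
  assumes inv: "base_inv ps (Suc r) \<sigma>"
  shows "base_inv ps r (exec base_step \<sigma>)"
proof -
  define x where "x = nmem \<sigma> ''x'' 0"
  have s: "env ps \<sigma>" "Suc r + x = N" "\<And>y. y < x \<Longrightarrow> rmem \<sigma> ''A'' y = A 0 (y div n) (U - E y)"
    using inv by (auto simp: base_inv_def x_def)
  have x: "nmem \<sigma> ''row'' x = x div n" using envD[OF s(1)] s(2) by simp
  have "env ps (exec base_step \<sigma>)"
    using s(1) by (rule env_exec) (auto simp: base_step_def static_n_def static_r_def)
  moreover have "nmem (exec base_step \<sigma>) ''x'' 0 = Suc x"
    by (simp add: base_step_def x_def)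
  moreover have "rmem (exec base_step \<sigma>) ''A'' = (rmem \<sigma> ''A'')(x := A 0 (x div n) (U - E x))"
    using x envD(3,7)[OF s(1)] by (auto simp: base_step_def x_def[symmetric] neq_iff)
  ultimately show ?thesis
    using s by (auto simp: base_inv_def less_Suc_eq)
qed

definition vertex_inv :: "nat list \<Rightarrow> nat \<Rightarrow> nat \<Rightarrow> store \<Rightarrow> bool" where
  "vertex_inv ps q r \<sigma> \<longleftrightarrow> levels ps q \<sigma> \<and> r + nmem \<sigma> ''v'' 0 = n \<and>
     (\<forall>v < nmem \<sigma> ''v'' 0. rmem \<sigma> ''cur'' v = M + U * c v \<and> rmem \<sigma> ''fill'' v = M)"

lemma vertex_step:
  assumes inv: "vertex_inv ps q (Suc r) \<sigma>"
  shows "vertex_inv ps q r (exec vertex_step \<sigma>)"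
proof -
  define v where "v = nmem \<sigma> ''v'' 0"
  have s: "levels ps q \<sigma>" "Suc r + v = n"
      "\<And>u. u < v \<Longrightarrow> rmem \<sigma> ''cur'' u = M + U * c u \<and> rmem \<sigma> ''fill'' u = M"
    using inv by (auto simp: vertex_inv_def v_def)
  note env = envD[OF levelsD(1)[OF s(1)]]
  have "levels ps q (exec vertex_step \<sigma>)"
    using s(1) by (rule levels_exec) (auto simp: vertex_step_def static_n_def static_r_def)
  moreover have "nmem (exec vertex_step \<sigma>) ''v'' 0 = Suc v"
    by (simp add: vertex_step_def v_def)
  moreover have "rmem (exec vertex_step \<sigma>) ''cur'' = (rmem \<sigma> ''cur'')(v := M + U * c v)"
    "rmem (exec vertex_step \<sigma>) ''fill'' = (rmem \<sigma> ''fill'')(v := M)"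
    using env(6,7) env(8)[of v] s(2) by (simp_all add: vertex_step_def v_def[symmetric])
  ultimately show ?thesis
    using s by (auto simp: vertex_inv_def less_Suc_eq)
qed

definition fill_inv :: "nat list \<Rightarrow> nat \<Rightarrow> nat \<Rightarrow> store \<Rightarrow> bool" where
  "fill_inv ps q r \<sigma> \<longleftrightarrow> levels ps q \<sigma> \<and> r + nmem \<sigma> ''x'' 0 = N \<and>
     (\<forall>v < n. rmem \<sigma> ''cur'' v = M + U * c v \<and>
        is_min (rmem \<sigma> ''fill'' v) (cands (fill_cand q) v {..<nmem \<sigma> ''x'' 0} M))"

lemma fill_step:
  assumes inv: "fill_inv ps q (Suc r) \<sigma>"
  shows "fill_inv ps q r (exec fill_step \<sigma>)"
proof -
  define x where "x = nmem \<sigma> ''x'' 0"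
  have s: "levels ps q \<sigma>" "Suc r + x = N" "\<And>v. v < n \<Longrightarrow> rmem \<sigma> ''cur'' v = M + U * c v"
      "\<And>v. v < n \<Longrightarrow> is_min (rmem \<sigma> ''fill'' v) (cands (fill_cand q) v {..<x} M)"
    using inv by (auto simp: fill_inv_def x_def)
  have xN: "x < N" using s(2) by simp
  note env = envD[OF levelsD(1)[OF s(1)]]
  note ed = edge_bounds[OF xN]
  have val: "rval fill_cand_exp \<sigma> = fill_cand q x"
    using levelsD(2)[OF s(1)] levelsD(5)[OF s(1) edge_less[OF ed(2,1)]] ed env(12)[OF xN]
    by (simp add: fill_cand_exp_def fill_cand_def x_def[symmetric])
  define f' where "f' = (if ok x \<and> fill_cand q x < rmem \<sigma> ''fill'' (x div n) then fill_cand q x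
      else rmem \<sigma> ''fill'' (x div n))"
  have "levels ps q (exec fill_step \<sigma>)"
    using s(1) by (rule levels_exec) (auto simp: fill_step_def static_n_def static_r_def)
  moreover have "nmem (exec fill_step \<sigma>) ''x'' 0 = Suc x"
    by (simp add: fill_step_def x_def)
  moreover have "rmem (exec fill_step \<sigma>) ''fill'' = (rmem \<sigma> ''fill'')(x div n := f')"
    using env(10,14)[OF xN] val by (simp add: fill_step_def x_def[symmetric] f'_def)
  moreover have "rmem (exec fill_step \<sigma>) ''cur'' = rmem \<sigma> ''cur''"
    by (rule exec_frame) (simp add: fill_step_def)
  moreover have "is_min (((rmem \<sigma> ''fill'')(x div n := f')) v) (cands (fill_cand q) v {..<Suc x} M)"
    if "v < n" for v
    unfolding lessThan_Suc by (rule is_min_insert[OF s(4)[OF that]]) (auto simp: f'_def)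
  ultimately show ?thesis
    using s by (simp add: fill_inv_def)
qed

text \<open>Every iteration either pulls an edge or emits a state, so \<open>N - i + j\<close> is
  the measure, starting at \<open>2 * N\<close>. The last clause records that a pulled edge stays
  eligible for all states still to come, as their gas only decreases.\<close>

definition sweep_inv :: "nat list \<Rightarrow> nat \<Rightarrow> nat \<Rightarrow> store \<Rightarrow> bool" where
  "sweep_inv ps q r \<sigma> \<longleftrightarrow> levels ps q \<sigma> \<and>
     (let i = nmem \<sigma> ''i'' 0; j = nmem \<sigma> ''j'' 0 in
      r + i = N + j \<and> i \<le> N \<and> j \<le> N \<and>
      (\<forall>v < n. is_min (rmem \<sigma> ''fill'' v) (cands (fill_cand q) v {..<N} M) \<and>
         is_min (rmem \<sigma> ''cur'' v) (cands (exact_cand q) v (set (drop j ps)) (M + U * c v))) \<and>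
      (\<forall>i' < i. rmem \<sigma> ''A'' (Suc q * N + ps ! i') = A (Suc q) (ps ! i' div n) (U - E (ps ! i'))) \<and>
      (\<forall>i' j'. i \<le> i' \<and> i' < N \<and> j \<le> j' \<and> j' < N \<longrightarrow> U - E (ps ! i') \<le> E (ps ! j')))"

lemma pull_step:
  assumes inv: "sweep_inv ps q (Suc r) \<sigma>" and test: "bval sweep_test \<sigma>" "bval pull_test \<sigma>"
  shows "sweep_inv ps q r (exec pull_step \<sigma>)"
proof -
  define i j b where defs: "i = nmem \<sigma> ''i'' 0" "j = nmem \<sigma> ''j'' 0" "b = nmem \<sigma> ''b'' 0"
  note folds = defs[symmetric]
  have s: "levels ps q \<sigma>" "Suc r + i = N + j" "j \<le> N"
      "\<And>v. v < n \<Longrightarrow> is_min (rmem \<sigma> ''fill'' v) (cands (fill_cand q) v {..<N} M)"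
      "\<And>v. v < n \<Longrightarrow> is_min (rmem \<sigma> ''cur'' v) (cands (exact_cand q) v (set (drop j ps)) (M + U * c v))"
      "\<And>i'. i' < i \<Longrightarrow> rmem \<sigma> ''A'' (Suc q * N + ps ! i') = A (Suc q) (ps ! i' div n) (U - E (ps ! i'))"
      "\<And>i' j'. i \<le> i' \<Longrightarrow> i' < N \<Longrightarrow> j \<le> j' \<Longrightarrow> j' < N \<Longrightarrow> U - E (ps ! i') \<le> E (ps ! j')"
    using inv unfolding sweep_inv_def Let_def folds by auto
  note ev = levelsD(1)[OF s(1)]
  note env = envD[OF ev]
  have i: "i < N" using test(1) env(5) by (simp add: sweep_test_def folds)
  have "0 < j" using test(2) by (simp add: pull_test_def folds)
  then obtain k where k: "j = Suc k" by (cases j) auto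
  then have kN: "k < N" using s(3) by simp
  define y where "y = ps ! k"
  have y: "y < N" using env_ps(2)[OF ev kN] by (simp add: y_def)
  note ed = edge_bounds[OF y]
  have p: "nmem \<sigma> ''p'' (b + k) = y" "nmem \<sigma> ''p'' (b + i) = ps ! i"
    using env(15)[OF kN] env(15)[OF i] by (simp_all add: y_def folds)
  have ge: "U - E (ps ! i) \<le> E y"
    using test(2) env(6) env(13)[OF y] env(13)[OF env_ps(2)[OF ev i]] p
    by (simp add: pull_test_def folds k not_less)
  define \<rho> where "\<rho> = exec (block [nset ''j'' (NSub (nvar ''j'') (NConst 1)),
     nset ''y'' (NGet ''p'' (NAdd (nvar ''b'') (nvar ''j'')))]) \<sigma>"
  have \<rho>: "nmem \<rho> ''j'' 0 = k" "nmem \<rho> ''y'' 0 = y" "nmem \<rho> ''i'' 0 = i" "rmem \<rho> = rmem \<sigma>"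
    using p k by (simp_all add: \<rho>_def folds)
  have lr: "levels ps q \<rho>"
    unfolding \<rho>_def using s(1) by (rule levels_exec) (auto simp: static_n_def static_r_def)
  note envr = envD[OF levelsD(1)[OF lr]]
  have val: "rval exact_cand_exp \<rho> = exact_cand q y"
    using levelsD(2)[OF lr] levelsD(5)[OF lr edge_less[OF ed(2,2)]] ed envr(8)[OF ed(1)]
      envr(9)[OF ed(2)] envr(10,11,13)[OF y] E_loop[OF ed(2)]
    by (simp add: exact_cand_exp_def exact_cand_def \<rho>(2))
  define f' where "f' = (if ok y \<and> exact_cand q y < rmem \<sigma> ''cur'' (y div n) then exact_cand q y
      else rmem \<sigma> ''cur'' (y div n))"
  define \<tau> where "\<tau> = exec pull_step \<sigma>"
  have \<tau>: "\<tau> = exec (Cond (BAnd (NLess (NConst 0) (NGet ''ok'' (nvar ''y''))) (RLess exact_cand_exp cur_exp))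
       (RSet ''cur'' (NGet ''row'' (nvar ''y'')) exact_cand_exp) Skip) \<rho>"
    by (simp only: \<tau>_def \<rho>_def pull_step_def block.simps exec.simps)
  have l\<tau>: "levels ps q \<tau>"
    unfolding \<tau> using lr by (rule levels_exec) (auto simp: static_n_def static_r_def)
  have eqs: "nmem \<tau> ''j'' 0 = k" "nmem \<tau> ''i'' 0 = i" "rmem \<tau> ''fill'' = rmem \<sigma> ''fill''"
      "rmem \<tau> ''A'' = rmem \<sigma> ''A''" "rmem \<tau> ''cur'' = (rmem \<sigma> ''cur'')(y div n := f')"
    unfolding \<tau> using \<rho> val envr(10,14)[OF y] by (simp_all add: f'_def)
  have drop: "drop k ps = y # drop j ps"
    using kN env_ps(1)[OF ev] by (simp add: k y_def Cons_nth_drop_Suc)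
  have cur: "is_min (((rmem \<sigma> ''cur'')(y div n := f')) v)
      (cands (exact_cand q) v (set (drop k ps)) (M + U * c v))" if "v < n" for v
    unfolding drop list.simps by (rule is_min_insert[OF s(5)[OF that]]) (auto simp: f'_def)
  \<comment> \<open>Remaining states have at most the gas of state \<open>i\<close>, and pulled
    edges are at least as long as \<open>y\<close>; so the comparison just made covers all
    pairs.\<close>
  have elig: "U - E (ps ! i') \<le> E (ps ! j')" if "i \<le> i'" "i' < N" "k \<le> j'" "j' < N" for i' j'
  proof -
    have "U - E (ps ! i') \<le> U - E (ps ! i)" using env_ps(3)[OF ev that(1,2)] by simp
    also have "\<dots> \<le> E y" by (rule ge)
    also have "\<dots> \<le> E (ps ! j')" using env_ps(3)[OF ev that(3,4)] by (simp add: y_def)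
    finally show ?thesis .
  qed
  have "r + i = N + k" "k \<le> N" using s(2) k kN by simp_all
  then show ?thesis
    using l\<tau> i s(4,6) cur elig unfolding \<tau>_def[symmetric] sweep_inv_def Let_def eqs by simp
qed

lemma emit_step:
  assumes inv: "sweep_inv ps q (Suc r) \<sigma>" and test: "bval sweep_test \<sigma>" "\<not> bval pull_test \<sigma>"
  shows "sweep_inv ps q r (exec emit_step \<sigma>)"
proof -
  define i j b where defs: "i = nmem \<sigma> ''i'' 0" "j = nmem \<sigma> ''j'' 0" "b = nmem \<sigma> ''b'' 0"
  note folds = defs[symmetric]
  have s: "levels ps q \<sigma>" "Suc r + i = N + j" "j \<le> N"
      "\<And>v. v < n \<Longrightarrow> is_min (rmem \<sigma> ''fill'' v) (cands (fill_cand q) v {..<N} M)"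
      "\<And>v. v < n \<Longrightarrow> is_min (rmem \<sigma> ''cur'' v) (cands (exact_cand q) v (set (drop j ps)) (M + U * c v))"
      "\<And>i'. i' < i \<Longrightarrow> rmem \<sigma> ''A'' (Suc q * N + ps ! i') = A (Suc q) (ps ! i' div n) (U - E (ps ! i'))"
      "\<And>i' j'. i \<le> i' \<Longrightarrow> i' < N \<Longrightarrow> j \<le> j' \<Longrightarrow> j' < N \<Longrightarrow> U - E (ps ! i') \<le> E (ps ! j')"
    using inv unfolding sweep_inv_def Let_def folds by auto
  note ev = levelsD(1)[OF s(1)]
  note env = envD[OF ev]
  have i: "i < N" using test(1) env(5) by (simp add: sweep_test_def folds)
  define y v where "y = ps ! i" and "v = y div n"
  have y: "y < N" using env_ps(2)[OF ev i] by (simp add: y_def)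
  note ed = edge_bounds[OF y]
  have v: "v < n" using ed by (simp add: v_def)
  have p: "nmem \<sigma> ''p'' (b + i) = y"
    using env(15)[OF i] by (simp_all add: y_def folds)
  \<comment> \<open>The failed test rules out the longest edge not yet pulled, hence by sortedness
    all of them.\<close>
  have less: "E (ps ! j') < U - E y" if j': "j' < j" for j'
  proof -
    obtain k where k: "j = Suc k" using j' by (cases j) auto
    then have kN: "k < N" using s(3) by simp
    have "E (ps ! j') \<le> E (ps ! k)" using env_ps(3)[OF ev _ kN] j' k by simp
    also have "\<dots> < U - E y"
      using test(2) env(6) env(13)[OF y] env(13)[OF env_ps(2)[OF ev kN]] p env(15)[OF kN]
      by (simp add: pull_test_def folds k)
    finally show ?thesis .
  qed
  have val: "A (Suc q) v (U - E y) = min (min (A q v (U - E y)) (rmem \<sigma> ''cur'' v - (U - E y) * c v))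
      (rmem \<sigma> ''fill'' v + E y * c v)"
  proof (rule A_next_level[OF y v_def s(4)[OF v] s(5)[OF v]])
    fix y' assume "y' \<in> set (drop j ps)"
    then obtain m where "m < length (drop j ps)" "y' = drop j ps ! m"
      by (metis in_set_conv_nth)
    then have "j + m < N" "y' = ps ! (j + m)"
      using env_ps(1)[OF ev] s(3) by simp_all
    then show "y' < N \<and> U - E y \<le> E y'"
      using s(7)[of i "j + m"] i env_ps(2)[OF ev] by (simp add: y_def)
  next
    fix y' assume y': "y' < N" "U - E y \<le> E y'"
    then obtain j' where j': "j' < N" "y' = ps ! j'" using env_ps(4)[OF ev] by blast
    then have "j \<le> j'" using less[of j'] y'(2) by (metis not_le)
    then have "drop j ps ! (j' - j) = y'" "j' - j < length (drop j ps)"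
      using j' env_ps(1)[OF ev] by auto
    then show "y' \<in> set (drop j ps)" using nth_mem by metis
  qed
  define \<rho> where "\<rho> = exec (block [
     nset ''y'' (NGet ''p'' (NAdd (nvar ''b'') (nvar ''i''))),
     rset ''z'' (RGet ''A'' (NAdd (nvar ''a'') (nvar ''y'')))]) \<sigma>"
  have \<rho>: "nmem \<rho> ''y'' 0 = y" "rmem \<rho> ''z'' 0 = A q v (U - E y)" "nmem \<rho> ''i'' 0 = i"
      "nmem \<rho> ''j'' 0 = j"
      "rmem \<rho> ''cur'' = rmem \<sigma> ''cur''" "rmem \<rho> ''fill'' = rmem \<sigma> ''fill''" "rmem \<rho> ''A'' = rmem \<sigma> ''A''"
    using p levelsD(2,5)[OF s(1)] y by (simp_all add: \<rho>_def folds v_def)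
  have lr: "levels ps q \<rho>"
    unfolding \<rho>_def using s(1) by (rule levels_exec) (auto simp: static_n_def static_r_def)
  note envr = envD[OF levelsD(1)[OF lr]]
  have vals: "rval exact_exp \<rho> = rmem \<sigma> ''cur'' v - (U - E y) * c v"
      "rval fill_exp \<rho> = rmem \<sigma> ''fill'' v + E y * c v"
    using envr(6) envr(8)[OF v] envr(10,13)[OF y]
    by (simp_all add: exact_exp_def fill_exp_def \<rho> v_def)
  define \<pi> where "\<pi> = exec (block [
     Cond (RLess exact_exp (rvar ''z'')) (rset ''z'' exact_exp) Skip,
     Cond (RLess fill_exp (rvar ''z'')) (rset ''z'' fill_exp) Skip]) \<rho>"
  have fill_upd: "rval fill_exp (\<rho>\<lparr>rmem := (rmem \<rho>)(''z'' := z)\<rparr>) = rval fill_exp \<rho>" for z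
    by (simp add: fill_exp_def)
  have \<pi>: "rmem \<pi> ''z'' 0 = A (Suc q) v (U - E y)" "nmem \<pi> ''y'' 0 = y" "nmem \<pi> ''i'' 0 = i"
      "nmem \<pi> ''j'' 0 = j"
      "rmem \<pi> ''cur'' = rmem \<sigma> ''cur''" "rmem \<pi> ''fill'' = rmem \<sigma> ''fill''" "rmem \<pi> ''A'' = rmem \<sigma> ''A''"
    using \<rho> by (simp_all add: \<pi>_def fill_upd vals val min_def del: A.simps)
  have l\<pi>: "levels ps q \<pi>"
    unfolding \<pi>_def using lr by (rule levels_exec) (auto simp: static_n_def static_r_def)
  define \<tau> where "\<tau> = exec emit_step \<sigma>"
  have \<tau>: "\<tau> = exec (block [RSet ''A'' (NAdd (nvar ''e'') (nvar ''y'')) (rvar ''z''), ninc ''i'']) \<pi>"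
    by (simp only: \<tau>_def \<pi>_def \<rho>_def emit_step_def block.simps exec.simps)
  have eqs: "nmem \<tau> ''j'' 0 = j" "nmem \<tau> ''i'' 0 = Suc i" "rmem \<tau> ''fill'' = rmem \<sigma> ''fill''"
      "rmem \<tau> ''cur'' = rmem \<sigma> ''cur''"
      "rmem \<tau> ''A'' = (rmem \<sigma> ''A'')(Suc q * N + y := A (Suc q) v (U - E y))"
    unfolding \<tau> using \<pi> levelsD(3)[OF l\<pi>] by (simp_all del: A.simps mult_Suc)
  have l\<tau>: "levels ps q \<tau>"
  proof -
    have "env ps \<tau>"
      unfolding \<tau> using levelsD(1)[OF l\<pi>] by (rule env_exec) (auto simp: static_n_def static_r_def)
    \<comment> \<open>The cell just written lies beyond the cells of all rounds up to
      \<open>q\<close>.\<close>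
    moreover have "level q' \<tau>" if "q' \<le> q" for q'
      unfolding level_def
    proof (intro allI impI)
      fix x assume x: "x < N"
      have "q' * N + x < Suc q' * N" using x by simp
      also have "\<dots> \<le> Suc q * N" using that by (intro mult_le_mono1) simp
      finally have "q' * N + x \<noteq> Suc q * N + y" by simp
      then show "rmem \<tau> ''A'' (q' * N + x) = A q' (x div n) (U - E x)"
        using s(1) that x unfolding eqs(5) by (simp add: levels_def level_def)
    qed
    moreover have "nmem \<tau> ''a'' 0 = q * N" "nmem \<tau> ''e'' 0 = Suc q * N" "nmem \<tau> ''q'' 0 = q"
      unfolding \<tau> using levelsD(2-4)[OF l\<pi>] by simp_all
    ultimately show ?thesis by (simp add: levels_def)
  qed
  have A: "((rmem \<sigma> ''A'')(Suc q * N + y := A (Suc q) v (U - E y))) (Suc q * N + ps ! i') =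
      A (Suc q) (ps ! i' div n) (U - E (ps ! i'))" if "i' < Suc i" for i'
    using s(6)[of i'] that by (auto simp: less_Suc_eq y_def v_def simp del: A.simps mult_Suc)
  have "r + Suc i = N + j" "Suc i \<le> N" using s(2) i by simp_all
  then show ?thesis
    using l\<tau> s(3-5,7) A unfolding \<tau>_def[symmetric] sweep_inv_def Let_def eqs
    by (simp del: A.simps mult_Suc)
qed

section \<open>Termination and step bounds of the rounds\<close>

definition level_time :: nat where
  "level_time = cost (nset ''v'' (NConst 0)) + (Suc n * (bcost table_test + 1 + cost vertex_step) +
    (cost (nset ''x'' (NConst 0)) + (Suc N * (bcost edge_test + 1 + cost fill_step) +
    (cost sweep_init + (Suc (2 * N) * (bcost sweep_test + 1 + cost sweep_step) + cost level_next)))))"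

lemma vertex_loop:
  assumes "levels ps q \<sigma>"
  shows "halts (block [nset ''v'' (NConst 0), While table_test vertex_step]) \<sigma>
    (cost (nset ''v'' (NConst 0)) + Suc n * (bcost table_test + 1 + cost vertex_step)) (vertex_inv ps q 0)"
  unfolding block.simps
proof (rule halts_Seq[OF halts_exec[where Q = "vertex_inv ps q n"]])
  show "vertex_inv ps q n (exec (nset ''v'' (NConst 0)) \<sigma>)"
    using levels_exec[OF assms, of "nset ''v'' (NConst 0)"]
    by (simp add: vertex_inv_def static_n_def)
  fix \<tau> assume "vertex_inv ps q n \<tau>"
  then show "halts (While table_test vertex_step) \<tau> (Suc n * (bcost table_test + 1 + cost vertex_step))
      (vertex_inv ps q 0)"
  proof (rule halts_While[where J = "vertex_inv ps q"])
    show "halts vertex_step \<upsilon> (cost vertex_step) (vertex_inv ps q r)" if "vertex_inv ps q (Suc r) \<upsilon>" for r \<upsilon>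
      by (rule halts_exec) (use vertex_step[OF that] in \<open>simp_all add: vertex_step_def\<close>)
    show "\<not> bval table_test \<upsilon>" if "vertex_inv ps q 0 \<upsilon>" for \<upsilon>
      using that envD(1)[OF levelsD(1)] by (auto simp: vertex_inv_def table_test_def)
    show "vertex_inv ps q 0 \<upsilon>" if "vertex_inv ps q r \<upsilon>" "\<not> bval table_test \<upsilon>" for r \<upsilon>
      using that envD(1)[OF levelsD(1)] by (auto simp: vertex_inv_def table_test_def)
  qed
qed simp

lemma fill_loop:
  assumes "vertex_inv ps q 0 \<sigma>"
  shows "halts (block [nset ''x'' (NConst 0), While edge_test fill_step]) \<sigma>
    (cost (nset ''x'' (NConst 0)) + Suc N * (bcost edge_test + 1 + cost fill_step)) (fill_inv ps q 0)"
  unfolding block.simps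
proof (rule halts_Seq[OF halts_exec[where Q = "fill_inv ps q N"]])
  show "fill_inv ps q N (exec (nset ''x'' (NConst 0)) \<sigma>)"
    using assms levels_exec[of ps q \<sigma> "nset ''x'' (NConst 0)"] is_min_empty
    by (simp add: fill_inv_def vertex_inv_def static_n_def)
  fix \<tau> assume "fill_inv ps q N \<tau>"
  then show "halts (While edge_test fill_step) \<tau> (Suc N * (bcost edge_test + 1 + cost fill_step))
      (fill_inv ps q 0)"
  proof (rule halts_While[where J = "fill_inv ps q"])
    show "halts fill_step \<upsilon> (cost fill_step) (fill_inv ps q r)" if "fill_inv ps q (Suc r) \<upsilon>" for r \<upsilon>
      by (rule halts_exec) (use fill_step[OF that] in \<open>simp_all add: fill_step_def\<close>)
    show "\<not> bval edge_test \<upsilon>" if "fill_inv ps q 0 \<upsilon>" for \<upsilon>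
      using that envD(5)[OF levelsD(1)] by (auto simp: fill_inv_def edge_test_def)
    show "fill_inv ps q 0 \<upsilon>" if "fill_inv ps q r \<upsilon>" "\<not> bval edge_test \<upsilon>" for r \<upsilon>
      using that envD(5)[OF levelsD(1)] by (auto simp: fill_inv_def edge_test_def)
  qed
qed simp

lemma sweep_loop:
  assumes "fill_inv ps q 0 \<sigma>"
  shows "halts (block [sweep_init, While sweep_test sweep_step, level_next]) \<sigma>
    (cost sweep_init + (Suc (2 * N) * (bcost sweep_test + 1 + cost sweep_step) + cost level_next))
    (levels ps (Suc q))"
proof -
  let ?Q = "\<lambda>\<tau>. levels ps q \<tau> \<and> level (Suc q) \<tau>"
  have s: "levels ps q \<sigma>" "nmem \<sigma> ''x'' 0 = N" using assms by (auto simp: fill_inv_def)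
  have init: "sweep_inv ps q (2 * N) (exec sweep_init \<sigma>)"
  proof -
    have l: "levels ps q (exec sweep_init \<sigma>)"
      using s(1) by (rule levels_exec) (auto simp: sweep_init_def static_n_def static_r_def)
    have eqs: "nmem (exec sweep_init \<sigma>) ''i'' 0 = 0" "nmem (exec sweep_init \<sigma>) ''j'' 0 = N"
      "rmem (exec sweep_init \<sigma>) = rmem \<sigma>"
      using envD(5)[OF levelsD(1)[OF s(1)]] by (simp_all add: sweep_init_def)
    have "set (drop N ps) = {}" using env_ps(1)[OF levelsD(1)[OF s(1)]] by simp
    then show ?thesis
      using assms l is_min_empty s(2) unfolding sweep_inv_def Let_def eqs fill_inv_def by simp
  qed
  have loop: "halts (While sweep_test sweep_step) \<tau> (Suc (2 * N) * (bcost sweep_test + 1 + cost sweep_step)) ?Q"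
    if "sweep_inv ps q (2 * N) \<tau>" for \<tau>
    using that
  proof (rule halts_While[where J = "sweep_inv ps q"])
    show "halts sweep_step \<upsilon> (cost sweep_step) (sweep_inv ps q r)"
      if "sweep_inv ps q (Suc r) \<upsilon>" "bval sweep_test \<upsilon>" for r \<upsilon>
    proof (rule halts_exec)
      show "sweep_inv ps q r (exec sweep_step \<upsilon>)"
        using pull_step[OF that] emit_step[OF that] by (simp add: sweep_step_def)
    qed (simp add: sweep_step_def pull_step_def emit_step_def)
    show "\<not> bval sweep_test \<upsilon>" if "sweep_inv ps q 0 \<upsilon>" for \<upsilon>
      using that envD(5)[OF levelsD(1)] by (auto simp: sweep_inv_def Let_def sweep_test_def)
    fix r \<upsilon> assume inv: "sweep_inv ps q r \<upsilon>" "\<not> bval sweep_test \<upsilon>"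
    then have l: "levels ps q \<upsilon>" and i: "nmem \<upsilon> ''i'' 0 = N"
      using envD(5)[OF levelsD(1), of ps q \<upsilon>] by (auto simp: sweep_inv_def Let_def sweep_test_def)
    have "rmem \<upsilon> ''A'' (Suc q * N + y) = A (Suc q) (y div n) (U - E y)" if y: "y < N" for y
    proof -
      obtain k where "k < N" "y = ps ! k" using env_ps(4)[OF levelsD(1)[OF l] y] by blast
      then show ?thesis
        using inv(1) i unfolding sweep_inv_def Let_def by (simp del: A.simps mult_Suc)
    qed
    then show "?Q \<upsilon>" using l by (simp add: level_def)
  qed
  have next_level: "levels ps (Suc q) (exec level_next \<tau>)" if "?Q \<tau>" for \<tau>
  proof -
    have "env ps (exec level_next \<tau>)"
      using that by (intro env_exec) (auto simp: levels_def level_next_def static_n_def static_r_def)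
    moreover have "rmem (exec level_next \<tau>) = rmem \<tau>" by (simp add: level_next_def)
    moreover have "nmem (exec level_next \<tau>) ''a'' 0 = Suc q * N"
      "nmem (exec level_next \<tau>) ''e'' 0 = Suc (Suc q) * N" "nmem (exec level_next \<tau>) ''q'' 0 = Suc q"
      using that levelsD(2-4)[of ps q \<tau>] envD(5)[OF levelsD(1), of ps q \<tau>] by (auto simp: level_next_def)
    ultimately show ?thesis
      using that unfolding levels_def level_def by (auto simp: le_Suc_eq)
  qed
  show ?thesis
    unfolding block.simps
    by (rule halts_Seq[OF halts_exec[where Q = "sweep_inv ps q (2 * N)"]]; (rule halts_Seq[OF loop])?;
        (rule halts_exec)?) (use init next_level in \<open>auto simp: sweep_init_def level_next_def\<close>)
qed

lemma level_prog:
  assumes "levels ps q \<sigma>"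
  shows "halts level_prog \<sigma> level_time (levels ps (Suc q))"
  unfolding level_prog_def block.simps
  by (rule halts_mono, rule halts_Seq_assoc, rule halts_Seq[OF vertex_loop[OF assms, unfolded block.simps]],
      rule halts_Seq_assoc, erule halts_Seq[OF fill_loop[unfolded block.simps]],
      erule sweep_loop[unfolded block.simps])
     (simp_all add: level_time_def)

definition levels_time :: nat where
  "levels_time = cost (nset ''x'' (NConst 0)) + (Suc N * (bcost edge_test + 1 + cost base_step) +
     (cost levels_init + Suc (max_stops I) * (bcost bound_test + 1 + level_time)))"

lemma levels_prog:
  assumes "env ps \<sigma>"
  shows "halts levels_prog \<sigma> levels_time (levels ps (max_stops I))"
proof -
  have init: "base_inv ps N (exec (nset ''x'' (NConst 0)) \<sigma>)"
    using env_exec[OF assms, of "nset ''x'' (NConst 0)"] by (simp add: base_inv_def static_n_def)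
  have base: "halts (While edge_test base_step) \<tau> (Suc N * (bcost edge_test + 1 + cost base_step)) (base_inv ps 0)"
    if "base_inv ps N \<tau>" for \<tau>
    using that
  proof (rule halts_While[where J = "base_inv ps"])
    show "halts base_step \<upsilon> (cost base_step) (base_inv ps r)" if "base_inv ps (Suc r) \<upsilon>" for r \<upsilon>
      by (rule halts_exec) (use base_step[OF that] in \<open>simp_all add: base_step_def\<close>)
    show "\<not> bval edge_test \<upsilon>" if "base_inv ps 0 \<upsilon>" for \<upsilon>
      using that envD(5) by (auto simp: base_inv_def edge_test_def)
    show "base_inv ps 0 \<upsilon>" if "base_inv ps r \<upsilon>" "\<not> bval edge_test \<upsilon>" for r \<upsilon>
      using that envD(5) by (auto simp: base_inv_def edge_test_def)
  qed
  have init': "levels ps 0 (exec levels_init \<tau>)" if "base_inv ps 0 \<tau>" for \<tau>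
  proof -
    have "env ps (exec levels_init \<tau>)"
      using that by (intro env_exec) (auto simp: base_inv_def levels_init_def static_n_def static_r_def)
    then show ?thesis
      using that envD(5)[of ps \<tau>] by (simp add: levels_def level_def base_inv_def levels_init_def)
  qed
  define J where "J r \<tau> \<longleftrightarrow> (\<exists>q. levels ps q \<tau> \<and> r + q = max_stops I)" for r \<tau>
  have test: "bval bound_test \<tau> \<longleftrightarrow> q < max_stops I" if "levels ps q \<tau>" for q \<tau>
    using levelsD(4)[OF that] envD(4)[OF levelsD(1)[OF that]] by (simp add: bound_test_def)
  have loop: "halts (While bound_test level_prog) \<tau> (Suc (max_stops I) * (bcost bound_test + 1 + level_time))
      (levels ps (max_stops I))" if "levels ps 0 \<tau>" for \<tau>
  proof (rule halts_While[where J = J])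
    show "J (max_stops I) \<tau>" using that by (auto simp: J_def)
    show "\<not> bval bound_test \<upsilon>" if "J 0 \<upsilon>" for \<upsilon>
      using that test by (auto simp: J_def)
    show "levels ps (max_stops I) \<upsilon>" if J: "J r \<upsilon>" and b: "\<not> bval bound_test \<upsilon>" for r \<upsilon>
    proof -
      obtain q where q: "levels ps q \<upsilon>" "r + q = max_stops I" using J by (auto simp: J_def)
      then have "q = max_stops I" using b test[OF q(1)] by simp
      then show ?thesis using q by simp
    qed
    fix r \<upsilon> assume "J (Suc r) \<upsilon>"
    then obtain q where q: "levels ps q \<upsilon>" "Suc r + q = max_stops I" by (auto simp: J_def)
    show "halts level_prog \<upsilon> level_time (J r)"
      by (rule halts_mono[OF level_prog[OF q(1)]]) (use q(2) in \<open>auto simp: J_def intro!: exI[of _ "Suc q"]\<close>)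
  qed
  show ?thesis
    unfolding levels_prog_def levels_time_def block.simps
    by (rule halts_Seq[OF halts_exec[where Q = "base_inv ps N"]]; (rule halts_Seq[OF base])?;
        (rule halts_Seq[OF halts_exec[where Q = "levels ps 0"] loop])?)
       (use init init' in \<open>auto simp: levels_init_def\<close>)
qed

end

section \<open>Recovering a cheapest route\<close>

text \<open>Going from all stops left down to none is the order of travel, so the route is written
  from the source onwards. The initial state is the loop at the source, which encodes the empty
  tank.\<close>

definition back_init :: prog where
  "back_init = block [
     nset ''u'' (NGet ''dg'' (nvar ''s'')),
     NSet ''route'' (NConst 0) (nvar ''s''),
     nset ''length'' (NConst 1),
     nset ''feasible'' (NConst 0)]"

abbreviation value_exp :: rexp where
  "value_exp \<equiv> RGet ''A'' (NAdd (nvar ''a'') (nvar ''u''))"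
abbreviation gas_exp :: rexp where
  "gas_exp \<equiv> RSub (rvar ''U'') (RGet ''d'' (nvar ''u''))"
abbreviation back_price_exp :: rexp where
  "back_price_exp \<equiv> RGet ''c'' (NGet ''row'' (nvar ''u''))"

definition same_row_test :: bexp where
  "same_row_test = BAnd (NLess (NConst 0) (NGet ''ok'' (nvar ''x'')))
     (BNot (nne (NGet ''row'' (nvar ''x'')) (NGet ''row'' (nvar ''u''))))"

text \<open>No admissible candidate lies below the value, so the negated comparison is a test for
  equality.\<close>

definition exact_test :: bexp where
  "exact_test = BAnd same_row_test (BAnd (BNot (RLess (RGet ''d'' (nvar ''x'')) gas_exp))
     (BNot (RLess value_exp (RAdd (RMul (RSub (RGet ''d'' (nvar ''x'')) gas_exp) back_price_exp)
        (RGet ''A'' (NAdd (nvar ''e'') (NGet ''dg'' (NGet ''col'' (nvar ''x'')))))))))"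

definition fill_test :: bexp where
  "fill_test = BAnd same_row_test
     (BNot (RLess value_exp (RAdd (RMul (RGet ''d'' (nvar ''u'')) back_price_exp)
        (RGet ''A'' (NAdd (nvar ''e'') (NGet ''tr'' (nvar ''x'')))))))"

text \<open>All edges are scanned, not only those at the current vertex: there are at most
  \<open>max_stops I\<close> scans, each linear in the number of edges. The last match wins.\<close>

definition scan_step :: prog where
  "scan_step = block [
     Cond exact_test (block [
       rset ''f'' (RSub (RGet ''d'' (nvar ''x'')) gas_exp),
       nset ''y'' (NGet ''dg'' (NGet ''col'' (nvar ''x'')))]) Skip,
     Cond fill_test (block [
       rset ''f'' (RGet ''d'' (nvar ''u'')),
       nset ''y'' (NGet ''tr'' (nvar ''x''))]) Skip,
     ninc ''x'']"

definition extend_step :: prog where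
  "extend_step = block [
     RSet ''fuel'' (NSub (nvar ''length'') (NConst 1)) (rvar ''f''),
     NSet ''route'' (nvar ''length'') (NGet ''row'' (nvar ''y'')),
     ninc ''length'',
     nset ''u'' (nvar ''y'')]"

text \<open>Only a strict gain over one stop fewer calls for a stop here; otherwise the same state
  is carried to the next level.\<close>

definition stop_test :: bexp where
  "stop_test = RLess value_exp (RGet ''A'' (NAdd (nvar ''e'') (nvar ''u'')))"

definition stop_prog :: prog where
  "stop_prog = block [nset ''x'' (NConst 0), While edge_test scan_step, extend_step]"

definition back_prev :: prog where
  "back_prev = block [nset ''a'' (nvar ''e''), nset ''q'' (NSub (nvar ''q'') (NConst 1))]"

definition back_step :: prog where
  "back_step = block [
     nset ''e'' (NSub (nvar ''a'') (nvar ''N'')),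
     Cond stop_test stop_prog Skip,
     back_prev]"

definition back_test :: bexp where
  "back_test = NLess (NConst 0) (nvar ''q'')"

definition back_prog :: prog where
  "back_prog = block [
     back_init,
     Cond (RLess value_exp (rvar ''M''))
       (block [nset ''feasible'' (NConst 1), While back_test back_step]) Skip]"

context gas_problem begin

section \<open>Correctness of the recovered route\<close>

definition choice :: "nat \<Rightarrow> nat \<Rightarrow> real \<Rightarrow> nat \<Rightarrow> bool" where
  "choice q u f y \<longleftrightarrow> y < N \<and> E y \<le> U \<and> y div n \<noteq> u div n \<and> 0 \<le> f \<and> (U - E u) + f \<le> U \<and>
     (U - E u) + f - dist (u div n) (y div n) = U - E y \<and>
     f * c (u div n) + A q (y div n) (U - E y) = A (Suc q) (u div n) (U - E u)"

definition exact_choice :: "nat \<Rightarrow> nat \<Rightarrow> nat \<Rightarrow> bool" where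
  "exact_choice q u x \<longleftrightarrow> ok x \<and> x div n = u div n \<and> U - E u \<le> E x \<and>
     (E x - (U - E u)) * c (u div n) + A q (x mod n) 0 \<le> A (Suc q) (u div n) (U - E u)"

definition fill_choice :: "nat \<Rightarrow> nat \<Rightarrow> nat \<Rightarrow> bool" where
  "fill_choice q u x \<longleftrightarrow> ok x \<and> x div n = u div n \<and>
     E u * c (u div n) + fill_cand q x \<le> A (Suc q) (u div n) (U - E u)"

text \<open>\<open>A_exact\<close> supplies the converse of the tested inequality. Arrival is with
  an empty tank, hence the loop at \<open>x mod n\<close> as the next state.\<close>

lemma choice_exact:
  assumes "x < N" "u < N" "E u \<le> U" "exact_choice q u x"
  shows "choice q u (E x - (U - E u)) ((x mod n) * n + x mod n)"
proof -
  let ?v = "u div n" and ?w = "x mod n"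
  have x: "ok x" "x div n = ?v" "U - E u \<le> E x" using assms(4) by (auto simp: exact_choice_def)
  note o = ok_dist[OF assms(1) x(1), unfolded x(2)]
  have w: "?w * n + ?w < N" "E (?w * n + ?w) = U"
    using edge_less[OF o(1) o(1)] E_loop[OF o(1)] by auto
  have "A (Suc q) ?v (U - E u) \<le> (E x - (U - E u)) * c ?v + A q ?w 0"
    unfolding o(3) using o x(3) by (intro A_exact) auto
  then have "(E x - (U - E u)) * c ?v + A q ?w 0 = A (Suc q) ?v (U - E u)"
    using assms(4) unfolding exact_choice_def by linarith
  then show ?thesis
    using w o x assms(3) by (simp add: choice_def del: A.simps)
qed

lemma choice_fill:
  assumes "x < N" "u < N" "E u \<le> U" "fill_choice q u x"
  shows "choice q u (E u) ((x mod n) * n + x div n)"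
proof -
  let ?v = "u div n" and ?w = "x mod n"
  have x: "ok x" "x div n = ?v" using assms(4) by (auto simp: fill_choice_def)
  note o = ok_dist[OF assms(1) x(1), unfolded x(2)]
  have v: "?v < n" using edge_bounds[OF assms(2)] by simp
  have w: "?w * n + ?v < N" using edge_less[OF o(1) v] .
  have "A (Suc q) ?v (U - E u) \<le> (U - (U - E u)) * c ?v + A q ?w (U - dist ?v ?w)"
    using o by (intro A_fill) auto
  then have "E u * c ?v + A q ?w (U - dist ?v ?w) = A (Suc q) ?v (U - E u)"
    using assms(4) o(5) unfolding fill_choice_def fill_cand_def x(2) by (simp del: A.simps)
  then show ?thesis
    using w o v assms(3) E_nonneg[OF assms(2)] unfolding choice_def x(2) by (simp del: A.simps)
qed

lemma ex_choice:
  assumes "u < N" "A (Suc q) (u div n) (U - E u) < A q (u div n) (U - E u)"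
  shows "\<exists>x<N. exact_choice q u x \<or> fill_choice q u x"
proof (cases q "u div n" "U - E u" rule: A_cases)
  case keep
  then show ?thesis using assms(2) by simp
next
  case (exact w)
  have v: "u div n < n" using edge_bounds[OF assms(1)] by simp
  show ?thesis
    using exact edge_less[OF v exact(1)] ok_edge[OF v] E_dist[OF v]
    by (intro exI[of _ "(u div n) * n + w"]) (simp add: exact_choice_def del: A.simps)
next
  case (fill w)
  have v: "u div n < n" using edge_bounds[OF assms(1)] by simp
  have "E (w * n + u div n) = dist (u div n) w"
    using E_dist[OF fill(1) v] dist_sym[OF fill(1) v] fill(2) by simp
  then show ?thesis
    using fill edge_less[OF v fill(1)] ok_edge[OF v] v
    by (intro exI[of _ "(u div n) * n + w"]) (simp add: fill_choice_def fill_cand_def del: A.simps)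
qed

text \<open>The cost so far and the value of the current state always add up to the optimum. Keeping
  this value below \<open>M\<close> ensures that the route ends at the destination once no stops are
  left.\<close>

definition back_inv :: "nat list \<Rightarrow> nat \<Rightarrow> store \<Rightarrow> bool" where
  "back_inv ps q \<sigma> \<longleftrightarrow> env ps \<sigma> \<and> nmem \<sigma> ''a'' 0 = q * N \<and> nmem \<sigma> ''q'' 0 = q \<and>
     q \<le> max_stops I \<and> (\<forall>q' \<le> max_stops I. level q' \<sigma>) \<and> nmem \<sigma> ''feasible'' 0 \<noteq> 0 \<and>
     (let u = nmem \<sigma> ''u'' 0; x = A q (u div n) (U - E u) in
      u < N \<and> E u \<le> U \<and> x < M \<and> 0 < nmem \<sigma> ''length'' 0 \<and>
      length (out_fuel \<sigma>) + q \<le> max_stops I \<and>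
      partial_way (out_route \<sigma>) (out_fuel \<sigma>) (u div n) (U - E u) (A (max_stops I) (src I) 0 - x))"

definition scan_inv :: "nat list \<Rightarrow> nat \<Rightarrow> nat \<Rightarrow> store \<Rightarrow> bool" where
  "scan_inv ps q r \<sigma> \<longleftrightarrow> back_inv ps (Suc q) \<sigma> \<and> nmem \<sigma> ''e'' 0 = q * N \<and> r + nmem \<sigma> ''x'' 0 = N \<and>
     (let u = nmem \<sigma> ''u'' 0 in
      (\<exists>x < nmem \<sigma> ''x'' 0. exact_choice q u x \<or> fill_choice q u x) \<longrightarrow>
      choice q u (rmem \<sigma> ''f'' 0) (nmem \<sigma> ''y'' 0))"

lemma back_exec:
  assumes "back_inv ps q \<sigma>"
    "nwrites P \<inter> (static_n \<union> {''a'', ''q'', ''u'', ''feasible'', ''length'', ''route''}) = {}"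
    "rwrites P \<inter> (static_r \<union> {''A'', ''fuel''}) = {}"
  shows "back_inv ps q (exec P \<sigma>)"
proof -
  have "env ps (exec P \<sigma>)" using assms by (intro env_exec) (auto simp: back_inv_def)
  moreover have "nmem (exec P \<sigma>) a = nmem \<sigma> a"
    if "a \<in> {''a'', ''q'', ''u'', ''feasible'', ''length'', ''route''}" for a
    using assms(2) that by (intro exec_frame) blast
  moreover have "rmem (exec P \<sigma>) a = rmem \<sigma> a" if "a \<in> {''A'', ''fuel''}" for a
    using assms(3) that by (intro exec_frame) blast
  ultimately show ?thesis
    using assms(1) by (simp add: back_inv_def level_def out_route_def out_fuel_def)
qed

lemma scan_step:
  assumes inv: "scan_inv ps q (Suc r) \<sigma>"
  shows "scan_inv ps q r (exec scan_step \<sigma>)"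
proof -
  define x u v where defs: "x = nmem \<sigma> ''x'' 0" "u = nmem \<sigma> ''u'' 0" "v = u div n"
  note folds = defs(1,2)[symmetric]
  have s: "back_inv ps (Suc q) \<sigma>" "nmem \<sigma> ''e'' 0 = q * N" "Suc r + x = N"
    "(\<exists>x' < x. exact_choice q u x' \<or> fill_choice q u x') \<Longrightarrow> choice q u (rmem \<sigma> ''f'' 0) (nmem \<sigma> ''y'' 0)"
    using inv unfolding scan_inv_def Let_def folds by auto
  have b: "env ps \<sigma>" "nmem \<sigma> ''a'' 0 = Suc q * N" "level (Suc q) \<sigma>" "level q \<sigma>" "u < N" "E u \<le> U"
    using s(1) unfolding back_inv_def Let_def folds by auto
  have x: "x < N" using s(3) by simp
  note ed = edge_bounds[OF x] edge_bounds[OF b(5)]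
  note env = envD(6)[OF b(1)] envD(8)[OF b(1) ed(3)] envD(9)[OF b(1) ed(2)] envD(10-14)[OF b(1) x]
    envD(10,13)[OF b(1,5)]
  have val: "rmem \<sigma> ''A'' (Suc q * N + u) = A (Suc q) v (U - E u)"
    "rmem \<sigma> ''A'' (q * N + (x mod n * n + x mod n)) = A q (x mod n) 0"
    "rmem \<sigma> ''A'' (q * N + (x mod n * n + x div n)) = fill_cand q x"
    using levelD[OF b(3,5)] levelD[OF b(4) edge_less[OF ed(2,2)]] levelD[OF b(4) edge_less[OF ed(2,1)]]
      ed E_loop[OF ed(2)]
    by (simp_all add: fill_cand_def defs(3) del: A.simps mult_Suc)
  have same: "bval same_row_test \<sigma> \<longleftrightarrow> ok x \<and> x div n = v"
    using env by (auto simp: same_row_test_def folds defs(3))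
  have exact: "bval exact_test \<sigma> \<longleftrightarrow> exact_choice q u x"
    using same env val b(2) s(2)
    by (auto simp: exact_test_def exact_choice_def folds defs(3) not_less simp del: A.simps mult_Suc)
  have fill: "bval fill_test \<sigma> \<longleftrightarrow> fill_choice q u x"
    using same env val b(2) s(2)
    by (auto simp: fill_test_def fill_choice_def folds defs(3) not_less simp del: A.simps mult_Suc)
  define \<rho> where "\<rho> = exec (Cond exact_test (block [
       rset ''f'' (RSub (RGet ''d'' (nvar ''x'')) gas_exp),
       nset ''y'' (NGet ''dg'' (NGet ''col'' (nvar ''x'')))]) Skip) \<sigma>"
  have \<rho>: "nmem \<rho> ''x'' 0 = x" "nmem \<rho> ''u'' 0 = u" "nmem \<rho> ''tr'' = nmem \<sigma> ''tr''" "rmem \<rho> ''d'' = rmem \<sigma> ''d''"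
    "rmem \<rho> ''f'' 0 = (if exact_choice q u x then E x - (U - E u) else rmem \<sigma> ''f'' 0)"
    "nmem \<rho> ''y'' 0 = (if exact_choice q u x then x mod n * n + x mod n else nmem \<sigma> ''y'' 0)"
    using env exact by (simp_all add: \<rho>_def folds)
  \<comment> \<open>The first conditional writes only \<open>f\<close> and \<open>y\<close>, which
    \<open>fill_test\<close> does not read. If both tests succeed, the second overwrites both cells,
    so they still belong together.\<close>
  have "bval fill_test \<rho> \<longleftrightarrow> bval fill_test \<sigma>"
    by (simp add: \<rho>_def fill_test_def same_row_test_def)
  then have fill': "bval fill_test \<rho> \<longleftrightarrow> fill_choice q u x" using fill by simp
  define \<tau> where "\<tau> = exec scan_step \<sigma>"
  have \<tau>: "\<tau> = exec (block [Cond fill_test (block [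
       rset ''f'' (RGet ''d'' (nvar ''u'')),
       nset ''y'' (NGet ''tr'' (nvar ''x''))]) Skip, ninc ''x'']) \<rho>"
    by (simp only: \<tau>_def \<rho>_def scan_step_def block.simps exec.simps)
  have eqs: "nmem \<tau> ''x'' 0 = Suc x" "nmem \<tau> ''u'' 0 = u"
    "rmem \<tau> ''f'' 0 = (if fill_choice q u x then E u else rmem \<rho> ''f'' 0)"
    "nmem \<tau> ''y'' 0 = (if fill_choice q u x then x mod n * n + x div n else nmem \<rho> ''y'' 0)"
    using fill' \<rho>(1-4) env by (simp_all add: \<tau>)
  have binv: "back_inv ps (Suc q) \<tau>"
    unfolding \<tau>_def using s(1) by (rule back_exec) (auto simp: scan_step_def static_n_def static_r_def)
  have e: "nmem \<tau> ''e'' 0 = q * N"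
    unfolding \<tau>_def s(2)[symmetric] by (subst exec_frame) (auto simp: scan_step_def)
  have "choice q u (rmem \<tau> ''f'' 0) (nmem \<tau> ''y'' 0)"
    if "\<exists>x' < Suc x. exact_choice q u x' \<or> fill_choice q u x'"
    using that s(4) choice_exact[OF x b(5,6)] choice_fill[OF x b(5,6)] unfolding eqs(3,4) \<rho>(5,6)
    by (auto simp: less_Suc_eq)
  then show ?thesis
    using binv e s(3) unfolding \<tau>_def[symmetric] scan_inv_def Let_def eqs(1,2) by auto
qed

lemma extend_step:
  assumes binv: "back_inv ps (Suc q) \<sigma>" and e: "nmem \<sigma> ''e'' 0 = q * N"
    and choice: "choice q (nmem \<sigma> ''u'' 0) (rmem \<sigma> ''f'' 0) (nmem \<sigma> ''y'' 0)"
  shows "back_inv ps q (exec (block [extend_step, back_prev]) \<sigma>)"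
proof -
  define u f y l where defs: "u = nmem \<sigma> ''u'' 0" "f = rmem \<sigma> ''f'' 0" "y = nmem \<sigma> ''y'' 0"
    "l = nmem \<sigma> ''length'' 0"
  note folds = defs[symmetric]
  define \<tau> where "\<tau> = exec (block [extend_step, back_prev]) \<sigma>"
  have b: "env ps \<sigma>" "nmem \<sigma> ''q'' 0 = Suc q" "q < max_stops I" "\<And>q'. q' \<le> max_stops I \<Longrightarrow> level q' \<sigma>"
     "nmem \<sigma> ''feasible'' 0 \<noteq> 0" "u < N" "E u \<le> U" "A (Suc q) (u div n) (U - E u) < M" "0 < l"
     "length (out_fuel \<sigma>) + Suc q \<le> max_stops I"
     "partial_way (out_route \<sigma>) (out_fuel \<sigma>) (u div n) (U - E u)
        (A (max_stops I) (src I) 0 - A (Suc q) (u div n) (U - E u))"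
    using binv unfolding back_inv_def Let_def folds by auto
  have ch: "y < N" "E y \<le> U" "y div n \<noteq> u div n" "0 \<le> f" "(U - E u) + f \<le> U"
     "(U - E u) + f - dist (u div n) (y div n) = U - E y"
     "f * c (u div n) + A q (y div n) (U - E y) = A (Suc q) (u div n) (U - E u)"
    using choice unfolding choice_def folds by auto
  \<comment> \<open>The amount is bought at position \<open>l - 1\<close>, before driving to
    position \<open>l\<close>, so \<open>fuel\<close> is one cell behind
    \<open>route\<close>.\<close>
  obtain m where l: "l = Suc m" using b(9) by (cases l) auto
  have eqs: "nmem \<tau> ''a'' 0 = q * N" "nmem \<tau> ''q'' 0 = q" "nmem \<tau> ''u'' 0 = y" "nmem \<tau> ''length'' 0 = Suc l"
    "nmem \<tau> ''feasible'' 0 = nmem \<sigma> ''feasible'' 0" "rmem \<tau> ''A'' = rmem \<sigma> ''A''"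
    "nmem \<tau> ''route'' = (nmem \<sigma> ''route'')(l := y div n)" "rmem \<tau> ''fuel'' = (rmem \<sigma> ''fuel'')(m := f)"
    using e b(2) l envD(10)[OF b(1) ch(1)] by (simp_all add: \<tau>_def extend_step_def back_prev_def folds)
  have env: "env ps \<tau>"
    unfolding \<tau>_def using b(1) by (rule env_exec) (auto simp: extend_step_def back_prev_def static_n_def static_r_def)
  have out: "out_route \<tau> = out_route \<sigma> @ [y div n]" "out_fuel \<tau> = out_fuel \<sigma> @ [f]"
    unfolding out_route_def out_fuel_def eqs folds by (simp_all add: l)
  have v: "u div n < n" "y div n < n" using edge_bounds b(6) ch(1) by auto
  have "partial_way (out_route \<sigma> @ [y div n]) (out_fuel \<sigma> @ [f]) (y div n)
      (U - E u + f - dist (u div n) (y div n))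
      (A (max_stops I) (src I) 0 - A (Suc q) (u div n) (U - E u) + f * c (u div n))"
    using ch E_nonneg[OF ch(1)] by (intro partial_way_extend[OF b(11) v(2) ch(3)]) linarith+
  then have "partial_way (out_route \<tau>) (out_fuel \<tau>) (y div n) (U - E y)
      (A (max_stops I) (src I) 0 - A q (y div n) (U - E y))"
    unfolding out ch(6) ch(7)[symmetric] by (simp del: A.simps)
  moreover have "A q (y div n) (U - E y) < M"
    using ch(4,7) b(8) mult_nonneg_nonneg[OF ch(4) less_imp_le[OF c_pos[OF v(1)]]] by linarith
  moreover have "\<forall>q'\<le>max_stops I. level q' \<tau>" using b(4) unfolding level_def eqs by blast
  moreover have "length (out_fuel \<tau>) + q \<le> max_stops I" using b(10) unfolding out by simp
  ultimately show ?thesis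
    using env ch(1,2) b(3,5) unfolding \<tau>_def[symmetric] back_inv_def Let_def eqs by simp
qed

definition stop_time :: nat where
  "stop_time = cost (nset ''x'' (NConst 0)) +
     (Suc N * (bcost edge_test + 1 + cost scan_step) + cost extend_step)"

definition back_time :: nat where
  "back_time = cost (nset ''e'' (NSub (nvar ''a'') (nvar ''N''))) +
     ((bcost stop_test + 1 + (stop_time + cost Skip)) + cost back_prev)"

lemma back_step:
  assumes binv: "back_inv ps (Suc q) \<sigma>"
  shows "halts back_step \<sigma> back_time (back_inv ps q)"
proof -
  let ?I = "\<lambda>\<sigma>. back_inv ps (Suc q) \<sigma> \<and> nmem \<sigma> ''e'' 0 = q * N"
  \<comment> \<open>The invariant is restored only when \<open>back_prev\<close> lowers the level,
    so both branches aim at its weakest precondition under \<open>back_prev\<close>.\<close>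
  let ?Q = "\<lambda>\<tau>. back_inv ps q (exec back_prev \<tau>)"
  have init: "?I (exec (nset ''e'' (NSub (nvar ''a'') (nvar ''N''))) \<sigma>)"
  proof -
    have "nmem \<sigma> ''a'' 0 = Suc q * N" "nmem \<sigma> ''N'' 0 = N"
      using binv envD(5)[of ps \<sigma>] by (auto simp: back_inv_def)
    then show ?thesis
      using back_exec[OF binv, of "nset ''e'' (NSub (nvar ''a'') (nvar ''N''))"]
      by (simp add: static_n_def)
  qed
  have test: "bval stop_test \<tau> \<longleftrightarrow>
      A (Suc q) (nmem \<tau> ''u'' 0 div n) (U - E (nmem \<tau> ''u'' 0)) < A q (nmem \<tau> ''u'' 0 div n) (U - E (nmem \<tau> ''u'' 0))"
    if "?I \<tau>" for \<tau>
  proof -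
    have *: "nmem \<tau> ''a'' 0 = Suc q * N" "level (Suc q) \<tau>" "level q \<tau>" "nmem \<tau> ''u'' 0 < N"
      using that by (auto simp: back_inv_def Let_def)
    show ?thesis
      using that *(1) levelD[OF *(2,4)] levelD[OF *(3,4)]
      by (simp add: stop_test_def del: A.simps mult_Suc)
  qed
  have stop: "halts stop_prog \<tau> stop_time ?Q" if I: "?I \<tau>" and t: "bval stop_test \<tau>" for \<tau>
  proof -
    let ?u = "nmem \<tau> ''u'' 0"
    have u: "?u < N" using I by (auto simp: back_inv_def Let_def)
    have ex: "\<exists>x<N. exact_choice q ?u x \<or> fill_choice q ?u x"
      using t test[OF I] by (intro ex_choice[OF u]) blast
    define J where "J r \<upsilon> \<longleftrightarrow> scan_inv ps q r \<upsilon> \<and> nmem \<upsilon> ''u'' 0 = ?u" for r \<upsilon>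
    have init: "J N (exec (nset ''x'' (NConst 0)) \<tau>)"
      using I back_exec[of ps "Suc q" \<tau> "nset ''x'' (NConst 0)"]
      by (simp add: J_def scan_inv_def static_n_def)
    have loop: "halts (While edge_test scan_step) \<upsilon> (Suc N * (bcost edge_test + 1 + cost scan_step))
        (\<lambda>\<upsilon>. ?I \<upsilon> \<and> choice q (nmem \<upsilon> ''u'' 0) (rmem \<upsilon> ''f'' 0) (nmem \<upsilon> ''y'' 0))" if "J N \<upsilon>" for \<upsilon>
      using that
    proof (rule halts_While[where J = J])
      have x: "bval edge_test \<upsilon> \<longleftrightarrow> nmem \<upsilon> ''x'' 0 < N" if "J r \<upsilon>" for r \<upsilon>
        using that envD(5)[of ps \<upsilon>] by (auto simp: J_def scan_inv_def back_inv_def edge_test_def)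
      show "\<not> bval edge_test \<upsilon>" if "J 0 \<upsilon>" for \<upsilon>
        using that x[OF that] by (simp add: J_def scan_inv_def)
      show "halts scan_step \<upsilon> (cost scan_step) (J r)" if "J (Suc r) \<upsilon>" for r \<upsilon>
      proof (rule halts_exec)
        have "nmem (exec scan_step \<upsilon>) ''u'' = nmem \<upsilon> ''u''"
          by (rule exec_frame) (simp add: scan_step_def)
        then show "J r (exec scan_step \<upsilon>)"
          using that scan_step by (simp add: J_def)
      qed (simp add: scan_step_def)
      show "?I \<upsilon> \<and> choice q (nmem \<upsilon> ''u'' 0) (rmem \<upsilon> ''f'' 0) (nmem \<upsilon> ''y'' 0)"
        if "J r \<upsilon>" "\<not> bval edge_test \<upsilon>" for r \<upsilon>
      proof -
        have "nmem \<upsilon> ''x'' 0 = N" using that x[OF that(1)] by (simp add: J_def scan_inv_def)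
        then show ?thesis
          using that(1) ex unfolding J_def scan_inv_def Let_def by auto
      qed
    qed
    have fin: "?Q (exec extend_step \<upsilon>)"
      if "?I \<upsilon> \<and> choice q (nmem \<upsilon> ''u'' 0) (rmem \<upsilon> ''f'' 0) (nmem \<upsilon> ''y'' 0)" for \<upsilon>
      using that extend_step[of ps q \<upsilon>] by simp
    show ?thesis
      unfolding stop_prog_def stop_time_def block.simps
      by (rule halts_Seq[OF halts_exec[where Q = "J N"]]; (rule halts_Seq[OF loop])?; (rule halts_exec)?)
         (use init fin in \<open>auto simp: extend_step_def\<close>)
  qed
  have keep: "?Q \<tau>" if I: "?I \<tau>" and t: "\<not> bval stop_test \<tau>" for \<tau>
  proof -
    let ?u = "nmem \<tau> ''u'' 0" and ?\<upsilon> = "exec back_prev \<tau>"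
    have A: "A (Suc q) (?u div n) (U - E ?u) = A q (?u div n) (U - E ?u)"
      using t test[OF I] A_keep[of q "?u div n" "U - E ?u"] by linarith
    have env: "env ps ?\<upsilon>"
      using I by (intro env_exec) (auto simp: back_inv_def back_prev_def static_n_def static_r_def)
    have eqs: "nmem ?\<upsilon> ''a'' 0 = q * N" "nmem ?\<upsilon> ''q'' 0 = q" "nmem ?\<upsilon> ''u'' = nmem \<tau> ''u''"
      "nmem ?\<upsilon> ''length'' = nmem \<tau> ''length''" "nmem ?\<upsilon> ''route'' = nmem \<tau> ''route''"
      "nmem ?\<upsilon> ''feasible'' = nmem \<tau> ''feasible''" "rmem ?\<upsilon> = rmem \<tau>"
      using I by (simp_all add: back_prev_def back_inv_def)
    show ?thesis
      using I env unfolding back_inv_def Let_def level_def out_route_def out_fuel_def eqs A by auto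
  qed
  have cond: "halts (Cond stop_test stop_prog Skip) \<tau> (bcost stop_test + 1 + (stop_time + cost Skip)) ?Q"
    if I: "?I \<tau>" for \<tau>
  proof (rule halts_Cond)
    show "halts stop_prog \<tau> (stop_time + cost Skip) ?Q" if "bval stop_test \<tau>"
      by (rule halts_mono[OF stop[OF I that]]) auto
    show "halts Skip \<tau> (stop_time + cost Skip) ?Q" if "\<not> bval stop_test \<tau>"
      by (rule halts_mono[OF halts_exec]) (use keep[OF I that] in auto)
  qed
  show ?thesis
    unfolding back_step_def back_time_def block.simps
    by (rule halts_Seq[OF halts_exec[where Q = ?I]]; (rule halts_Seq[OF cond])?; (rule halts_exec)?)
       (use init in \<open>auto simp: back_prev_def\<close>)
qed

definition answer_time :: nat where
  "answer_time = cost back_init + (bcost (RLess value_exp (rvar ''M'')) + 1 +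
     (cost (nset ''feasible'' (NConst 1)) + Suc (max_stops I) * (bcost back_test + 1 + back_time) + cost Skip))"

lemma back_prog:
  assumes "levels ps (max_stops I) \<sigma>"
  shows "halts back_prog \<sigma> answer_time (correct_output I)"
proof -
  let ?v = "A (max_stops I) (src I) 0" and ?u = "src I * n + src I"
  note env = envD[OF levelsD(1)[OF assms]]
  define \<rho> where "\<rho> = exec back_init \<sigma>"
  have \<rho>: "nmem \<rho> ''u'' 0 = ?u" "nmem \<rho> ''route'' 0 = src I" "nmem \<rho> ''length'' 0 = 1"
      "nmem \<rho> ''feasible'' 0 = 0" "rmem \<rho> = rmem \<sigma>"
    using env(2) env(9)[OF src] by (simp_all add: \<rho>_def back_init_def)
  have l\<rho>: "levels ps (max_stops I) \<rho>"
    unfolding \<rho>_def using assms by (rule levels_exec) (auto simp: back_init_def static_n_def static_r_def)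
  have u: "?u < N" "?u div n = src I" "E ?u = U"
    using edge_less src E_loop by auto
  have test: "bval (RLess value_exp (rvar ''M'')) \<rho> \<longleftrightarrow> ?v < M"
    using levelsD(2)[OF l\<rho>] levelsD(5)[OF l\<rho> u(1)] envD(7)[OF levelsD(1)[OF l\<rho>]] \<rho>(1) u by simp
  have start: "back_inv ps (max_stops I) (exec (nset ''feasible'' (NConst 1)) \<rho>)" if "?v < M"
  proof -
    define \<tau> where "\<tau> = exec (nset ''feasible'' (NConst 1)) \<rho>"
    have l: "levels ps (max_stops I) \<tau>"
      unfolding \<tau>_def using l\<rho> by (rule levels_exec) (auto simp: static_n_def static_r_def)
    have eqs: "nmem \<tau> ''u'' 0 = ?u" "nmem \<tau> ''route'' 0 = src I" "nmem \<tau> ''length'' 0 = 1"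
      "nmem \<tau> ''feasible'' 0 = 1"
      using \<rho> by (simp_all add: \<tau>_def)
    have "out_route \<tau> = [src I]" "out_fuel \<tau> = []"
      by (simp_all add: out_route_def out_fuel_def eqs)
    then show ?thesis
      using l that u partial_way_start unfolding \<tau>_def[symmetric] back_inv_def Let_def eqs
      by (simp add: levels_def)
  qed
  have loop: "halts (While back_test back_step) \<tau> (Suc (max_stops I) * (bcost back_test + 1 + back_time))
      (back_inv ps 0)" if "back_inv ps (max_stops I) \<tau>" for \<tau>
    using that
  proof (rule halts_While[where J = "back_inv ps"])
    have t: "bval back_test \<upsilon> \<longleftrightarrow> 0 < q" if "back_inv ps q \<upsilon>" for q \<upsilon>
      using that by (simp add: back_inv_def back_test_def)
    show "\<not> bval back_test \<upsilon>" if "back_inv ps 0 \<upsilon>" for \<upsilon>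
      using t[OF that] by simp
    show "back_inv ps 0 \<upsilon>" if "back_inv ps q \<upsilon>" "\<not> bval back_test \<upsilon>" for q \<upsilon>
      using that t[OF that(1)] by simp
  qed (rule back_step)
  have fin: "correct_output I \<tau>" if "back_inv ps 0 \<tau>" for \<tau>
  proof -
    let ?w = "nmem \<tau> ''u'' 0"
    have *: "nmem \<tau> ''feasible'' 0 \<noteq> 0" "A 0 (?w div n) (U - E ?w) < M"
      "length (out_fuel \<tau>) \<le> max_stops I"
      "partial_way (out_route \<tau>) (out_fuel \<tau>) (?w div n) (U - E ?w) (?v - A 0 (?w div n) (U - E ?w))"
      using that unfolding back_inv_def Let_def by auto
    \<comment> \<open>Without stops left, a value below \<open>M\<close> occurs only at the
      destination, where it is 0; the cost of the route is then the optimum.\<close>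
    then have "?w div n = dst I" by (auto split: if_splits)
    then have "cheapest I (out_route \<tau>) (out_fuel \<tau>)"
      using * by (intro partial_way_cheapest) auto
    then show ?thesis using *(1) by (simp add: correct_output_def out_feasible_def)
  qed
  have infeasible: "correct_output I \<rho>" if "\<not> ?v < M"
    using that \<rho>(4) not_feasible_if_A_ge_M by (auto simp: correct_output_def out_feasible_def)
  show ?thesis
    unfolding back_prog_def answer_time_def block.simps
  proof (rule halts_Seq[OF halts_exec[where Q = "\<lambda>\<tau>. \<tau> = \<rho>"]])
    fix \<tau> assume [simp]: "\<tau> = \<rho>"
    let ?t = "cost (nset ''feasible'' (NConst 1)) + Suc (max_stops I) * (bcost back_test + 1 + back_time)"
    show "halts (Cond (RLess value_exp (rvar ''M'')) (Seq (nset ''feasible'' (NConst 1)) (While back_test back_step)) Skip)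
        \<tau> (bcost (RLess value_exp (rvar ''M'')) + 1 + (?t + cost Skip)) (correct_output I)"
    proof (rule halts_Cond)
      assume "bval (RLess value_exp (rvar ''M'')) \<tau>"
      then have "?v < M" using test by simp
      then show "halts (Seq (nset ''feasible'' (NConst 1)) (While back_test back_step)) \<tau> (?t + cost Skip)
          (correct_output I)"
        by (intro halts_mono[OF halts_Seq[OF halts_exec[where Q = "back_inv ps (max_stops I)"] loop]])
           (use start fin in auto)
    next
      assume "\<not> bval (RLess value_exp (rvar ''M'')) \<tau>"
      then have "\<not> ?v < M" using test by simp
      then show "halts Skip \<tau> (?t + cost Skip) (correct_output I)"
        by (intro halts_mono[OF halts_exec]) (use infeasible in auto)
    qed
  qed (simp_all add: \<rho>_def back_init_def)
qed

end

section \<open>The complete program\<close>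

text \<open>One constant, independent of the instance, that bounds the cost of every loop-free
  piece: a sum of naturals dominates each of its members.\<close>

definition max_cost :: nat where
  "max_cost = sum_list [
     bcost table_test + 1 + cost table_step, cost bound_init, bcost bound_test + 1 + cost bound_step,
     cost merge_init, bcost merge_test + 1 + cost merge_step, cost sort_next,
     cost sort_init, bcost sort_test + 1,
     cost (nset ''v'' (NConst 0)), bcost table_test + 1 + cost vertex_step,
     cost (nset ''x'' (NConst 0)), bcost edge_test + 1 + cost fill_step,
     cost sweep_init, bcost sweep_test + 1 + cost sweep_step, cost level_next,
     bcost edge_test + 1 + cost base_step, cost levels_init, bcost bound_test + 1,
     bcost edge_test + 1 + cost scan_step, cost extend_step,
     cost (nset ''e'' (NSub (nvar ''a'') (nvar ''N''))), bcost stop_test + 1, cost Skip, cost back_prev,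
     cost back_init, bcost (RLess value_exp (rvar ''M'')) + 1, cost (nset ''feasible'' (NConst 1)),
     bcost back_test + 1]"

definition gas_prog :: prog where
  "gas_prog = block [table_prog, sort_prog, levels_prog, back_prog]"

context gas_problem begin

lemma gas_prog:
  assumes R: "N \<le> 2 ^ R"
  shows "halts gas_prog (input_store I) (table_time + (sort_time N R + (levels_time + answer_time)))
    (correct_output I)"
proof -
  have sort: "halts sort_prog \<sigma> (sort_time N R) (\<lambda>\<tau>. \<exists>ps. env ps \<tau>)"
    if s: "tables \<sigma> \<and> (\<forall>y < N. nmem \<sigma> ''p'' y = y)" for \<sigma>
  proof -
    let ?ps = "\<lambda>\<tau> :: store. map (nmem \<tau> ''p'') [nmem \<tau> ''b'' 0..<nmem \<tau> ''b'' 0 + N]"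
    have "halts sort_prog \<sigma> (sort_time N R)
        (\<lambda>\<tau>. sorted (map (rmem \<sigma> ''d'') (?ps \<tau>)) \<and> set (?ps \<tau>) = {..<N})"
      using s R by (intro sort_prog) (auto simp: tables_def)
    then show ?thesis
    \<comment> \<open>\<open>sort_prog\<close> speaks only about the sorted region; the tables
      survive because sorting writes none of their arrays.\<close>
    proof (rule halts_mono[OF halts_frame])
      fix \<tau> assume t: "(sorted (map (rmem \<sigma> ''d'') (?ps \<tau>)) \<and> set (?ps \<tau>) = {..<N}) \<and>
        (\<forall>a. a \<notin> nwrites sort_prog \<longrightarrow> nmem \<tau> a = nmem \<sigma> a) \<and>
        (\<forall>a. a \<notin> rwrites sort_prog \<longrightarrow> rmem \<tau> a = rmem \<sigma> a)"
      note defs = sort_prog_def sort_init_def pass_prog_def merge_init_def merge_step_def sort_next_def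
      have "nwrites sort_prog \<inter> {''n'', ''s'', ''t'', ''Delta'', ''N'', ''row'', ''col'', ''tr'', ''dg'', ''ok''} = {}"
        and r: "rwrites sort_prog = {}"
        by (simp_all add: defs)
      then have frame: "nmem \<tau> a = nmem \<sigma> a"
        if "a \<in> {''n'', ''s'', ''t'', ''Delta'', ''N'', ''row'', ''col'', ''tr'', ''dg'', ''ok''}" for a
        using conjunct1[OF conjunct2[OF t]] that by (meson disjoint_iff)
      have "rmem \<tau> = rmem \<sigma>" using conjunct2[OF conjunct2[OF t]] r by (intro ext) simp
      then have tab: "tables \<tau>" using s unfolding tables_def by (simp add: frame)
      have "map (rmem \<sigma> ''d'') (?ps \<tau>) = map E (?ps \<tau>)"
        using s t unfolding tables_def by (intro map_cong) (auto simp del: set_map)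
      then have "sorted (map E (?ps \<tau>))" using t by (simp del: map_map map_eq_conv)
      then have "env (?ps \<tau>) \<tau>" using tab t unfolding env_def by (simp del: map_map)
      then show "\<exists>ps. env ps \<tau>" ..
    qed simp
  qed
  have levels: "halts levels_prog \<sigma> levels_time (\<lambda>\<tau>. \<exists>ps. levels ps (max_stops I) \<tau>)" if e: "\<exists>ps. env ps \<sigma>" for \<sigma>
  proof -
    obtain ps where "env ps \<sigma>" using e by blast
    then show ?thesis by (rule halts_mono[OF levels_prog]) auto
  qed
  have answer: "halts back_prog \<sigma> answer_time (correct_output I)" if "\<exists>ps. levels ps (max_stops I) \<sigma>" for \<sigma>
    using that back_prog by blast
  show ?thesis
    unfolding gas_prog_def block.simps
    by (rule halts_Seq[OF table_prog], rule halts_Seq[OF sort], assumption, rule halts_Seq[OF levels], assumption,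
        rule answer)
qed

text \<open>Constant and linear terms are absorbed by \<open>N \<ge> 1\<close> and
  \<open>n \<le> N\<close>, and \<open>max_stops I \<ge> 1\<close> pays for the work outside the
  rounds even if \<open>R = 0\<close>.\<close>

lemma gas_prog_time:
  "table_time + (sort_time N R + (levels_time + answer_time)) \<le> 100 * max_cost * (N * (max_stops I + R))"
proof -
  let ?K = max_cost and ?D = "max_stops I"
  have N: "1 \<le> N" "n \<le> N" using n_pos by (auto simp: N_def)
  have D: "1 \<le> ?D" using stops_pos by simp
  have K: "x \<le> ?K" if "x \<in> set xs" "?K = sum_list xs" for x xs
    using that member_le_sum_list[of x xs] by simp
  note K = K[OF _ max_cost_def]
  \<comment> \<open>\<open>Suc i\<close> rather than \<open>i\<close>, since the final, failing loop
    test is charged as well.\<close>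
  have loop: "Suc i * x \<le> y * j + y" if "i \<le> j" "x \<le> y" for i j x y :: nat
    using mult_le_mono[of "Suc i" "Suc j" x y] that by (simp add: mult.commute)
  have loop': "Suc (2 * i) * x \<le> y * i + y * i + y" "Suc (2 * i + 1) * x \<le> y * i + y * i + 2 * y"
    if "x \<le> y" for i x y :: nat
    using mult_le_mono2[OF that, of "Suc (2 * i)"] mult_le_mono2[OF that, of "Suc (2 * i + 1)"]
    by (simp_all add: algebra_simps)
  let ?X = "?K * (N * (?D + R))"
  have KN: "?K \<le> ?K * N" using N by simp
  have XN: "?K * N \<le> ?X" using D by simp
  have XDN: "?K * N * ?D \<le> ?X" by (simp add: algebra_simps)
  have XD: "?K * ?D \<le> ?X"
    using mult_le_mono1[OF KN, of ?D] XDN by (rule order_trans)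
  have XRN: "?K * N * Suc R \<le> ?X" using D mult_le_mono2[of 1 ?D "?K * N"] by (simp add: algebra_simps)
  have 1: "table_time \<le> 5 * ?X"
  proof -
    have "Suc N * (bcost table_test + 1 + cost table_step) \<le> ?K * N + ?K"
      "cost bound_init \<le> ?K"
      "Suc ?D * (bcost bound_test + 1 + cost bound_step) \<le> ?K * ?D + ?K"
      by (intro loop loop' K; simp)+
    then show ?thesis
      unfolding table_time_def using KN XN XD by linarith
  qed
  have pass: "pass_time N \<le> 6 * (?K * N)"
  proof -
    have "cost merge_init \<le> ?K" "Suc (2 * N + 1) * (bcost merge_test + 1 + cost merge_step) \<le> ?K * N + ?K * N + 2 * ?K"
      "cost sort_next \<le> ?K"
      by (intro loop loop' K; simp)+
    then show ?thesis
      unfolding pass_time_def using KN by linarith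
  qed
  have 2: "sort_time N R \<le> 8 * ?X"
  proof -
    have "cost sort_init \<le> ?K" "bcost sort_test + 1 \<le> ?K" by (intro K; simp)+
    then have "bcost sort_test + 1 + pass_time N \<le> 7 * (?K * N)" using pass KN by linarith
    then have "Suc R * (bcost sort_test + 1 + pass_time N) \<le> Suc R * (7 * (?K * N))"
      by (rule mult_le_mono2)
    also have "\<dots> = 7 * (?K * N * Suc R)" by (simp add: algebra_simps)
    also have "\<dots> \<le> 7 * ?X" using XRN by simp
    finally show ?thesis
      unfolding sort_time_def using \<open>cost sort_init \<le> ?K\<close> KN XN by linarith
  qed
  have level: "level_time \<le> 11 * (?K * N)"
  proof -
    have "cost (nset ''v'' (NConst 0)) \<le> ?K"
      "Suc n * (bcost table_test + 1 + cost vertex_step) \<le> ?K * N + ?K"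
      "cost (nset ''x'' (NConst 0)) \<le> ?K"
      "Suc N * (bcost edge_test + 1 + cost fill_step) \<le> ?K * N + ?K"
      "cost sweep_init \<le> ?K"
      "Suc (2 * N) * (bcost sweep_test + 1 + cost sweep_step) \<le> ?K * N + ?K * N + ?K"
      "cost level_next \<le> ?K"
      by (intro loop loop' K N(2); simp)+
    then show ?thesis
      unfolding level_time_def using KN by linarith
  qed
  have 3: "levels_time \<le> 30 * ?X"
  proof -
    have c: "cost (nset ''x'' (NConst 0)) \<le> ?K"
      "Suc N * (bcost edge_test + 1 + cost base_step) \<le> ?K * N + ?K"
      "cost levels_init \<le> ?K" "bcost bound_test + 1 \<le> ?K"
      by (intro loop loop' K; simp)+
    then have "bcost bound_test + 1 + level_time \<le> 12 * (?K * N)" using level KN by linarith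
    then have "Suc ?D * (bcost bound_test + 1 + level_time) \<le> (2 * ?D) * (12 * (?K * N))"
      using D by (intro mult_le_mono) auto
    also have "\<dots> \<le> 24 * ?X" using XDN by (simp add: algebra_simps)
    finally show ?thesis
      unfolding levels_time_def using c KN XN by linarith
  qed
  have answer: "back_time \<le> 8 * (?K * N)"
  proof -
    have "cost (nset ''x'' (NConst 0)) \<le> ?K"
      "Suc N * (bcost edge_test + 1 + cost scan_step) \<le> ?K * N + ?K"
      "cost extend_step \<le> ?K" "cost (nset ''e'' (NSub (nvar ''a'') (nvar ''N''))) \<le> ?K"
      "bcost stop_test + 1 \<le> ?K" "cost Skip \<le> ?K" "cost back_prev \<le> ?K"
      by (intro loop loop' K; simp)+
    then show ?thesis
      unfolding back_time_def stop_time_def using KN by linarith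
  qed
  have 4: "answer_time \<le> 22 * ?X"
  proof -
    have c: "cost back_init \<le> ?K" "bcost (RLess value_exp (rvar ''M'')) + 1 \<le> ?K"
      "cost (nset ''feasible'' (NConst 1)) \<le> ?K" "cost Skip \<le> ?K" "bcost back_test + 1 \<le> ?K"
      by (intro loop loop' K; simp)+
    then have "bcost back_test + 1 + back_time \<le> 9 * (?K * N)" using answer KN by linarith
    then have "Suc ?D * (bcost back_test + 1 + back_time) \<le> (2 * ?D) * (9 * (?K * N))"
      using D by (intro mult_le_mono) auto
    also have "\<dots> \<le> 18 * ?X" using XDN by (simp add: algebra_simps)
    finally show ?thesis
      unfolding answer_time_def using c KN XN by linarith
  qed
  \<comment> \<open>The four parts add up to 5 + 8 + 30 + 22 = 65, so 100 is a rounded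
    constant.\<close>
  have "table_time + (sort_time N R + (levels_time + answer_time)) \<le> 100 * ?X"
    using 1 2 3 4 by linarith
  then show ?thesis by (simp only: mult.assoc)
qed

end

theorem theorem1:
  "\<exists>(P :: prog) (C :: real). \<forall>I. valid_instance I \<longrightarrow>
     (\<exists>k \<tau>. runs P (input_store I) k \<tau> \<and> correct_output I \<tau> \<and>
        real k \<le> C * (real (max_stops I) * real (verts I) ^ 2
                      + real (verts I) ^ 2 * log 2 (real (verts I))))"
proof (intro exI[of _ gas_prog] exI[of _ "200 * real max_cost"] allI impI)
  fix I assume "valid_instance I"
  then interpret gas_problem I by unfold_locales
  define L where "L = log 2 (real n)"
  \<comment> \<open>The sorted list has n^2 entries, so the number of doublings is twice the
    logarithm of n, rounded up.\<close>
  define R where "R = nat \<lceil>2 * L\<rceil>"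
  have n: "1 \<le> real n" using n_pos by simp
  have L: "0 \<le> L" unfolding L_def using n by simp
  have R: "2 * L \<le> real R" "real R \<le> 2 * L + 1"
    unfolding R_def using L by linarith+
  have "real N = 2 powr (2 * L)"
  proof -
    have "2 powr (2 * L) = (2 powr L) ^ 2"
      by (simp add: powr_powr[symmetric] mult.commute)
    then show ?thesis
      using n by (simp add: L_def N_def power2_eq_square)
  qed
  also have "\<dots> \<le> 2 powr real R" using R by simp
  finally have "N \<le> 2 ^ R"
    by (simp add: powr_realpow)
  then obtain k \<tau> where k: "runs gas_prog (input_store I) k \<tau>" "correct_output I \<tau>"
    "k \<le> 100 * max_cost * (N * (max_stops I + R))"
    using gas_prog[of R] gas_prog_time[of R] unfolding halts_def by (meson order_trans)
  have "real k \<le> real (100 * max_cost * (N * (max_stops I + R)))"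
    using k(3) by (rule of_nat_mono)
  also have "\<dots> = 100 * real max_cost * (real n ^ 2 * (real (max_stops I) + real R))"
    by (simp add: N_def power2_eq_square)
  \<comment> \<open>Rounding up costs at most 1, which is absorbed by
    \<open>max_stops I \<ge> 1\<close>; this also covers one vertex, where the logarithm vanishes.
    The factor 2 turns 100 into 200.\<close>
  also have "\<dots> \<le> 100 * real max_cost * (real n ^ 2 * (2 * (real (max_stops I) + L)))"
    using R(2) stops_pos by (intro mult_left_mono) auto
  also have "\<dots> = 200 * real max_cost * (real (max_stops I) * real n ^ 2 + real n ^ 2 * L)"
    by (simp add: algebra_simps)
  finally show "\<exists>k \<tau>. runs gas_prog (input_store I) k \<tau> \<and> correct_output I \<tau> \<and>
      real k \<le> 200 * real max_cost * (real (max_stops I) * real n ^ 2 + real n ^ 2 * log 2 (real n))"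
    using k(1,2) unfolding L_def by blast
qed

end
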